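(* Let $F^\pm\in\mathcal E(\lambda,\Lambda)$, $f^\pm\in C(B_1^\pm)\cap L^\infty(B_1^\pm)$, $g\in C(T)$. Let $u,v:\overline{B_1}\to\mathbb R$ be, respectively, a bounded upper semicontinuous viscosity subsolution and a bounded lower semicontinuous viscosity supersolution of the flat problem $F^\pm(D^2u)=f^\pm$ in $B_1^\pm$, $u^+_{x_n}-u^-_{x_n}=g$ on $T$. If $u\le v$ on $\partial B_1$, then $u\le v$ in $B_1$.
   Context: $\mathcal E(\lambda,\Lambda)$: $F:\mathcal S^n\to\mathbb R$ with $F(0)=0$ and $\lambda\|N\|\le F(M+N)-F(M)\le\Lambda\|N\|$ for $N\ge0$. $B_1^\pm=B_1\cap\{\pm x_n>0\}$, $T=B_1\cap\{x_n=0\}$. Viscosity subsolution: USC $u$ such that for $\varphi$ touching $u$ from above at $x_0$: if $x_0\in B_1^\pm$ and $\varphi$ is $C^2$ near $x_0$, $F^\pm(D^2\varphi(x_0))\ge f^\pm(x_0)$; if $x_0\in T$ and $\varphi$ is continuous with restrictions $\varphi^\pm$ to $\overline{B_\delta(x_0)\cap\{\pm x_n>0\}}$ of class $C^2$, $\varphi^+_{x_n}(x_0)-\varphi^-_{x_n}(x_0)\ge g(x_0)$. Supersolution: LSC, touching from below, reversed inequalities. *)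

theory Defs
  imports "HOL-Analysis.Analysis"
begin

text \<open>Points of R^n are vectors of type real^'n; the distinguished ("normal")
coordinate x_n is the coordinate k :: 'n.  Matrices are real^'n^'n.\<close>

definition sym_mat :: "real^'n^'n \<Rightarrow> bool" where
  "sym_mat M \<longleftrightarrow> transpose M = M"

definition psd_mat :: "real^'n^'n \<Rightarrow> bool" where
  "psd_mat N \<longleftrightarrow> (\<forall>\<xi>. 0 \<le> \<xi> \<bullet> (N *v \<xi>))"

definition mat_norm :: "real^'n^'n \<Rightarrow> real" where
  "mat_norm N = onorm (\<lambda>x. N *v x)"

definition ellip_class :: "real \<Rightarrow> real \<Rightarrow> (real^'n^'n \<Rightarrow> real) \<Rightarrow> bool" where
  "ellip_class lam Lam F \<longleftrightarrow> 0 < lam \<and> lam \<le> Lam \<and> F 0 = 0 \<and>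
     (\<forall>M N. sym_mat M \<and> sym_mat N \<and> psd_mat N \<longrightarrow>
        lam * mat_norm N \<le> F (M + N) - F M \<and> F (M + N) - F M \<le> Lam * mat_norm N)"

definition C2_on :: "(real^'n) set \<Rightarrow> (real^'n \<Rightarrow> real) \<Rightarrow> (real^'n \<Rightarrow> real^'n)
     \<Rightarrow> (real^'n \<Rightarrow> real^'n^'n) \<Rightarrow> bool" where
  "C2_on S \<phi> G H \<longleftrightarrow> open S \<and>
     (\<forall>x\<in>S. (\<phi> has_derivative (\<lambda>h. G x \<bullet> h)) (at x) \<and>
             (G has_derivative (\<lambda>h. H x *v h)) (at x)) \<and>
     continuous_on S H"

definition usc_on :: "(real^'n) set \<Rightarrow> (real^'n \<Rightarrow> real) \<Rightarrow> bool" where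
  "usc_on S u \<longleftrightarrow> (\<forall>x\<in>S. \<forall>e>0. \<exists>d>0. \<forall>y\<in>S. dist y x < d \<longrightarrow> u y < u x + e)"

definition lsc_on :: "(real^'n) set \<Rightarrow> (real^'n \<Rightarrow> real) \<Rightarrow> bool" where
  "lsc_on S u \<longleftrightarrow> (\<forall>x\<in>S. \<forall>e>0. \<exists>d>0. \<forall>y\<in>S. dist y x < d \<longrightarrow> u x - e < u y)"

definition touch_above :: "(real^'n \<Rightarrow> real) \<Rightarrow> (real^'n \<Rightarrow> real) \<Rightarrow> real^'n \<Rightarrow> bool" where
  "touch_above \<phi> u x0 \<longleftrightarrow> \<phi> x0 = u x0 \<and> (\<exists>r>0. \<forall>x\<in>ball x0 r. u x \<le> \<phi> x)"

definition touch_below :: "(real^'n \<Rightarrow> real) \<Rightarrow> (real^'n \<Rightarrow> real) \<Rightarrow> real^'n \<Rightarrow> bool" where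
  "touch_below \<phi> u x0 \<longleftrightarrow> \<phi> x0 = u x0 \<and> (\<exists>r>0. \<forall>x\<in>ball x0 r. \<phi> x \<le> u x)"

definition Bplus :: "'n \<Rightarrow> (real^'n) set" where
  "Bplus k = {x \<in> ball 0 1. x $ k > 0}"
definition Bminus :: "'n \<Rightarrow> (real^'n) set" where
  "Bminus k = {x \<in> ball 0 1. x $ k < 0}"
definition Tflat :: "'n \<Rightarrow> (real^'n) set" where
  "Tflat k = {x \<in> ball 0 1. x $ k = 0}"

text \<open>Viscosity subsolution of  F^+(D^2u)=f^+ in B_1^+, F^-(D^2u)=f^- in B_1^-,
  u^+_{x_n} - u^-_{x_n} = g on T.  A test function on T is continuous near x0 and its
  restrictions to the closed half balls are C^2 up to the flat boundary, i.e. agree there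
  with C^2 functions phiP, phiM on the full ball; phi^{\<pm>}_{x_n}(x0) is the k-th component
  of the gradient of phiP/phiM at x0.\<close>
definition visc_sub ::
  "'n \<Rightarrow> (real^'n^'n \<Rightarrow> real) \<Rightarrow> (real^'n^'n \<Rightarrow> real) \<Rightarrow> (real^'n \<Rightarrow> real)
     \<Rightarrow> (real^'n \<Rightarrow> real) \<Rightarrow> (real^'n \<Rightarrow> real) \<Rightarrow> (real^'n \<Rightarrow> real) \<Rightarrow> bool" where
  "visc_sub k Fp Fm fp fm g u \<longleftrightarrow>
     usc_on (ball 0 1) u \<and>
     (\<forall>x0 \<phi> \<delta> G H. x0 \<in> Bplus k \<and> 0 < \<delta> \<and> C2_on (ball x0 \<delta>) \<phi> G H \<and> touch_above \<phi> u x0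
        \<longrightarrow> Fp (H x0) \<ge> fp x0) \<and>
     (\<forall>x0 \<phi> \<delta> G H. x0 \<in> Bminus k \<and> 0 < \<delta> \<and> C2_on (ball x0 \<delta>) \<phi> G H \<and> touch_above \<phi> u x0
        \<longrightarrow> Fm (H x0) \<ge> fm x0) \<and>
     (\<forall>x0 \<phi> \<delta> \<phi>P GP HP \<phi>M GM HM. x0 \<in> Tflat k \<and> 0 < \<delta> \<and>
        continuous_on (ball x0 \<delta>) \<phi> \<and>
        C2_on (ball x0 \<delta>) \<phi>P GP HP \<and> C2_on (ball x0 \<delta>) \<phi>M GM HM \<and>
        (\<forall>x \<in> closure (ball x0 \<delta> \<inter> {y. y $ k > 0}). \<phi> x = \<phi>P x) \<and>
        (\<forall>x \<in> closure (ball x0 \<delta> \<inter> {y. y $ k < 0}). \<phi> x = \<phi>M x) \<and>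
        touch_above \<phi> u x0
        \<longrightarrow> GP x0 $ k - GM x0 $ k \<ge> g x0)"

definition visc_super ::
  "'n \<Rightarrow> (real^'n^'n \<Rightarrow> real) \<Rightarrow> (real^'n^'n \<Rightarrow> real) \<Rightarrow> (real^'n \<Rightarrow> real)
     \<Rightarrow> (real^'n \<Rightarrow> real) \<Rightarrow> (real^'n \<Rightarrow> real) \<Rightarrow> (real^'n \<Rightarrow> real) \<Rightarrow> bool" where
  "visc_super k Fp Fm fp fm g v \<longleftrightarrow>
     lsc_on (ball 0 1) v \<and>
     (\<forall>x0 \<phi> \<delta> G H. x0 \<in> Bplus k \<and> 0 < \<delta> \<and> C2_on (ball x0 \<delta>) \<phi> G H \<and> touch_below \<phi> v x0
        \<longrightarrow> Fp (H x0) \<le> fp x0) \<and>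
     (\<forall>x0 \<phi> \<delta> G H. x0 \<in> Bminus k \<and> 0 < \<delta> \<and> C2_on (ball x0 \<delta>) \<phi> G H \<and> touch_below \<phi> v x0
        \<longrightarrow> Fm (H x0) \<le> fm x0) \<and>
     (\<forall>x0 \<phi> \<delta> \<phi>P GP HP \<phi>M GM HM. x0 \<in> Tflat k \<and> 0 < \<delta> \<and>
        continuous_on (ball x0 \<delta>) \<phi> \<and>
        C2_on (ball x0 \<delta>) \<phi>P GP HP \<and> C2_on (ball x0 \<delta>) \<phi>M GM HM \<and>
        (\<forall>x \<in> closure (ball x0 \<delta> \<inter> {y. y $ k > 0}). \<phi> x = \<phi>P x) \<and>
        (\<forall>x \<in> closure (ball x0 \<delta> \<inter> {y. y $ k < 0}). \<phi> x = \<phi>M x) \<and>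
        touch_below \<phi> v x0
        \<longrightarrow> GP x0 $ k - GM x0 $ k \<le> g x0)"

end

theory Submission
  imports Defs
begin

text \<open>
  If the claim fails, a strict perturbation of the subsolution minus the supersolution has a positive maximum,
  either in an open half ball or on the flat interface.

  In a half ball, replace both functions by their sup-convolutions \<open>U\<close> and \<open>W\<close> (with \<open>W\<close> built from
  \<open>- v\<close>), which are semiconvex.  The points where \<open>U + W - p \<bullet> x\<close> is maximal, for small slopes \<open>p\<close>,
  form a set of positive outer measure, because \<open>p\<close> depends on the point in a Lipschitz way.  On that
  set \<open>U\<close> and \<open>W\<close> are touched from above by \<open>h\<^sub>1\<close> and \<open>h\<^sub>2\<close>, whose second differences are bounded
  on both sides and whose sum is concave.  Instead of Alexandrov's theorem it is enough that on some small
  ball around such a point \<open>h\<^sub>1\<close> and \<open>h\<^sub>2\<close> are quadratic up to a small relative error.  This holds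
  because the \<open>L\<^sup>2\<close> norm of the second difference quotient does not increase when the step is doubled,
  so at some scale it hardly changes and third differences are small.

  At the interface, sup-convolve only in the tangential directions.  Then the tangential gradient at
  height \<open>r\<close> above the contact point is \<open>O(sqrt r)\<close>, so a value on the normal axis controls the
  function on a disc of radius \<open>K r\<close>; with a quadratic barrier this identifies the best slope of a test
  function on each side with the actual slope along the axis.  The order of the two functions along the axis
  then contradicts the strict jump condition.  A maximum of the convolved functions off the interface is
  excluded by adding \<open>B x\<^sub>k\<^sup>2\<close> with \<open>B\<close> large, for which boundedness of the right-hand sides suffices.
\<close>

section \<open>Semicontinuity and sup-convolution\<close>

text \<open>The operators depend on the Hessian alone, so paraboloids touching the two functions at
  different nearby points can still be compared. This is why a quadratic approximation on one ball
  can stand in for a common point of twice differentiability. Its error is a fixed multiple of the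
  squared lattice step, while the ball has a radius of \<open>m\<close> steps with \<open>m\<close>
  arbitrarily large; that makes the relative error small.

  The right-hand sides need not extend continuously to the interface and the operators on the two
  sides are unrelated. A full sup-convolution could move its maximizer across the interface and lose
  track of the condition holding there; shifting only tangentially preserves the normal coordinate.

  The order \<open>sqrt r\<close> arises because at height \<open>r\<close> one may move
  tangentially by \<open>sqrt r\<close> while an upper bound of the form
  \<open>a * r + C * |h|^2\<close> stays of order \<open>r\<close>. A tangential gradient of larger
  order would break that bound.\<close>

definition usc :: "'a::metric_space set \<Rightarrow> ('a \<Rightarrow> real) \<Rightarrow> bool" where
  "usc S f \<longleftrightarrow> (\<forall>x\<in>S. \<forall>e>0. \<exists>d>0. \<forall>y\<in>S. dist y x < d \<longrightarrow> f y < f x + e)"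

lemma usc_subset: "usc S f \<Longrightarrow> T \<subseteq> S \<Longrightarrow> usc T f"
  unfolding usc_def by (meson subsetD)

lemma usc_add:
  assumes "usc S f" "usc S g"
  shows "usc S (\<lambda>x. f x + g x)"
  unfolding usc_def
proof (intro ballI allI impI)
  fix x e assume x: "x \<in> S" and e: "(e::real) > 0"
  obtain d1 where d1: "d1 > 0" "\<forall>y\<in>S. dist y x < d1 \<longrightarrow> f y < f x + e/2"
    using assms(1) x e unfolding usc_def by (meson half_gt_zero)
  obtain d2 where d2: "d2 > 0" "\<forall>y\<in>S. dist y x < d2 \<longrightarrow> g y < g x + e/2"
    using assms(2) x e unfolding usc_def by (meson half_gt_zero)
  show "\<exists>d>0. \<forall>y\<in>S. dist y x < d \<longrightarrow> f y + g y < f x + g x + e"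
    using d1 d2 by (intro exI[of _ "min d1 d2"]) fastforce
qed

lemma usc_continuous:
  assumes "continuous_on S f"
  shows "usc S f"
  unfolding usc_def
proof (intro ballI allI impI)
  fix x e assume x: "x \<in> S" and e: "(e::real) > 0"
  then obtain d where d: "d > 0" "\<forall>y\<in>S. dist y x < d \<longrightarrow> dist (f y) (f x) < e"
    using assms unfolding continuous_on_iff by meson
  show "\<exists>d>0. \<forall>y\<in>S. dist y x < d \<longrightarrow> f y < f x + e"
    using d by (intro exI[of _ d]) (auto simp: dist_real_def abs_less_iff)
qed

lemma usc_compose:
  assumes "usc T f" "continuous_on S g" "g ` S \<subseteq> T"
  shows "usc S (\<lambda>x. f (g x))"
  unfolding usc_def
proof (intro ballI allI impI)
  fix x e assume x: "x \<in> S" and e: "(e::real) > 0"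
  then have "g x \<in> T" using assms(3) by auto
  then obtain d1 where d1: "d1 > 0" "\<forall>y\<in>T. dist y (g x) < d1 \<longrightarrow> f y < f (g x) + e"
    using assms(1) e unfolding usc_def by meson
  obtain d where d: "d > 0" "\<forall>y\<in>S. dist y x < d \<longrightarrow> dist (g y) (g x) < d1"
    using assms(2) x d1(1) unfolding continuous_on_iff by meson
  show "\<exists>d>0. \<forall>y\<in>S. dist y x < d \<longrightarrow> f (g y) < f (g x) + e"
    using d d1(2) assms(3) by (intro exI[of _ d]) auto
qed

lemma usc_sequentially:
  assumes f: "usc S f" and X: "\<And>j. X j \<in> S" "X \<longlonglongrightarrow> x" "x \<in> S"
    and T: "T \<longlonglongrightarrow> t" "\<And>j. T j \<le> f (X j)"
  shows "t \<le> f x"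
proof (rule field_le_epsilon)
  fix e assume e: "(e::real) > 0"
  obtain d where d: "d > 0" "\<forall>y\<in>S. dist y x < d \<longrightarrow> f y < f x + e"
    using f X(3) e unfolding usc_def by meson
  have "\<forall>\<^sub>F j in sequentially. dist (X j) x < d"
    using X(2) d(1) by (rule tendstoD)
  then have "\<forall>\<^sub>F j in sequentially. T j \<le> f x + e"
    by eventually_elim (use d(2) X(1) T(2) in \<open>smt (verit)\<close>)
  then show "t \<le> f x + e"
    using T(1) by (simp add: tendsto_upperbound)
qed

text \<open>Without a maximum, the open sets \<open>U y\<close>, on which \<open>f\<close> stays
  below \<open>f y\<close>, cover \<open>S\<close>. In a finite subcover the index with the largest
  value is itself covered, which produces an index with a larger value.\<close>

lemma usc_attains_sup:
  assumes S: "compact S" "S \<noteq> {}" and f: "usc S f"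
  shows "\<exists>x\<in>S. \<forall>y\<in>S. f y \<le> f x"
proof (rule ccontr)
  assume neg: "\<not> (\<exists>x\<in>S. \<forall>y\<in>S. f y \<le> f x)"
  define U where "U y = \<Union>{ball z d |z d. \<forall>w\<in>S. dist w z < d \<longrightarrow> f w < f y}" for y
  have op: "open (U y)" for y unfolding U_def by (intro open_Union) auto
  have "S \<subseteq> (\<Union>y\<in>S. U y)"
  proof
    fix z assume z: "z \<in> S"
    then obtain y where y: "y \<in> S" "f z < f y" using neg by (meson not_le)
    then obtain d where d: "d > 0" "\<forall>w\<in>S. dist w z < d \<longrightarrow> f w < f z + (f y - f z)"
      using f z unfolding usc_def by (meson diff_gt_0_iff_gt)
    then have "ball z d \<subseteq> U y" unfolding U_def by auto
    then have "z \<in> U y" using d(1) by auto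
    then show "z \<in> (\<Union>y\<in>S. U y)" using y by blast
  qed
  then obtain C where C: "C \<subseteq> S" "finite C" "S \<subseteq> (\<Union>y\<in>C. U y)"
    using compactE_image[OF S(1), of S U] op by metis
  then have "C \<noteq> {}" using S(2) by auto
  then have "Max (f ` C) \<in> f ` C" using C(2) by simp
  then obtain y where y: "y \<in> C" "\<forall>z\<in>C. f z \<le> f y"
    using C(2) Max_ge[of "f ` C"] by fastforce
  from y(1) obtain y' where y': "y' \<in> C" "y \<in> U y'" using C by auto
  then have "f y < f y'" unfolding U_def using y(1) C(1) by (auto simp: dist_commute)
  then show False using y y' by force
qed

text \<open>The points competing at \<open>x\<close> lie in the coset \<open>x + Z\<close>:
  \<open>Z = UNIV\<close> gives the usual sup-convolution, a hyperplane regularizes tangentially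
  only. Where the coset misses \<open>S\<close> the supremum is over the empty set, hence the set
  \<open>dom\<close> below.\<close>

definition sup_conv :: "'a::euclidean_space set \<Rightarrow> 'a set \<Rightarrow> real \<Rightarrow> ('a \<Rightarrow> real) \<Rightarrow> 'a \<Rightarrow> real" where
  "sup_conv Z S e u x = (SUP y\<in>{y\<in>S. y - x \<in> Z}. u y - (norm (x - y))\<^sup>2 / (2*e))"

locale sup_convolution =
  fixes Z S :: "'a::euclidean_space set" and e :: real and u :: "'a \<Rightarrow> real"
  assumes S: "compact S" and Z: "subspace Z" and e: "e > 0" and usc: "usc S u"
begin

definition dom where "dom = {x. \<exists>y\<in>S. y - x \<in> Z}"

abbreviation conv where "conv \<equiv> sup_conv Z S e u"

lemma Z_closed: "closed Z"
  using Z by (rule closed_subspace)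

lemma S_subset_dom: "S \<subseteq> dom"
  unfolding dom_def using subspace_0[OF Z] by force

lemma attained:
  assumes "x \<in> dom"
  shows "\<exists>y\<in>S. y - x \<in> Z \<and> conv x = u y - (norm (x - y))\<^sup>2 / (2*e) \<and>
    (\<forall>y'\<in>S. y' - x \<in> Z \<longrightarrow> u y' - (norm (x - y'))\<^sup>2 / (2*e) \<le> conv x)"
proof -
  let ?A = "{y\<in>S. y - x \<in> Z}" and ?f = "\<lambda>y. u y - (norm (x - y))\<^sup>2 / (2*e)"
  have "?A = S \<inter> (\<lambda>y. y - x) -` Z" by auto
  moreover have "closed ((\<lambda>y. y - x) -` Z)"
    using Z_closed by (intro closed_vimage continuous_intros)
  ultimately have "compact ?A" using S by (simp add: compact_Int_closed)
  moreover have "?A \<noteq> {}" using assms unfolding dom_def by auto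
  moreover have "usc ?A (\<lambda>y. u y + - ((norm (x - y))\<^sup>2 / (2*e)))"
    by (intro usc_add usc_subset[OF usc] usc_continuous continuous_intros) (use e in auto)
  ultimately obtain y where y: "y \<in> ?A" "\<forall>y'\<in>?A. ?f y' \<le> ?f y"
    using usc_attains_sup[of ?A ?f] by auto
  then have "conv x = ?f y"
    unfolding sup_conv_def by (intro cSup_eq_maximum) auto
  then show ?thesis using y by auto
qed

lemma upper:
  assumes "y \<in> S" "y - x \<in> Z"
  shows "u y - (norm (x - y))\<^sup>2 / (2*e) \<le> conv x"
  using attained[of x] assms unfolding dom_def by auto

definition arg where
  "arg x = (SOME y. y \<in> S \<and> y - x \<in> Z \<and> conv x = u y - (norm (x - y))\<^sup>2 / (2*e))"

lemma arg:
  assumes "x \<in> dom"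
  shows "arg x \<in> S" "arg x - x \<in> Z" "conv x = u (arg x) - (norm (x - arg x))\<^sup>2 / (2*e)"
proof -
  have "arg x \<in> S \<and> arg x - x \<in> Z \<and> conv x = u (arg x) - (norm (x - arg x))\<^sup>2 / (2*e)"
    unfolding arg_def by (rule someI_ex) (use attained[OF assms] in blast)
  then show "arg x \<in> S" "arg x - x \<in> Z" "conv x = u (arg x) - (norm (x - arg x))\<^sup>2 / (2*e)"
    by auto
qed

lemma ge: "x \<in> S \<Longrightarrow> u x \<le> conv x"
  using upper[of x x] subspace_0[OF Z] by simp

text \<open>The maximizer \<open>arg x\<close> still competes at \<open>x + z\<close>, and expanding
  the square puts a paraboloid below \<open>conv\<close>. This is semiconvexity in the directions of
  \<open>Z\<close>, with an explicit slope.\<close>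

lemma lower_paraboloid:
  assumes "x \<in> dom" "z \<in> Z"
  shows "conv x + ((1/e) *\<^sub>R (arg x - x)) \<bullet> z - (norm z)\<^sup>2 / (2*e) \<le> conv (x + z)"
proof -
  let ?y = "arg x"
  have "?y - (x + z) \<in> Z"
    using subspace_diff[OF Z arg(2)[OF assms(1)] assms(2)] by (simp add: algebra_simps)
  from upper[OF arg(1)[OF assms(1)] this]
  have "u ?y - (norm (x + z - ?y))\<^sup>2 / (2*e) \<le> conv (x + z)" .
  moreover have "(norm (x + z - ?y))\<^sup>2 = (norm (x - ?y))\<^sup>2 + (norm z)\<^sup>2 - 2 * ((?y - x) \<bullet> z)"
    unfolding power2_norm_eq_inner by (simp add: algebra_simps inner_commute)
  ultimately have "u ?y - ((norm (x - ?y))\<^sup>2 + (norm z)\<^sup>2 - 2 * ((?y - x) \<bullet> z)) / (2*e) \<le> conv (x + z)"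
    by simp
  moreover have "((1/e) *\<^sub>R (?y - x)) \<bullet> z = 2 * ((?y - x) \<bullet> z) / (2*e)" using e by simp
  ultimately show ?thesis
    using arg(3)[OF assms(1)] by (simp add: add_divide_distrib diff_divide_distrib)
qed

text \<open>Shifting a point and its maximizer by the same \<open>h\<close> leaves the penalty
  unchanged. Hence a function touching \<open>conv\<close> from above at \<open>x\<close> can be
  translated so that it touches \<open>u\<close> at \<open>arg x\<close>; this holds for all
  directions \<open>h\<close>, not only those in \<open>Z\<close>.\<close>

lemma increment:
  assumes "x \<in> dom" "arg x + h \<in> S"
  shows "u (arg x + h) - u (arg x) \<le> conv (x + h) - conv x"
proof -
  have "arg x + h - (x + h) \<in> Z" using arg(2)[OF assms(1)] by simp
  from upper[OF assms(2) this] show ?thesis using arg(3)[OF assms(1)] by simp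
qed

lemma arg_near:
  assumes "x \<in> S" "\<And>y. y \<in> S \<Longrightarrow> \<bar>u y\<bar> \<le> M"
  shows "(norm (x - arg x))\<^sup>2 \<le> 4 * e * M"
proof -
  have x: "x \<in> dom" using assms S_subset_dom by auto
  have "u x \<le> u (arg x) - (norm (x - arg x))\<^sup>2 / (2*e)" using ge[OF assms(1)] arg(3)[OF x] by simp
  moreover have "u (arg x) \<le> M" "- M \<le> u x"
    using assms(2)[OF arg(1)[OF x]] assms(2)[OF assms(1)] by auto
  ultimately have "(norm (x - arg x))\<^sup>2 / (2*e) \<le> 2 * M" by linarith
  then show ?thesis using e by (simp add: field_simps)
qed

lemma conv_le:
  assumes "x \<in> dom" "\<And>y. y \<in> S \<Longrightarrow> u y \<le> M"
  shows "conv x \<le> M"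
proof -
  have "(norm (x - arg x))\<^sup>2 / (2*e) \<ge> 0" using e by simp
  then show ?thesis using arg(1,3)[OF assms(1)] assms(2) by (smt (verit))
qed

text \<open>If the values stayed too large along a sequence tending to \<open>x\<close>, a limit of
  maximizers would lie in \<open>S\<close> and in the closed coset \<open>x + Z\<close>, and would
  beat the supremum at \<open>x\<close>.\<close>

lemma usc_conv: "usc dom conv"
  unfolding usc_def
proof (rule ccontr)
  assume "\<not> (\<forall>x\<in>dom. \<forall>e>0. \<exists>d>0. \<forall>y\<in>dom. dist y x < d \<longrightarrow> conv y < conv x + e)"
  then obtain x q where x: "x \<in> dom" "q > 0"
    and "\<And>d. d > 0 \<Longrightarrow> \<exists>y\<in>dom. dist y x < d \<and> conv x + q \<le> conv y"
    by (meson not_le)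
  then have "\<exists>y\<in>dom. dist y x < inverse (real (Suc j)) \<and> conv x + q \<le> conv y" for j by simp
  then obtain X where X: "\<And>j. X j \<in> dom" "\<And>j. dist (X j) x < inverse (real (Suc j))"
    "\<And>j. conv x + q \<le> conv (X j)" by metis
  have "(\<lambda>j. dist (X j) x) \<longlonglongrightarrow> 0"
    by (rule Lim_null_comparison[OF _ LIMSEQ_inverse_real_of_nat])
      (use X(2) in \<open>auto intro!: always_eventually simp: less_imp_le\<close>)
  then have Xx: "X \<longlonglongrightarrow> x" using tendsto_dist_iff by blast
  obtain r y where r: "strict_mono r" "y \<in> S" "((\<lambda>j. arg (X j)) \<circ> r) \<longlonglongrightarrow> y"
    using S arg(1)[OF X(1)] unfolding compact_def by (metis (no_types, lifting))
  have Xr: "(\<lambda>j. X (r j)) \<longlonglongrightarrow> x" using LIMSEQ_subseq_LIMSEQ[OF Xx r(1)] by (simp add: o_def)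
  have ar: "(\<lambda>j. arg (X (r j))) \<longlonglongrightarrow> y" using r(3) by (simp add: o_def)
  have "y - x \<in> Z"
    by (rule closed_sequentially[OF Z_closed _ tendsto_diff[OF ar Xr]]) (use arg(2)[OF X(1)] in auto)
  have "conv x + q + (norm (x - y))\<^sup>2 / (2*e) \<le> u y"
  proof (rule usc_sequentially[OF usc _ ar r(2)])
    show "(\<lambda>j. conv x + q + (norm (X (r j) - arg (X (r j))))\<^sup>2 / (2*e))
        \<longlonglongrightarrow> conv x + q + (norm (x - y))\<^sup>2 / (2*e)"
      by (intro tendsto_intros Xr ar) (use e in auto)
    show "conv x + q + (norm (X (r j) - arg (X (r j))))\<^sup>2 / (2*e) \<le> u (arg (X (r j)))" for j
      using arg(3)[OF X(1)[of "r j"]] X(3)[of "r j"] by linarith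
  qed (use arg(1)[OF X(1)] in auto)
  then show False using upper[OF r(2) \<open>y - x \<in> Z\<close>] x(2) by simp
qed

end

section \<open>Doubling of variables and maxima of sums of sup-convolutions\<close>

lemma doubling_identity:
  fixes a y z p :: "'a::real_inner"
  assumes "e > 0"
  shows "((norm (a - y))\<^sup>2 + (norm (a - z))\<^sup>2) / (2*e) + p \<bullet> a =
    (norm (y - z))\<^sup>2 / (4*e) + p \<bullet> ((1/2) *\<^sub>R (y + z)) - e * (norm p)\<^sup>2 / 4
    + (norm (a - ((1/2) *\<^sub>R (y + z) - (e/2) *\<^sub>R p)))\<^sup>2 / e"
proof -
  \<comment> \<open>Completing the square in \<open>a\<close>: first around the midpoint
    \<open>m\<close> of \<open>y\<close> and \<open>z\<close>, then including the linear term, which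
    moves the minimizer to \<open>m - (e/2) *\<^sub>R p\<close>.\<close>
  define m where "m = (1/2) *\<^sub>R (y + z)"
  have y: "y = 2 *\<^sub>R m - z" unfolding m_def by simp
  have 1: "(norm (a - y))\<^sup>2 + (norm (a - z))\<^sup>2 = (norm (y - z))\<^sup>2 / 2 + 2 * (norm (a - m))\<^sup>2"
    unfolding y power2_norm_eq_inner by (simp add: algebra_simps inner_commute diff_divide_distrib add_divide_distrib)
  have 2: "(norm (a - (m - (e/2) *\<^sub>R p)))\<^sup>2 = (norm (a - m))\<^sup>2 + e * (p \<bullet> a) - e * (p \<bullet> m) + e\<^sup>2 * (norm p)\<^sup>2 / 4"
    unfolding power2_norm_eq_inner by (simp add: algebra_simps inner_commute power2_eq_square)
  show ?thesis
    unfolding m_def[symmetric] 1 2 using assms by (simp add: field_simps power2_eq_square)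
qed

text \<open>Interchanging suprema reduces the maximization of the convolved sum minus
  \<open>p\<close> to the doubled functional in \<open>y\<close> and \<open>z\<close>, and
  \<open>doubling_identity\<close> names the optimal point \<open>x\<close>. So a contact point
  exists for every slope \<open>p\<close> by compactness in \<open>y\<close> and
  \<open>z\<close>.\<close>

lemma sup_conv_sum_max:
  fixes u w :: "'a::euclidean_space \<Rightarrow> real"
  assumes U: "sup_convolution Z S e u" and W: "sup_convolution Z S e w" and p: "p \<in> Z"
    and yz: "y \<in> S" "z \<in> S" "y - z \<in> Z"
    and max: "\<And>y' z'. y' \<in> S \<Longrightarrow> z' \<in> S \<Longrightarrow> y' - z' \<in> Z \<Longrightarrow>
      u y' + w z' - (norm (y' - z'))\<^sup>2 / (4*e) - p \<bullet> ((1/2) *\<^sub>R (y' + z'))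
      \<le> u y + w z - (norm (y - z))\<^sup>2 / (4*e) - p \<bullet> ((1/2) *\<^sub>R (y + z))"
    and x: "x = (1/2) *\<^sub>R (y + z) - (e/2) *\<^sub>R p" and x': "x' \<in> sup_convolution.dom Z S"
  shows "sup_conv Z S e u x' + sup_conv Z S e w x' - p \<bullet> x'
    \<le> sup_conv Z S e u x + sup_conv Z S e w x - p \<bullet> x"
proof -
  interpret U: sup_convolution Z S e u by fact
  interpret W: sup_convolution Z S e w by fact
  have e: "e > 0" by (rule U.e)
  define y' z' where "y' = U.arg x'" and "z' = W.arg x'"
  note a = U.arg[OF x', folded y'_def] W.arg[OF x', folded z'_def]
  have "y' - z' \<in> Z" using subspace_diff[OF U.Z a(2) a(5)] by simp
  from max[OF a(1) a(4) this]
  have m: "u y' + w z' - (norm (y' - z'))\<^sup>2 / (4*e) - p \<bullet> ((1/2) *\<^sub>R (y' + z'))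
      \<le> u y + w z - (norm (y - z))\<^sup>2 / (4*e) - p \<bullet> ((1/2) *\<^sub>R (y + z))" .
  have "y - x = (1/2) *\<^sub>R (y - z) + (e/2) *\<^sub>R p"
    unfolding x by (simp add: algebra_simps flip: scaleR_add_left)
  then have yx: "y - x \<in> Z" using yz(3) p U.Z by (simp add: subspace_add subspace_scale)
  have "z - x = - (1/2) *\<^sub>R (y - z) + (e/2) *\<^sub>R p"
    unfolding x by (simp add: algebra_simps flip: scaleR_add_left)
  then have zx: "z - x \<in> Z" using yz(3) p U.Z by (metis subspace_add subspace_scale)
  have "sup_conv Z S e u x' + sup_conv Z S e w x' - p \<bullet> x'
      = u y' + w z' - (((norm (x' - y'))\<^sup>2 + (norm (x' - z'))\<^sup>2) / (2*e) + p \<bullet> x')"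
    unfolding a(3) a(6) by (simp add: add_divide_distrib)
  also have "\<dots> \<le> u y' + w z' - ((norm (y' - z'))\<^sup>2 / (4*e) + p \<bullet> ((1/2) *\<^sub>R (y' + z')) - e * (norm p)\<^sup>2 / 4)"
    unfolding doubling_identity[OF e] using e by simp
  also have "\<dots> \<le> u y + w z - ((norm (y - z))\<^sup>2 / (4*e) + p \<bullet> ((1/2) *\<^sub>R (y + z)) - e * (norm p)\<^sup>2 / 4)"
    using m by simp
  also have "\<dots> = u y + w z - (((norm (x - y))\<^sup>2 + (norm (x - z))\<^sup>2) / (2*e) + p \<bullet> x)"
    unfolding doubling_identity[OF e] x[symmetric] by simp
  also have "\<dots> \<le> sup_conv Z S e u x + sup_conv Z S e w x - p \<bullet> x"
    using U.upper[OF yz(1) yx] W.upper[OF yz(2) zx] by (simp add: add_divide_distrib)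
  finally show ?thesis .
qed

lemma doubling_attained:
  fixes u w :: "'a::euclidean_space \<Rightarrow> real"
  assumes S: "compact S" "S \<noteq> {}" and Z: "subspace Z" and u: "usc S u" and w: "usc S w" and e: "e > 0"
  shows "\<exists>y\<in>S. \<exists>z\<in>S. y - z \<in> Z \<and> (\<forall>y'\<in>S. \<forall>z'\<in>S. y' - z' \<in> Z \<longrightarrow>
      u y' + w z' - (norm (y' - z'))\<^sup>2 / (4*e) - p \<bullet> ((1/2) *\<^sub>R (y' + z'))
      \<le> u y + w z - (norm (y - z))\<^sup>2 / (4*e) - p \<bullet> ((1/2) *\<^sub>R (y + z)))"
proof -
  let ?A = "{q \<in> S \<times> S. fst q - snd q \<in> Z}"
  let ?f = "\<lambda>q. (u (fst q) + w (snd q)) + (- (norm (fst q - snd q))\<^sup>2 / (4*e) - p \<bullet> ((1/2) *\<^sub>R (fst q + snd q)))"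
  have "?A = (S \<times> S) \<inter> (\<lambda>q. fst q - snd q) -` Z" by auto
  moreover have "closed ((\<lambda>q::'a\<times>'a. fst q - snd q) -` Z)"
    using closed_subspace[OF Z] by (intro closed_vimage continuous_intros)
  ultimately have "compact ?A" using compact_Times[OF S(1) S(1)] by (metis compact_Int_closed)
  moreover obtain s where "s \<in> S" using S(2) by auto
  then have "(s, s) \<in> ?A" using subspace_0[OF Z] by auto
  then have "?A \<noteq> {}" by blast
  moreover have "usc ?A ?f"
    by (intro usc_add usc_compose[OF u] usc_compose[OF w] usc_continuous continuous_intros) (use e in auto)
  ultimately obtain q where "q \<in> ?A" "\<forall>q'\<in>?A. ?f q' \<le> ?f q"
    using usc_attains_sup[of ?A ?f] by blast
  then show ?thesis
    by (intro bexI[of _ "fst q"] bexI[of _ "snd q"]) (fastforce simp: algebra_simps)+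
qed

text \<open>As \<open>e\<close> tends to 0 the penalty forces \<open>y\<close> and \<open>z\<close>
  together and the slope vanishes, so a limit of pairs at least as good as \<open>(xb, xb)\<close>
  is a diagonal maximizer, which strictness identifies as \<open>xb\<close>. Arguing by
  contradiction gives a threshold uniform in \<open>p\<close> and in the pair.\<close>

lemma doubling_near:
  fixes u w :: "'a::euclidean_space \<Rightarrow> real"
  assumes S: "compact S" and u: "usc S u" and w: "usc S w" and xb: "xb \<in> S"
    and M: "\<And>y. y \<in> S \<Longrightarrow> \<bar>u y\<bar> \<le> M" "\<And>y. y \<in> S \<Longrightarrow> \<bar>w y\<bar> \<le> M"
    and strict: "\<And>y. y \<in> S \<Longrightarrow> y \<noteq> xb \<Longrightarrow> u y + w y < u xb + w xb" and kap: "kap > 0"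
  shows "\<exists>e0>0. \<forall>e p y z. 0 < e \<and> e \<le> e0 \<and> norm p \<le> e \<and> y \<in> S \<and> z \<in> S \<and>
    u xb + w xb - p \<bullet> xb \<le> u y + w z - (norm (y - z))\<^sup>2 / (4*e) - p \<bullet> ((1/2) *\<^sub>R (y + z)) \<longrightarrow>
    dist y xb < kap \<and> dist z xb < kap"
proof (rule ccontr)
  assume neg: "\<not> ?thesis"
  have "\<exists>e p y z. 0 < e \<and> e \<le> inverse (real (Suc j)) \<and> norm p \<le> e \<and> y \<in> S \<and> z \<in> S \<and>
    u xb + w xb - p \<bullet> xb \<le> u y + w z - (norm (y - z))\<^sup>2 / (4*e) - p \<bullet> ((1/2) *\<^sub>R (y + z)) \<and>
    \<not> (dist y xb < kap \<and> dist z xb < kap)" for j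
    using neg by (metis inverse_positive_iff_positive of_nat_0_less_iff zero_less_Suc)
  then obtain E P Y W where
    E: "\<And>j. 0 < E j" "\<And>j. E j \<le> inverse (real (Suc j))" and P: "\<And>j. norm (P j :: 'a) \<le> E j"
    and YW: "\<And>j. Y j \<in> S" "\<And>j. W j \<in> S"
    and ineq: "\<And>j. u xb + w xb - P j \<bullet> xb \<le> u (Y j) + w (W j) - (norm (Y j - W j))\<^sup>2 / (4*E j) - P j \<bullet> ((1/2) *\<^sub>R (Y j + W j))"
    and far: "\<And>j. \<not> (dist (Y j) xb < kap \<and> dist (W j) xb < kap)"
    by metis
  obtain R where R: "\<And>y. y \<in> S \<Longrightarrow> norm y \<le> R"
    using compact_imp_bounded[OF S] unfolding bounded_iff by auto
  obtain r l where r: "strict_mono (r::nat\<Rightarrow>nat)" "l \<in> S \<times> S" "((\<lambda>j. (Y j, W j)) \<circ> r) \<longlonglongrightarrow> l"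
    using compact_Times[OF S S] YW unfolding compact_def by (metis (no_types, lifting) SigmaI)
  obtain y z where l: "l = (y, z)" by force
  have Y: "(\<lambda>j. Y (r j)) \<longlonglongrightarrow> y" and W: "(\<lambda>j. W (r j)) \<longlonglongrightarrow> z"
    using tendsto_fst[OF r(3)] tendsto_snd[OF r(3)] unfolding l by (simp_all add: o_def)
  have yz: "y \<in> S" "z \<in> S" using r(2) l by auto
  have E0: "E \<longlonglongrightarrow> 0"
    by (rule Lim_null_comparison[OF _ LIMSEQ_inverse_real_of_nat])
      (use E in \<open>auto intro!: always_eventually simp: less_imp_le abs_of_pos\<close>)
  have P0: "P \<longlonglongrightarrow> 0"
    by (rule Lim_null_comparison[OF _ E0]) (use P in auto)
  have Er: "(\<lambda>j. E (r j)) \<longlonglongrightarrow> 0" and Pr: "(\<lambda>j. P (r j)) \<longlonglongrightarrow> 0"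
    using LIMSEQ_subseq_LIMSEQ[OF E0 r(1)] LIMSEQ_subseq_LIMSEQ[OF P0 r(1)] by (simp_all add: o_def)
  \<comment> \<open>The penalty is at most \<open>4*M + 2*R\<close>: four values of \<open>u\<close>
    and \<open>w\<close>, and the variation of the linear term, whose slope has norm at most
    \<open>E j \<le> 1\<close>.\<close>
  have bd: "(norm (Y j - W j))\<^sup>2 \<le> 4 * E j * (4*M + 2*R)" for j
  proof -
    have E1: "E j \<le> 1" using E(2)[of j] by (rule order_trans) (simp add: divide_simps)
    have "P j \<bullet> (xb - (1/2) *\<^sub>R (Y j + W j)) \<le> norm (P j) * norm (xb - (1/2) *\<^sub>R (Y j + W j))"
      by (rule norm_cauchy_schwarz)
    also have "\<dots> \<le> 1 * (2 * R)"
    proof (rule mult_mono)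
      show "norm (P j) \<le> 1" using P E1 order_trans by blast
      have "norm (xb - (1/2) *\<^sub>R (Y j + W j)) \<le> norm xb + norm ((1/2) *\<^sub>R (Y j + W j))"
        by (rule norm_triangle_ineq4)
      also have "\<dots> \<le> R + (R + R)/2"
        using R[OF xb] R[OF YW(1)[of j]] R[OF YW(2)[of j]] norm_triangle_ineq[of "Y j" "W j"] by simp
      finally show "norm (xb - (1/2) *\<^sub>R (Y j + W j)) \<le> 2 * R" by simp
    qed auto
    finally have "P j \<bullet> xb - P j \<bullet> ((1/2) *\<^sub>R (Y j + W j)) \<le> 2 * R" by (simp add: inner_diff_right)
    then have "(norm (Y j - W j))\<^sup>2 / (4*E j) \<le> 4*M + 2*R"
      using ineq[of j] M(1)[OF YW(1)[of j]] M(2)[OF YW(2)[of j]] M(1)[OF xb] M(2)[OF xb] by linarith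
    then show ?thesis using E(1)[of j] by (simp add: divide_le_eq mult.commute)
  qed
  have "(\<lambda>j. 4 * E (r j) * (4*M + 2*R)) \<longlonglongrightarrow> 4 * 0 * (4*M + 2*R)"
    by (intro tendsto_intros Er)
  moreover have "(\<lambda>j. (norm (Y (r j) - W (r j)))\<^sup>2) \<longlonglongrightarrow> (norm (y - z))\<^sup>2"
    by (intro tendsto_intros Y W)
  ultimately have "(norm (y - z))\<^sup>2 \<le> 4 * 0 * (4*M + 2*R)"
    using bd by (meson LIMSEQ_le)
  then have [simp]: "z = y" by simp
  have "u xb + w xb \<le> u y + w y"
  proof -
    let ?T = "\<lambda>j. u xb + w xb - P (r j) \<bullet> xb + P (r j) \<bullet> ((1/2) *\<^sub>R (Y (r j) + W (r j)))"
    have "?T \<longlonglongrightarrow> u xb + w xb - 0 \<bullet> xb + 0 \<bullet> ((1/2) *\<^sub>R (y + z))"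
      by (intro tendsto_intros Pr Y W)
    then have T: "?T \<longlonglongrightarrow> u xb + w xb" by simp
    have us: "usc (S \<times> S) (\<lambda>q. u (fst q) + w (snd q))"
      by (intro usc_add usc_compose[OF u] usc_compose[OF w] continuous_intros) auto
    have "u xb + w xb \<le> u (fst (y, z)) + w (snd (y, z))"
    proof (rule usc_sequentially[OF us _ _ _ T])
      show "(\<lambda>j. (Y (r j), W (r j))) \<longlonglongrightarrow> (y, z)" by (intro tendsto_intros Y W)
      show "?T j \<le> u (fst (Y (r j), W (r j))) + w (snd (Y (r j), W (r j)))" for j
      proof -
        have "(norm (Y (r j) - W (r j)))\<^sup>2 / (4*E (r j)) \<ge> 0" using E(1)[of "r j"] by simp
        then show ?thesis using ineq[of "r j"] by simp
      qed
    qed (use YW yz in auto)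
    then show ?thesis by simp
  qed
  then have "y = xb" using strict[OF yz(1)] by force
  then have "\<forall>\<^sub>F j in sequentially. dist (Y (r j)) xb < kap" "\<forall>\<^sub>F j in sequentially. dist (W (r j)) xb < kap"
    using tendstoD[OF Y kap] tendstoD[OF W kap] by simp_all
  then have "\<forall>\<^sub>F j in sequentially. False"
    by eventually_elim (use far in blast)
  then show False by simp
qed

section \<open>Concave envelopes and interpolation by functions with two-sided Hessian bounds\<close>

definition semiconvex :: "real \<Rightarrow> ('a::euclidean_space \<Rightarrow> real) \<Rightarrow> bool" where
  "semiconvex c f \<longleftrightarrow> convex_on UNIV (\<lambda>x. f x + c/2 * (norm x)\<^sup>2)"

lemma norm_convex_combination:
  fixes x y :: "'a::real_inner"
  shows "l * (norm x)\<^sup>2 + (1 - l) * (norm y)\<^sup>2 - (norm (l *\<^sub>R x + (1 - l) *\<^sub>R y))\<^sup>2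
    = l * (1 - l) * (norm (x - y))\<^sup>2"
  unfolding power2_norm_eq_inner
  by (simp add: algebra_simps inner_commute power2_eq_square)

lemma semiconvex_iff:
  "semiconvex c f \<longleftrightarrow> (\<forall>x y l. 0 \<le> l \<and> l \<le> 1 \<longrightarrow>
     f (l *\<^sub>R x + (1 - l) *\<^sub>R y) \<le> l * f x + (1 - l) * f y + c/2 * (l * (1 - l) * (norm (x - y))\<^sup>2))"
proof -
  have eq: "f (l *\<^sub>R x + (1 - l) *\<^sub>R y) + c/2 * (norm (l *\<^sub>R x + (1 - l) *\<^sub>R y))\<^sup>2
      \<le> l * (f x + c/2 * (norm x)\<^sup>2) + (1 - l) * (f y + c/2 * (norm y)\<^sup>2) \<longleftrightarrow>
      f (l *\<^sub>R x + (1 - l) *\<^sub>R y) \<le> l * f x + (1 - l) * f y + c/2 * (l * (1 - l) * (norm (x - y))\<^sup>2)" for x y l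
    unfolding norm_convex_combination[symmetric] by (simp add: algebra_simps diff_divide_distrib add_divide_distrib)
  show ?thesis
    unfolding semiconvex_def convex_on_def eq[symmetric]
    by (auto simp: convex_def) (metis add_diff_cancel_left' diff_ge_0_iff_ge)
qed

lemma semiconvex_add: "semiconvex c f \<Longrightarrow> semiconvex d g \<Longrightarrow> semiconvex (c + d) (\<lambda>x. f x + g x)"
  unfolding semiconvex_def by (drule (1) convex_on_add) (simp add: algebra_simps add_divide_distrib)

text \<open>Evaluate the paraboloid at a convex combination \<open>m\<close> in both end points and
  average: the linear terms cancel, and \<open>l * (1 - l)^2 + (1 - l) * l^2 = l * (1 - l)\<close>
  gives the right constant.\<close>

lemma semiconvex_touching:
  assumes "\<And>x. \<exists>p. \<forall>z. f x + p \<bullet> z - c/2 * (norm z)\<^sup>2 \<le> f (x + z)"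
  shows "semiconvex c f"
  unfolding semiconvex_iff
proof (intro allI impI)
  fix x y :: 'a and l :: real assume l: "0 \<le> l \<and> l \<le> 1"
  define m where "m = l *\<^sub>R x + (1 - l) *\<^sub>R y"
  obtain p where p: "\<And>z. f m + p \<bullet> z - c/2 * (norm z)\<^sup>2 \<le> f (m + z)" using assms by metis
  have x: "x = m + (1 - l) *\<^sub>R (x - y)" and y: "y = m + (- l) *\<^sub>R (x - y)"
    unfolding m_def by (simp_all add: algebra_simps)
  have 1: "f m + (1 - l) * (p \<bullet> (x - y)) - c/2 * ((1 - l)\<^sup>2 * (norm (x - y))\<^sup>2) \<le> f x"
    using p[of "(1 - l) *\<^sub>R (x - y)"] x by (simp add: power_mult_distrib)
  have 2: "f m - l * (p \<bullet> (x - y)) - c/2 * (l\<^sup>2 * (norm (x - y))\<^sup>2) \<le> f y"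
    using p[of "(- l) *\<^sub>R (x - y)"] y by (simp add: power_mult_distrib)
  have "l * (f m + (1 - l) * (p \<bullet> (x - y)) - c/2 * ((1 - l)\<^sup>2 * (norm (x - y))\<^sup>2))
     + (1 - l) * (f m - l * (p \<bullet> (x - y)) - c/2 * (l\<^sup>2 * (norm (x - y))\<^sup>2)) \<le> l * f x + (1 - l) * f y"
    using l by (intro add_mono mult_left_mono 1 2) auto
  then show "f (l *\<^sub>R x + (1 - l) *\<^sub>R y) \<le> l * f x + (1 - l) * f y + c/2 * (l * (1 - l) * (norm (x - y))\<^sup>2)"
    unfolding m_def[symmetric] by (simp add: algebra_simps power2_eq_square diff_divide_distrib add_divide_distrib)
qed

text \<open>Points of the hull stand for convex combinations of values of \<open>s\<close>.
  Properties of the envelope are proved for hull points by \<open>hull_minimal\<close> and then pass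
  to the supremum.\<close>

definition hypo_hull :: "('a::euclidean_space \<Rightarrow> real) \<Rightarrow> ('a \<times> real) set" where
  "hypo_hull s = convex hull {q. snd q \<le> s (fst q)}"

definition concave_env :: "('a::euclidean_space \<Rightarrow> real) \<Rightarrow> 'a \<Rightarrow> real" where
  "concave_env s x = Sup {t. (x, t) \<in> hypo_hull s}"

lemma hypo_hull_le:
  assumes g: "concave_on UNIV g" "\<And>x. s x \<le> g x" and q: "(x, t) \<in> hypo_hull s"
  shows "t \<le> g x"
proof -
  have "convex {q. snd q \<le> g (fst q)}"
    unfolding convex_def
  proof (clarify, simp)
    fix x1 x2 t1 t2 and u v :: real
    assume *: "t1 \<le> g x1" "t2 \<le> g x2" "0 \<le> u" "0 \<le> v" "u + v = 1"
    have "u * t1 + v * t2 \<le> u * g x1 + v * g x2" using * by (intro add_mono mult_left_mono) auto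
    also have "\<dots> \<le> g (u *\<^sub>R x1 + v *\<^sub>R x2)"
      using g(1) * unfolding concave_on_iff by auto
    finally show "u * t1 + v * t2 \<le> g (u *\<^sub>R x1 + v *\<^sub>R x2)" .
  qed
  moreover have "{q. snd q \<le> s (fst q)} \<subseteq> {q. snd q \<le> g (fst q)}" using g(2) order_trans by blast
  ultimately have "hypo_hull s \<subseteq> {q. snd q \<le> g (fst q)}"
    unfolding hypo_hull_def by (rule hull_minimal[rotated])
  then show ?thesis using q by auto
qed

lemma hypo_hull_self: "(x, s x) \<in> hypo_hull s"
  unfolding hypo_hull_def by (rule hull_inc) simp

text \<open>The concave majorant \<open>g\<close> keeps the vertical fibres of the hull bounded
  above, so that the supremum in \<open>concave_env\<close> is a genuine one.\<close>

context
  fixes s g :: "'a::euclidean_space \<Rightarrow> real"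
  assumes g: "concave_on UNIV g" "\<And>x. s x \<le> g x"
begin

lemma concave_env_upper: "(x, t) \<in> hypo_hull s \<Longrightarrow> t \<le> concave_env s x"
  unfolding concave_env_def
  by (rule cSup_upper) (auto intro!: bdd_aboveI2[of _ _ "g x"] bdd_aboveI[of _ "g x"] hypo_hull_le[OF g])

lemma concave_env_least:
  assumes "\<And>t. (x, t) \<in> hypo_hull s \<Longrightarrow> t \<le> b"
  shows "concave_env s x \<le> b"
  unfolding concave_env_def by (rule cSup_least) (use hypo_hull_self assms in auto)

lemma concave_env_ge: "s x \<le> concave_env s x"
  by (rule concave_env_upper[OF hypo_hull_self])

lemma concave_env_le: "concave_on UNIV k \<Longrightarrow> (\<And>x. s x \<le> k x) \<Longrightarrow> concave_env s x \<le> k x"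
  by (rule concave_env_least) (rule hypo_hull_le)

lemma concave_env_approx:
  assumes "r > 0"
  shows "\<exists>t. (x, t) \<in> hypo_hull s \<and> concave_env s x - r < t"
proof -
  have "concave_env s x - r < Sup {t. (x, t) \<in> hypo_hull s}"
    unfolding concave_env_def[symmetric] using assms by simp
  then show ?thesis
    using hypo_hull_self less_cSupD[of "{t. (x, t) \<in> hypo_hull s}"] by blast
qed

lemma concave_env_concave: "concave_on UNIV (concave_env s)"
  unfolding concave_on_iff
proof (intro conjI convex_UNIV ballI allI impI)
  fix x y and u v :: real assume *: "0 \<le> u" "0 \<le> v" "u + v = 1"
  show "u * concave_env s x + v * concave_env s y \<le> concave_env s (u *\<^sub>R x + v *\<^sub>R y)"
  proof (rule field_le_epsilon)
    fix r :: real assume r: "r > 0"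
    obtain t1 t2 where t: "(x, t1) \<in> hypo_hull s" "concave_env s x - r < t1"
      "(y, t2) \<in> hypo_hull s" "concave_env s y - r < t2" using concave_env_approx[OF r] by metis
    have "u *\<^sub>R (x, t1) + v *\<^sub>R (y, t2) \<in> hypo_hull s"
      using t(1,3) * convexD[OF convex_convex_hull] unfolding hypo_hull_def by blast
    then have "u * t1 + v * t2 \<le> concave_env s (u *\<^sub>R x + v *\<^sub>R y)"
      by (intro concave_env_upper) simp
    moreover have "u * (concave_env s x - r) + v * (concave_env s y - r) \<le> u * t1 + v * t2"
      using t * by (intro add_mono mult_left_mono) auto
    moreover have "u * (concave_env s x - r) + v * (concave_env s y - r)
       = u * concave_env s x + v * concave_env s y - (u + v) * r" by (simp add: algebra_simps)
    ultimately show "u * concave_env s x + v * concave_env s y \<le> concave_env s (u *\<^sub>R x + v *\<^sub>R y) + r"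
      using * by simp
  qed
qed

text \<open>A translate of the hypograph splits every point of the hull into two points of the hull, so
  semiconvexity passes from the function to its envelope.\<close>

lemma concave_env_semiconvex:
  assumes "semiconvex c s"
  shows "semiconvex c (concave_env s)"
  unfolding semiconvex_iff
proof (intro allI impI)
  fix x y :: 'a and l :: real assume l: "0 \<le> l \<and> l \<le> 1"
  define K where "K = c/2 * (l * (1 - l) * (norm (x - y))\<^sup>2)"
  let ?d = "x - y"
  \<comment> \<open>Points whose height, lowered by \<open>K\<close>, lies below an interpolation of
    hull points over two translates. Semiconvexity of \<open>s\<close> puts the hypograph into the
    convex set \<open>D\<close>, hence also the hull; over the convex combination of
    \<open>x\<close> and \<open>y\<close> the translates are \<open>x\<close> and \<open>y\<close>
    themselves.\<close>
  define D where "D = {q :: 'a \<times> real. \<exists>t1 t2. (fst q + (1 - l) *\<^sub>R ?d, t1) \<in> hypo_hull s \<and>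
     (fst q - l *\<^sub>R ?d, t2) \<in> hypo_hull s \<and> snd q - K \<le> l * t1 + (1 - l) * t2}"
  have "convex D"
    unfolding convex_def
  proof (intro ballI allI impI)
    fix q q' :: "'a \<times> real" and u v :: real
    assume q: "q \<in> D" "q' \<in> D" and uv: "0 \<le> u" "0 \<le> v" "u + v = 1"
    obtain t1 t2 where t: "(fst q + (1 - l) *\<^sub>R ?d, t1) \<in> hypo_hull s"
      "(fst q - l *\<^sub>R ?d, t2) \<in> hypo_hull s" "snd q - K \<le> l * t1 + (1 - l) * t2"
      using q(1) unfolding D_def by auto
    obtain t1' t2' where t': "(fst q' + (1 - l) *\<^sub>R ?d, t1') \<in> hypo_hull s"
      "(fst q' - l *\<^sub>R ?d, t2') \<in> hypo_hull s" "snd q' - K \<le> l * t1' + (1 - l) * t2'"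
      using q(2) unfolding D_def by auto
    have c: "u *\<^sub>R a + v *\<^sub>R b \<in> hypo_hull s" if "a \<in> hypo_hull s" "b \<in> hypo_hull s" for a b
      using that uv convexD[OF convex_convex_hull] unfolding hypo_hull_def by blast
    have v: "v = 1 - u" using uv by simp
    have "(fst (u *\<^sub>R q + v *\<^sub>R q') + (1 - l) *\<^sub>R ?d, u * t1 + v * t1') \<in> hypo_hull s"
      using c[OF t(1) t'(1)] unfolding v by (simp add: algebra_simps)
    moreover have "(fst (u *\<^sub>R q + v *\<^sub>R q') - l *\<^sub>R ?d, u * t2 + v * t2') \<in> hypo_hull s"
      using c[OF t(2) t'(2)] unfolding v by (simp add: algebra_simps)
    moreover have "u * (snd q - K) + v * (snd q' - K) \<le>
        u * (l * t1 + (1 - l) * t2) + v * (l * t1' + (1 - l) * t2')"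
      using t(3) t'(3) uv by (intro add_mono mult_left_mono) auto
    then have "snd (u *\<^sub>R q + v *\<^sub>R q') - K \<le> l * (u * t1 + v * t1') + (1 - l) * (u * t2 + v * t2')"
      unfolding v by (simp add: algebra_simps diff_divide_distrib)
    ultimately show "u *\<^sub>R q + v *\<^sub>R q' \<in> D" unfolding D_def by blast
  qed
  moreover have "{q. snd q \<le> s (fst q)} \<subseteq> D"
  proof
    fix q :: "'a \<times> real" assume "q \<in> {q. snd q \<le> s (fst q)}"
    then have "snd q \<le> s (fst q)" by simp
    moreover have "s (fst q) \<le> l * s (fst q + (1 - l) *\<^sub>R ?d) + (1 - l) * s (fst q - l *\<^sub>R ?d) + K"
    proof -
      have e1: "l *\<^sub>R (fst q + (1 - l) *\<^sub>R ?d) + (1 - l) *\<^sub>R (fst q - l *\<^sub>R ?d) = fst q"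
        by (simp add: algebra_simps)
      have e2: "(fst q + (1 - l) *\<^sub>R ?d) - (fst q - l *\<^sub>R ?d) = ?d"
        by (simp add: algebra_simps)
      show ?thesis
        using assms[unfolded semiconvex_iff, rule_format, OF l, of "fst q + (1 - l) *\<^sub>R ?d" "fst q - l *\<^sub>R ?d"]
        unfolding e1 e2 K_def .
    qed
    ultimately show "q \<in> D" unfolding D_def
      by (intro CollectI exI[of _ "s (fst q + (1 - l) *\<^sub>R ?d)"] exI[of _ "s (fst q - l *\<^sub>R ?d)"]
          conjI hypo_hull_self) linarith
  qed
  ultimately have D: "hypo_hull s \<subseteq> D" unfolding hypo_hull_def by (rule hull_minimal[rotated])
  show "concave_env s (l *\<^sub>R x + (1 - l) *\<^sub>R y) \<le> l * concave_env s x + (1 - l) * concave_env s y + K"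
  proof (rule concave_env_least)
    fix t assume "(l *\<^sub>R x + (1 - l) *\<^sub>R y, t) \<in> hypo_hull s"
    then have "(l *\<^sub>R x + (1 - l) *\<^sub>R y, t) \<in> D" using D by auto
    moreover have "l *\<^sub>R x + (1 - l) *\<^sub>R y + (1 - l) *\<^sub>R ?d = x" "l *\<^sub>R x + (1 - l) *\<^sub>R y - l *\<^sub>R ?d = y"
      by (simp_all add: algebra_simps)
    ultimately obtain t1 t2 where t: "(x, t1) \<in> hypo_hull s" "(y, t2) \<in> hypo_hull s"
      "t - K \<le> l * t1 + (1 - l) * t2" unfolding D_def by auto
    have "l * t1 + (1 - l) * t2 \<le> l * concave_env s x + (1 - l) * concave_env s y"
      using l t by (intro add_mono mult_left_mono concave_env_upper) auto
    then show "t \<le> l * concave_env s x + (1 - l) * concave_env s y + K" using t(3) by linarith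
  qed
qed

end

text \<open>Ilmanen's interpolation: with \<open>G\<close> the concave envelope of \<open>U + W\<close>, the convex envelope of
  a suitable modification of \<open>G - W\<close> lies between \<open>U\<close> and \<open>G - W\<close> and is of class \<open>C\<^sup>1\<^sup>,\<^sup>1\<close>.\<close>

lemma C11_majorants:
  fixes U W :: "'a::euclidean_space \<Rightarrow> real"
  assumes U: "semiconvex c U" and W: "semiconvex c W" and bd: "\<And>x. U x + W x \<le> b" and c: "c \<ge> 0"
  shows "\<exists>h1 h2. (\<forall>x. U x \<le> h1 x) \<and> (\<forall>x. W x \<le> h2 x) \<and> concave_on UNIV (\<lambda>x. h1 x + h2 x) \<and>
    semiconvex (3*c) h1 \<and> semiconvex (3*c) (\<lambda>x. - h1 x) \<and>
    semiconvex (3*c) h2 \<and> semiconvex (3*c) (\<lambda>x. - h2 x) \<and>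
    (\<forall>x p. (\<forall>y. U y + W y - p \<bullet> y \<le> U x + W x - p \<bullet> x) \<longrightarrow> h1 x = U x \<and> h2 x = W x)"
proof -
  let ?s = "\<lambda>x. U x + W x"
  define G where "G = concave_env ?s"
  have cb: "concave_on UNIV (\<lambda>x::'a. b)" by (simp add: concave_on_const)
  have G: "?s x \<le> G x" "concave_on UNIV G" "semiconvex (c + c) G" for x
    unfolding G_def
    using concave_env_ge[OF cb bd] concave_env_concave[OF cb bd]
      concave_env_semiconvex[OF cb bd semiconvex_add[OF U W]] by auto
  let ?q = "\<lambda>x::'a. c/2 * (norm x)\<^sup>2"
  \<comment> \<open>\<open>U + ?q\<close> is convex, so its negative is a concave majorant of
    \<open>?s2\<close>, because \<open>U + W \<le> G\<close>. Taking the envelope in between and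
    undoing the quadratic yields \<open>U \<le> h1 \<le> G - W\<close>.\<close>
  let ?s2 = "\<lambda>x. W x - G x - ?q x"
  let ?g2 = "\<lambda>x. - (U x + ?q x)"
  define G2 where "G2 = concave_env ?s2"
  have cg: "concave_on UNIV ?g2" using U unfolding concave_on_def semiconvex_def by (simp add: add.commute)
  have le: "?s2 x \<le> ?g2 x" for x using G(1)[of x] by simp
  have nG: "convex_on UNIV (\<lambda>x. - G x)" using G(2) unfolding concave_on_def .
  have s2: "semiconvex (2*c) ?s2"
    using convex_on_add[OF W[unfolded semiconvex_def] nG] unfolding semiconvex_def
    by (simp add: algebra_simps)
  have G2: "?s2 x \<le> G2 x" "concave_on UNIV G2" "semiconvex (2*c) G2" "G2 x \<le> ?g2 x" for x
    unfolding G2_def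
    using concave_env_ge[OF cg le] concave_env_concave[OF cg le]
      concave_env_semiconvex[OF cg le s2] concave_env_le[OF cg le cg le] by auto
  have nG2: "convex_on UNIV (\<lambda>x. - G2 x)" using G2(2) unfolding concave_on_def .
  have mono: "semiconvex d' f" if "semiconvex d f" "d \<le> d'" for d d' and f :: "'a \<Rightarrow> real"
    unfolding semiconvex_iff
  proof (intro allI impI)
    fix x y :: 'a and l :: real assume l: "0 \<le> l \<and> l \<le> 1"
    have "d/2 * (l * (1 - l) * (norm (x - y))\<^sup>2) \<le> d'/2 * (l * (1 - l) * (norm (x - y))\<^sup>2)"
      using l that(2) by (intro mult_right_mono) auto
    then show "f (l *\<^sub>R x + (1 - l) *\<^sub>R y) \<le> l * f x + (1 - l) * f y + d'/2 * (l * (1 - l) * (norm (x - y))\<^sup>2)"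
      using that(1)[unfolded semiconvex_iff, rule_format, OF l, of x y] by linarith
  qed
  \<comment> \<open>The constants: \<open>- h1 = G2 + ?q\<close> has \<open>2*c - c = c\<close>, and
    \<open>h2 = G - h1\<close> has \<open>2*c + c\<close>. This is the origin of
    \<open>3*c\<close>.\<close>
  define h1 where "h1 x = - G2 x - ?q x" for x
  define h2 where "h2 x = G x - h1 x" for x
  have h1: "U x \<le> h1 x" "h1 x \<le> G x - W x" for x
    using G2(1,4)[of x] unfolding h1_def by auto
  have h1c: "semiconvex c h1"
    using nG2 unfolding semiconvex_def h1_def by simp
  have h1s: "semiconvex c (\<lambda>x. - h1 x)"
    using G2(3) unfolding semiconvex_def h1_def by (simp add: algebra_simps)
  have h2c: "semiconvex (c + c + c) h2"
    using semiconvex_add[OF G(3) h1s] unfolding h2_def by simp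
  have "semiconvex 0 (\<lambda>x. - G x)" using nG unfolding semiconvex_def by simp
  from semiconvex_add[OF this h1c] have h2s: "semiconvex c (\<lambda>x. - h2 x)"
    unfolding h2_def by (simp add: algebra_simps)
  have "h1 x = U x \<and> h2 x = W x" if max: "\<forall>y. U y + W y - p \<bullet> y \<le> U x + W x - p \<bullet> x" for x p
  proof -
    \<comment> \<open>The affine function of slope \<open>p\<close> touching \<open>U + W\<close> at
      \<open>x\<close> is a concave majorant, so \<open>G x = U x + W x\<close> and the sandwich
      around \<open>h1\<close> collapses at \<open>x\<close>.\<close>
    let ?l = "\<lambda>y. (U x + W x - p \<bullet> x) + p \<bullet> y"
    have "concave_on UNIV ?l"
      unfolding concave_on_iff
    proof (intro conjI convex_UNIV ballI allI impI)
      fix y z :: 'a and a b :: real assume "0 \<le> a" "0 \<le> b" "a + b = 1"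
      then have b: "b = 1 - a" by simp
      show "a * ?l y + b * ?l z \<le> ?l (a *\<^sub>R y + b *\<^sub>R z)"
        unfolding b by (simp add: algebra_simps)
    qed
    moreover have "?s y \<le> ?l y" for y using max[rule_format, of y] by linarith
    ultimately have "G x \<le> ?l x" unfolding G_def by (rule concave_env_le[OF cb bd])
    then show ?thesis using h1[of x] G(1)[of x] unfolding h2_def by simp
  qed
  moreover have "concave_on UNIV (\<lambda>x. h1 x + h2 x)" using G(2) unfolding h2_def by simp
  ultimately show ?thesis
    using h1 mono[OF h1c, of "3*c"] mono[OF h1s, of "3*c"] mono[OF h2c, of "3*c"] mono[OF h2s, of "3*c"] c
    by (intro exI[of _ h1] exI[of _ h2]) (auto simp: h2_def algebra_simps)
qed

section \<open>Good scales by energy monotonicity\<close>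

lemma lborel_integral_shift:
  fixes f :: "'a::euclidean_space \<Rightarrow> real"
  assumes "integrable lborel f"
  shows "integrable lborel (\<lambda>x. f (x + c))" "(\<integral>x. f (x + c) \<partial>lborel) = (\<integral>x. f x \<partial>lborel)"
proof -
  have [measurable]: "f \<in> borel_measurable borel" using assms by auto
  have "integrable (distr lborel borel ((+) c)) f" using assms by (simp add: lborel_distr_plus)
  then show "integrable lborel (\<lambda>x. f (x + c))"
    by (subst (asm) integrable_distr_eq) (auto simp: add.commute)
  have "(\<integral>x. f x \<partial>lborel) = (\<integral>x. f x \<partial>(distr lborel borel ((+) c)))" by (simp add: lborel_distr_plus)
  also have "\<dots> = (\<integral>x. f (x + c) \<partial>lborel)"
    by (subst integral_distr) (auto simp: add.commute)
  finally show "(\<integral>x. f (x + c) \<partial>lborel) = (\<integral>x. f x \<partial>lborel)" by simp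
qed

text \<open>Each step averages over the vertices of a parallelogram whose sides double. Applied to a
  second difference quotient it produces the quotient at the doubled step.\<close>

primrec iter_avg :: "'a::euclidean_space \<Rightarrow> 'a \<Rightarrow> real \<Rightarrow> ('a \<Rightarrow> real) \<Rightarrow> nat \<Rightarrow> 'a \<Rightarrow> real" where
  "iter_avg u v t g 0 = g"
| "iter_avg u v t g (Suc j) = (\<lambda>x. (iter_avg u v t g j x + iter_avg u v t g j (x + (2^j*t) *\<^sub>R u)
     + iter_avg u v t g j (x + (2^j*t) *\<^sub>R v) + iter_avg u v t g j (x + (2^j*t) *\<^sub>R (u + v))) / 4)"

text \<open>The variance of the four values being averaged. By translation invariance its integral
  is the \<open>L^2\<close> energy lost in one averaging step.\<close>

definition avg_defect :: "'a::euclidean_space \<Rightarrow> 'a \<Rightarrow> real \<Rightarrow> ('a \<Rightarrow> real) \<Rightarrow> nat \<Rightarrow> 'a \<Rightarrow> real" where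
  "avg_defect u v t g j x = ((iter_avg u v t g j x)\<^sup>2 + (iter_avg u v t g j (x + (2^j*t) *\<^sub>R u))\<^sup>2
     + (iter_avg u v t g j (x + (2^j*t) *\<^sub>R v))\<^sup>2 + (iter_avg u v t g j (x + (2^j*t) *\<^sub>R (u + v)))\<^sup>2) / 4
     - (iter_avg u v t g (Suc j) x)\<^sup>2"

lemma four_point_variance:
  fixes a b c d :: real
  shows "(a - b)\<^sup>2 / 8 \<le> (a\<^sup>2 + b\<^sup>2 + c\<^sup>2 + d\<^sup>2) / 4 - ((a + b + c + d) / 4)\<^sup>2"
proof -
  have "16 * ((a\<^sup>2 + b\<^sup>2 + c\<^sup>2 + d\<^sup>2) / 4 - ((a + b + c + d) / 4)\<^sup>2) - 2 * (a - b)\<^sup>2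
     = (a + b - c - d)\<^sup>2 + 2 * (c - d)\<^sup>2"
    by (simp add: power2_eq_square field_simps)
  also have "\<dots> \<ge> 0" by simp
  finally have "2 * (a - b)\<^sup>2 \<le> 16 * ((a\<^sup>2 + b\<^sup>2 + c\<^sup>2 + d\<^sup>2) / 4 - ((a + b + c + d) / 4)\<^sup>2)"
    by (simp only: diff_ge_0_iff_ge)
  then have "(2 * (a - b)\<^sup>2) / 16 \<le> (16 * ((a\<^sup>2 + b\<^sup>2 + c\<^sup>2 + d\<^sup>2) / 4 - ((a + b + c + d) / 4)\<^sup>2)) / 16"
    by (rule divide_right_mono) simp
  moreover have "2 * y / 16 = y / 8" "16 * y / 16 = y" for y :: real by simp_all
  ultimately show ?thesis by metis
qed

text \<open>A small defect controls the change of the averaged function over one step in direction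
  \<open>u\<close>. For second difference quotients that change is a third difference in which
  \<open>u\<close> is repeated.\<close>

lemma avg_defect_ge:
  "(iter_avg u v t g j x - iter_avg u v t g j (x + (2^j*t) *\<^sub>R u))\<^sup>2 / 8 \<le> avg_defect u v t g j x"
  unfolding avg_defect_def iter_avg.simps by (rule four_point_variance)

lemma avg_defect_nonneg: "0 \<le> avg_defect u v t g j x"
  by (rule order_trans[OF _ avg_defect_ge]) simp

lemma iter_avg_measurable[measurable]:
  assumes [measurable]: "g \<in> borel_measurable borel"
  shows "iter_avg u v t g j \<in> borel_measurable borel"
  by (induction j) simp_all

lemma iter_avg_sq_integrable:
  assumes g[measurable]: "g \<in> borel_measurable borel" and "integrable lborel (\<lambda>x. (g x)\<^sup>2)"
  shows "integrable lborel (\<lambda>x. (iter_avg u v t g j x)\<^sup>2)"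
proof (induction j)
  case 0
  then show ?case using assms by simp
next
  case (Suc j)
  show ?case
  proof (rule Bochner_Integration.integrable_bound)
    show "integrable lborel (\<lambda>x. ((iter_avg u v t g j x)\<^sup>2 + (iter_avg u v t g j (x + (2^j*t) *\<^sub>R u))\<^sup>2
     + (iter_avg u v t g j (x + (2^j*t) *\<^sub>R v))\<^sup>2 + (iter_avg u v t g j (x + (2^j*t) *\<^sub>R (u + v)))\<^sup>2) / 4)"
      using lborel_integral_shift(1)[OF Suc.IH] Suc.IH by auto
    show "(\<lambda>x. (iter_avg u v t g (Suc j) x)\<^sup>2) \<in> borel_measurable lborel"
      using iter_avg_measurable[OF g, of u v t "Suc j"] by (simp del: iter_avg.simps)
    show "AE x in lborel. norm ((iter_avg u v t g (Suc j) x)\<^sup>2)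
         \<le> norm (((iter_avg u v t g j x)\<^sup>2 + (iter_avg u v t g j (x + (2^j*t) *\<^sub>R u))\<^sup>2
     + (iter_avg u v t g j (x + (2^j*t) *\<^sub>R v))\<^sup>2 + (iter_avg u v t g j (x + (2^j*t) *\<^sub>R (u + v)))\<^sup>2) / 4)"
      using avg_defect_nonneg[of u v t g j] unfolding avg_defect_def by (auto simp del: iter_avg.simps)
  qed
qed

lemma avg_defect_integral:
  assumes g[measurable]: "g \<in> borel_measurable borel" and "integrable lborel (\<lambda>x. (g x)\<^sup>2)"
  shows "integrable lborel (avg_defect u v t g j)"
    "(\<integral>x. avg_defect u v t g j x \<partial>lborel) =
      (\<integral>x. (iter_avg u v t g j x)\<^sup>2 \<partial>lborel) - (\<integral>x. (iter_avg u v t g (Suc j) x)\<^sup>2 \<partial>lborel)"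
proof -
  note i = iter_avg_sq_integrable[OF assms, of u v t]
  note s = lborel_integral_shift[OF i[of j]]
  have eq: "avg_defect u v t g j = (\<lambda>x. ((iter_avg u v t g j x)\<^sup>2 + (iter_avg u v t g j (x + (2^j*t) *\<^sub>R u))\<^sup>2
     + (iter_avg u v t g j (x + (2^j*t) *\<^sub>R v))\<^sup>2 + (iter_avg u v t g j (x + (2^j*t) *\<^sub>R (u + v)))\<^sup>2) / 4
     - (iter_avg u v t g (Suc j) x)\<^sup>2)"
    unfolding avg_defect_def by (rule ext) simp
  show "integrable lborel (avg_defect u v t g j)"
    unfolding eq using i s by (auto simp del: iter_avg.simps)
  show "(\<integral>x. avg_defect u v t g j x \<partial>lborel) =
      (\<integral>x. (iter_avg u v t g j x)\<^sup>2 \<partial>lborel) - (\<integral>x. (iter_avg u v t g (Suc j) x)\<^sup>2 \<partial>lborel)"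
    unfolding eq using i s by (simp del: iter_avg.simps)
qed

text \<open>The cutoff to a ball makes the energy finite. It is invisible at \<open>x\<close> as
  long as no translate used in the \<open>j\<close> averaging steps leaves the ball, and since the
  steps double, the translates have total length at most \<open>2^j * t * D\<close>.\<close>

lemma iter_avg_eq:
  assumes ref: "\<And>t x. t > 0 \<Longrightarrow> a (2*t) x = (a t x + a t (x + t *\<^sub>R u) + a t (x + t *\<^sub>R v) + a t (x + t *\<^sub>R (u + v))) / 4"
    and t: "t > 0" and D: "norm u + norm v \<le> D"
  shows "norm x + 2^j * t * D \<le> R \<Longrightarrow> iter_avg u v t (\<lambda>x. indicator (cball 0 R) x * a t x) j x = a (2^j*t) x"
proof (induction j arbitrary: x)
  case 0
  have "0 \<le> t * D" using t D by (smt (verit) norm_ge_zero mult_nonneg_nonneg)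
  then have "x \<in> cball 0 R" using 0 by simp
  then show ?case by simp
next
  case (Suc j)
  let ?t = "2^j * t"
  have tp: "?t > 0" using t by simp
  have *: "iter_avg u v t (\<lambda>x. indicator (cball 0 R) x * a t x) j (x + ?t *\<^sub>R w) = a ?t (x + ?t *\<^sub>R w)"
    if "norm w \<le> D" for w
  proof (rule Suc.IH)
    have "norm (x + ?t *\<^sub>R w) \<le> norm x + ?t * norm w"
      using norm_triangle_ineq[of x "?t *\<^sub>R w"] t by simp
    also have "\<dots> \<le> norm x + ?t * D"
      using that tp by (intro add_left_mono mult_left_mono) auto
    finally show "norm (x + ?t *\<^sub>R w) + ?t * D \<le> R" using Suc.prems by (simp add: algebra_simps)
  qed
  have "norm u \<le> D" "norm v \<le> D" "norm (u + v) \<le> D" "norm (0::'a) \<le> D"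
    using D norm_ge_zero[of u] norm_ge_zero[of v] norm_triangle_ineq[of u v] by (auto simp del: norm_ge_zero)
  then show ?case using *[of u] *[of v] *[of "u + v"] *[of 0] ref[OF tp, of x] by (simp add: mult.assoc)
qed

text \<open>The set \<open>K\<close> may fail to be measurable, so its size is measured through
  measurable supersets.\<close>

lemma not_negligible_outer:
  assumes "\<not> negligible K"
  obtains c where "c > 0" "\<And>B. B \<in> lmeasurable \<Longrightarrow> K \<subseteq> B \<Longrightarrow> c \<le> measure lebesgue B"
  using assms unfolding negligible_outer_le by (metis less_eq_real_def not_le)

text \<open>Pigeonhole over scales: the total energy loss is at most \<open>T0\<close> whatever the
  number \<open>J\<close> of doublings, so at one scale the defect has integral at most
  \<open>T0 / J\<close>. Markov's inequality then makes the set of bad points too small to contain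
  \<open>K\<close>.\<close>

lemma multiscale_regular_point:
  fixes a :: "'i \<Rightarrow> real \<Rightarrow> 'a::euclidean_space \<Rightarrow> real" and U V :: "'i \<Rightarrow> 'a"
  assumes I: "finite I" and S: "finite S"
    and cont: "\<And>i t. i \<in> I \<Longrightarrow> t > 0 \<Longrightarrow> continuous_on UNIV (a i t)"
    and bd: "\<And>i t x. i \<in> I \<Longrightarrow> t > 0 \<Longrightarrow> \<bar>a i t x\<bar> \<le> C"
    and ref: "\<And>i t x. i \<in> I \<Longrightarrow> t > 0 \<Longrightarrow> a i (2*t) x =
       (a i t x + a i t (x + t *\<^sub>R U i) + a i t (x + t *\<^sub>R V i) + a i t (x + t *\<^sub>R (U i + V i))) / 4"
    and K: "bounded K" "\<not> negligible K" and kap: "kap > 0" and tm: "tm > 0"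
  shows "\<exists>t x. 0 < t \<and> t \<le> tm \<and> x \<in> K \<and>
    (\<forall>i\<in>I. \<forall>s\<in>S. \<bar>a i t (x + t *\<^sub>R s) - a i t (x + t *\<^sub>R s + t *\<^sub>R U i)\<bar> \<le> kap)"
proof -
  obtain c where c: "c > 0" "\<And>B. B \<in> lmeasurable \<Longrightarrow> K \<subseteq> B \<Longrightarrow> c \<le> measure lebesgue B"
    using not_negligible_outer[OF K(2)] by metis
  obtain RK where RK: "\<And>x. x \<in> K \<Longrightarrow> norm x \<le> RK" using K(1) unfolding bounded_iff by auto
  define D where "D = (\<Sum>i\<in>I. norm (U i) + norm (V i))"
  define Ds where "Ds = (\<Sum>s\<in>S. norm s)"
  have D: "norm (U i) + norm (V i) \<le> D" if "i \<in> I" for i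
    unfolding D_def using that I by (intro member_le_sum) auto
  have Ds: "norm s \<le> Ds" if "s \<in> S" for s
    unfolding Ds_def using that S by (intro member_le_sum) auto
  have D0: "D \<ge> 0" "Ds \<ge> 0" unfolding D_def Ds_def by (auto intro!: sum_nonneg)
  \<comment> \<open>Room for \<open>x + t *\<^sub>R s\<close>, for one further step along
    \<open>U i\<close>, and for all translates in the averages, so that the cutoff is never seen
    from \<open>K\<close>.\<close>
  define R where "R = RK + tm * (Ds + 2 * D)"
  define k2 where "k2 = kap\<^sup>2 / 8"
  have k2: "k2 > 0" using kap unfolding k2_def by simp
  define T0 where "T0 = real (card S) * (\<Sum>i\<in>I. C\<^sup>2 * measure lborel (cball (0::'a) R))"
  have T0: "T0 \<ge> 0" unfolding T0_def by (intro mult_nonneg_nonneg sum_nonneg) auto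
  \<comment> \<open>\<open>J\<close> is so large that the mean energy loss \<open>T0 / J\<close>
    falls below \<open>k2 * c\<close>. Starting from the step \<open>tm / 2^J\<close> keeps all
    \<open>J\<close> scales below \<open>tm\<close>.\<close>
  obtain J :: nat where J: "T0 / (k2 * c) < real J" using reals_Archimedean2 by blast
  then have J0: "J > 0" using T0 k2 c(1) by (metis divide_nonneg_pos gr0I mult_pos_pos not_less of_nat_0)
  define t0 where "t0 = tm / 2^J"
  have t0: "t0 > 0" using tm unfolding t0_def by simp
  define g where "g i = (\<lambda>x. indicator (cball 0 R) x * a i t0 x)" for i
  have gm: "g i \<in> borel_measurable borel" if "i \<in> I" for i
    unfolding g_def
    by (intro borel_measurable_times borel_measurable_indicator
        borel_measurable_continuous_onI[OF cont[OF that t0]]) simp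
  have gi0: "integrable lborel (\<lambda>x. indicator (cball (0::'a) R) x * C\<^sup>2)"
    by (intro integrable_mult_left integrable_real_indicator) (use emeasure_bounded_finite[OF bounded_cball] in auto)
  have gle: "(g i x)\<^sup>2 \<le> indicator (cball 0 R) x * C\<^sup>2" if "i \<in> I" for i x
    using bd[OF that t0, of x] unfolding g_def by (auto simp: indicator_def abs_le_square_iff[symmetric])
  have gi: "integrable lborel (\<lambda>x. (g i x)\<^sup>2)" if "i \<in> I" for i
    by (rule Bochner_Integration.integrable_bound[OF gi0]) (use gm[OF that] gle[OF that] in \<open>auto simp: abs_mult\<close>)
  define E where "E i j = (\<integral>x. (iter_avg (U i) (V i) t0 (g i) j x)\<^sup>2 \<partial>lborel)" for i j
  have E0: "E i 0 \<le> C\<^sup>2 * measure lborel (cball (0::'a) R)" if "i \<in> I" for i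
  proof -
    have "E i 0 \<le> (\<integral>x. indicator (cball (0::'a) R) x * C\<^sup>2 \<partial>lborel)"
      unfolding E_def iter_avg.simps by (rule integral_mono[OF gi[OF that] gi0 gle[OF that]])
    then show ?thesis by (simp add: mult.commute)
  qed
  have Enn: "E i j \<ge> 0" for i j unfolding E_def by simp
  define Th where "Th j x = (\<Sum>i\<in>I. \<Sum>s\<in>S. avg_defect (U i) (V i) t0 (g i) j (x + (2^j*t0) *\<^sub>R s))" for j x
  have Thi: "integrable lborel (Th j)" and The: "(\<integral>x. Th j x \<partial>lborel) = real (card S) * (\<Sum>i\<in>I. E i j - E i (Suc j))" for j
  proof -
    have *: "integrable lborel (\<lambda>x. avg_defect (U i) (V i) t0 (g i) j (x + (2^j*t0) *\<^sub>R s))"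
      "(\<integral>x. avg_defect (U i) (V i) t0 (g i) j (x + (2^j*t0) *\<^sub>R s) \<partial>lborel) = E i j - E i (Suc j)"
      if "i \<in> I" for i s
      unfolding E_def using lborel_integral_shift[OF avg_defect_integral(1)[OF gm[OF that] gi[OF that]]]
        avg_defect_integral(2)[OF gm[OF that] gi[OF that]] by (auto simp del: iter_avg.simps)
    show "integrable lborel (Th j)" unfolding Th_def using * by auto
    have "(\<integral>x. Th j x \<partial>lborel) = (\<Sum>i\<in>I. \<Sum>s\<in>S. E i j - E i (Suc j))"
      unfolding Th_def using * by (simp add: Bochner_Integration.integral_sum)
    then show "(\<integral>x. Th j x \<partial>lborel) = real (card S) * (\<Sum>i\<in>I. E i j - E i (Suc j))"
      by (simp add: sum_distrib_left)
  qed
  have Thn: "Th j x \<ge> 0" for j x unfolding Th_def by (intro sum_nonneg avg_defect_nonneg)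
  have "(\<Sum>j<J. \<integral>x. Th j x \<partial>lborel) = real (card S) * (\<Sum>i\<in>I. E i 0 - E i J)"
  proof -
    have "(\<Sum>j<J. \<Sum>i\<in>I. E i j - E i (Suc j)) = (\<Sum>i\<in>I. E i 0 - E i J)"
      by (subst sum.swap) (simp add: sum_lessThan_telescope')
    then show ?thesis unfolding The by (simp flip: sum_distrib_left)
  qed
  also have "\<dots> \<le> T0" unfolding T0_def
  proof (intro mult_left_mono sum_mono)
    show "E i 0 - E i J \<le> C\<^sup>2 * measure lborel (cball (0::'a) R)" if "i \<in> I" for i
      using E0[OF that] Enn[of i J] by linarith
  qed simp
  finally have tot: "(\<Sum>j<J. \<integral>x. Th j x \<partial>lborel) \<le> T0" .
  have "\<exists>j<J. (\<integral>x. Th j x \<partial>lborel) \<le> T0 / real J"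
  proof (rule ccontr)
    assume "\<not> ?thesis"
    then have "(\<Sum>j<J. T0 / real J) < (\<Sum>j<J. \<integral>x. Th j x \<partial>lborel)"
      using J0 by (intro sum_strict_mono) auto
    then show False using tot J0 by simp
  qed
  then obtain j where j: "j < J" "(\<integral>x. Th j x \<partial>lborel) \<le> T0 / real J" by blast
  define t where "t = 2^j * t0"
  have t: "t > 0" unfolding t_def using t0 by simp
  have "(2::real)^j \<le> 2^J" using j by simp
  then have ttm: "t \<le> tm" unfolding t_def t0_def using tm by (simp add: field_simps)
  define B where "B = {x. k2 \<le> Th j x}"
  have Thm[measurable]: "Th j \<in> borel_measurable borel" using Thi[of j] by auto
  have Bm: "B \<in> sets lborel" unfolding B_def by simp
  have "emeasure lborel B < \<infinity> \<and> measure lborel B \<le> (\<integral>x. Th j x \<partial>lborel) / k2"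
  proof
    have "emeasure lborel B \<le> ennreal ((1/k2) * (\<integral>x. Th j x \<partial>lborel))"
      using integral_Markov_inequality[OF Thi[of j] _ k2] Thn unfolding B_def by simp
    also have "\<dots> < \<infinity>" by simp
    finally show "emeasure lborel B < \<infinity>" .
    show "measure lborel B \<le> (\<integral>x. Th j x \<partial>lborel) / k2"
      using integral_Markov_inequality_measure[OF Thi[of j] sets.top _ k2] Thn unfolding B_def by simp
  qed
  then have Bl: "B \<in> lmeasurable" "measure lebesgue B \<le> (\<integral>x. Th j x \<partial>lborel) / k2"
    using Bm by (auto simp: fmeasurable_def)
  have "T0 < real J * (k2 * c)"
    using J k2 c(1) by (simp add: pos_divide_less_eq)
  then have "T0 / real J < c * k2"
    using J0 by (simp add: pos_divide_less_eq mult.commute mult.left_commute)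
  then have "(\<integral>x. Th j x \<partial>lborel) / k2 < c"
    using j(2) k2 by (simp add: pos_divide_less_eq)
  then have "\<not> K \<subseteq> B" using c(2) Bl by force
  then obtain x where x: "x \<in> K" "Th j x < k2"
    unfolding B_def subset_iff mem_Collect_eq by (meson not_le)
  have "\<bar>a i t (x + t *\<^sub>R s) - a i t (x + t *\<^sub>R s + t *\<^sub>R U i)\<bar> \<le> kap" if i: "i \<in> I" and s: "s \<in> S" for i s
  proof -
    let ?d = "\<lambda>i s. avg_defect (U i) (V i) t0 (g i) j (x + t *\<^sub>R s)"
    let ?G = "iter_avg (U i) (V i) t0 (g i) j"
    have "?d i s \<le> (\<Sum>s\<in>S. ?d i s)" using s S by (intro member_le_sum avg_defect_nonneg) auto
    also have "\<dots> \<le> (\<Sum>i\<in>I. \<Sum>s\<in>S. ?d i s)"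
      using i I by (intro member_le_sum[of i I "\<lambda>i. \<Sum>s\<in>S. ?d i s"] sum_nonneg avg_defect_nonneg) auto
    also have "\<dots> < k2" using x(2) unfolding Th_def t_def .
    finally have "(?G (x + t *\<^sub>R s) - ?G (x + t *\<^sub>R s + t *\<^sub>R U i))\<^sup>2 / 8 < k2"
      using avg_defect_ge[of "U i" "V i" t0 "g i" j "x + t *\<^sub>R s"] unfolding t_def by linarith
    then have sq: "(?G (x + t *\<^sub>R s) - ?G (x + t *\<^sub>R s + t *\<^sub>R U i))\<^sup>2 \<le> kap\<^sup>2"
      unfolding k2_def by simp
    have n1: "norm (x + t *\<^sub>R s) \<le> RK + tm * Ds"
    proof -
      have "norm (x + t *\<^sub>R s) \<le> norm x + t * norm s" using norm_triangle_ineq[of x "t *\<^sub>R s"] t by simp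
      also have "\<dots> \<le> RK + tm * Ds"
        using RK[OF x(1)] ttm t Ds[OF s] tm by (intro add_mono mult_mono) auto
      finally show ?thesis .
    qed
    have n2: "norm (x + t *\<^sub>R s + t *\<^sub>R U i) \<le> RK + tm * Ds + tm * D"
    proof -
      have "t * norm (U i) \<le> tm * D"
        using ttm t D[OF i] norm_ge_zero[of "V i"] norm_ge_zero[of "U i"] tm by (intro mult_mono) linarith+
      then show ?thesis using n1 norm_triangle_ineq[of "x + t *\<^sub>R s" "t *\<^sub>R U i"] t by simp
    qed
    have tD: "t * D \<le> tm * D" using ttm D0(1) by (rule mult_right_mono)
    have eq: "?G y = a i t y" if "norm y \<le> RK + tm * Ds + tm * D" for y
      unfolding g_def t_def
      by (rule iter_avg_eq[OF ref[OF i] t0 D[OF i]])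
        (use that tD in \<open>simp_all add: R_def t_def algebra_simps\<close>)
    have "tm * D \<ge> 0" using tm D0 by simp
    then have "?G (x + t *\<^sub>R s) = a i t (x + t *\<^sub>R s)" "?G (x + t *\<^sub>R s + t *\<^sub>R U i) = a i t (x + t *\<^sub>R s + t *\<^sub>R U i)"
      using n1 n2 by (auto intro!: eq)
    then show ?thesis using sq kap by (simp add: abs_le_square_iff[symmetric])
  qed
  then show ?thesis using t ttm x(1) by blast
qed

section \<open>Differences on a lattice\<close>

definition diff2 :: "('a::real_vector \<Rightarrow> real) \<Rightarrow> 'a \<Rightarrow> 'a \<Rightarrow> 'a \<Rightarrow> real" where
  "diff2 h u v x = h (x + u + v) - h (x + u) - h (x + v) + h x"

text \<open>Divided by the squared step, this is the four-point averaging relation on which the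
  energy argument rests.\<close>

lemma diff2_double:
  "diff2 h (u + u) (v + v) x = diff2 h u v x + diff2 h u v (x + u) + diff2 h u v (x + v) + diff2 h u v (x + u + v)"
  unfolding diff2_def by (simp add: algebra_simps)

lemma diff2_commute: "diff2 h u v x = diff2 h v u x"
  unfolding diff2_def by (simp add: algebra_simps)

lemma diff2_add: "diff2 h (u + u') v x = diff2 h u v x + diff2 h u' v (x + u)"
  unfolding diff2_def by (simp add: algebra_simps)

lemma diff2_swap: "diff2 h u v (x + w) - diff2 h u v x = diff2 h w v (x + u) - diff2 h w v x"
  unfolding diff2_def by (simp add: algebra_simps)

text \<open>The energy argument controls only third differences with a repeated direction. Mixed
  ones are recovered by polarization, from the repeated difference in direction
  \<open>d1 + d2\<close>.\<close>

lemma diff3_polarization: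
  "2 * (diff2 h d1 w (x + d1 + d2) - diff2 h d1 w (x + d1)) =
    (diff2 h (d1 + d2) w (x + (d1 + d2)) - diff2 h (d1 + d2) w x)
    - (diff2 h d1 w (x + d1) - diff2 h d1 w x)
    - (diff2 h d2 w (x + d1 + d1 + d2) - diff2 h d2 w (x + d1 + d1))"
  unfolding diff2_add using diff2_swap[of h d1 w "x + d1" d2] by (simp add: algebra_simps)

lemma semiconvex_second_difference:
  assumes "semiconvex c h"
  shows "- c * (norm z)\<^sup>2 \<le> h (x + z) + h (x - z) - 2 * h x"
proof -
  have e1: "(1/2) *\<^sub>R (x + z) + (1 - 1/2) *\<^sub>R (x - z) = x"
    by (simp add: algebra_simps flip: scaleR_add_left)
  have e2: "(norm (x + z - (x - z)))\<^sup>2 = 4 * (norm z)\<^sup>2"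
  proof -
    have "x + z - (x - z) = 2 *\<^sub>R z" by (simp add: scaleR_2)
    then show ?thesis by (simp add: power_mult_distrib)
  qed
  show ?thesis
    using assms[unfolded semiconvex_iff, rule_format, of "1/2" "x + z" "x - z"]
    unfolding e1 e2 by simp
qed

text \<open>The four points form a parallelogram with centre \<open>m\<close>. The mixed difference
  is the difference of the symmetric second differences along the half-diagonals \<open>p\<close>
  and \<open>q\<close>, and the parallelogram law evaluates the sum of their squared
  lengths.\<close>

lemma semiconvex_diff2_bound:
  fixes h :: "'a::euclidean_space \<Rightarrow> real"
  assumes "semiconvex c h" "semiconvex c (\<lambda>x. - h x)"
  shows "\<bar>diff2 h u v x\<bar> \<le> c * ((norm u)\<^sup>2 + (norm v)\<^sup>2) / 2"
proof -
  define m p q where "m = x + (1/2) *\<^sub>R (u + v)" and "p = (1/2) *\<^sub>R (u + v)" and "q = (1/2) *\<^sub>R (u - v)"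
  have b: "\<bar>h (m + z) + h (m - z) - 2 * h m\<bar> \<le> c * (norm z)\<^sup>2" for z
    using semiconvex_second_difference[OF assms(1), of z m] semiconvex_second_difference[OF assms(2), of z m]
    by simp
  have "m + p = x + u + v" "m - p = x" "m + q = x + u" "m - q = x + v"
    unfolding m_def p_def q_def by (simp_all add: algebra_simps flip: scaleR_add_left)
  then have "diff2 h u v x = (h (m + p) + h (m - p) - 2 * h m) - (h (m + q) + h (m - q) - 2 * h m)"
    unfolding diff2_def by simp
  then have "\<bar>diff2 h u v x\<bar> \<le> c * (norm p)\<^sup>2 + c * (norm q)\<^sup>2" using b[of p] b[of q] by linarith
  also have "\<dots> = c * ((norm p)\<^sup>2 + (norm q)\<^sup>2)" by (simp add: algebra_simps)
  also have "(norm p)\<^sup>2 + (norm q)\<^sup>2 = ((norm u)\<^sup>2 + (norm v)\<^sup>2) / 2"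
    unfolding p_def q_def power2_norm_eq_inner by (simp add: algebra_simps inner_commute)
  finally show ?thesis by simp
qed

definition lattice_box :: "nat \<Rightarrow> (real^'n) set" where
  "lattice_box m = {s. \<forall>i. s $ i \<in> \<int> \<and> \<bar>s $ i\<bar> \<le> real m}"

abbreviation unit_vec :: "'n::finite \<Rightarrow> real^'n" where "unit_vec i \<equiv> axis i 1"

lemma finite_lattice_box: "finite (lattice_box m :: (real^'n) set)"
proof -
  have "lattice_box m \<subseteq> (\<lambda>f. \<chi> i::'n. real_of_int (f i)) ` (UNIV \<rightarrow>\<^sub>E {- int m..int m})"
  proof
    fix s :: "real^'n" assume s: "s \<in> lattice_box m"
    have "s = (\<chi> i. real_of_int \<lfloor>s $ i\<rfloor>)" using s unfolding lattice_box_def by (simp add: vec_eq_iff)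
    moreover have "(\<lambda>i. \<lfloor>s $ i\<rfloor>) \<in> UNIV \<rightarrow>\<^sub>E {- int m..int m}"
    proof (intro PiE_I)
      fix i
      have "s $ i \<in> \<int>" "\<bar>s $ i\<bar> \<le> real m" using s unfolding lattice_box_def by auto
      then show "\<lfloor>s $ i\<rfloor> \<in> {- int m..int m}"
        by (auto elim!: Ints_cases simp: abs_le_iff)
    qed auto
    ultimately show "s \<in> (\<lambda>f. \<chi> i. real_of_int (f i)) ` (UNIV \<rightarrow>\<^sub>E {- int m..int m})" by (rule image_eqI)
  qed
  then show ?thesis by (rule finite_subset) (intro finite_imageI finite_PiE; simp)
qed

text \<open>A lattice path to \<open>0\<close> that shrinks one coordinate at a time stays in the
  box and has at most \<open>CARD('n) * m\<close> unit steps.\<close>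

lemma lattice_path_bound:
  fixes g :: "real^'n \<Rightarrow> real"
  assumes step: "\<And>s i. s \<in> lattice_box m \<Longrightarrow> \<bar>g (s + unit_vec i) - g s\<bar> \<le> B"
    and s: "s \<in> lattice_box m" and B: "B \<ge> 0"
  shows "\<bar>g s - g 0\<bar> \<le> B * (real CARD('n) * real m)"
proof -
  have main: "s \<in> lattice_box m \<Longrightarrow> (\<Sum>i\<in>UNIV. \<bar>s $ i\<bar>) \<le> real N \<Longrightarrow> \<bar>g s - g 0\<bar> \<le> B * (\<Sum>i\<in>UNIV. \<bar>s $ i\<bar>)" for N s
  proof (induction N arbitrary: s)
    case 0
    then have "(\<Sum>i\<in>UNIV. \<bar>s $ i\<bar>) = 0" by (simp add: sum_nonneg order_antisym)
    then have "s = 0" by (simp add: sum_nonneg_eq_0_iff vec_eq_iff)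
    then show ?case by simp
  next
    case (Suc N)
    show ?case
    proof (cases "s = 0")
      case False
      then obtain i where i: "s $ i \<noteq> 0" by (auto simp: vec_eq_iff)
      obtain k where k: "s $ i = real_of_int k" using Suc.prems(1) unfolding lattice_box_def by (auto elim: Ints_cases)
      \<comment> \<open>One step towards \<open>0\<close> in coordinate \<open>i\<close>. The
        hypothesis speaks of forward steps only, so the sign of \<open>k\<close> decides which of
        \<open>s\<close> and \<open>s'\<close> is the starting point.\<close>
      define d :: real where "d = (if k > 0 then 1 else - 1)"
      have ab: "\<bar>s $ i\<bar> = \<bar>s $ i - d\<bar> + 1" using i unfolding k d_def by auto
      define s' where "s' = s - d *\<^sub>R unit_vec i"
      have s'i: "s' $ j = (if j = i then s $ i - d else s $ j)" for j
        unfolding s'_def by (auto simp: axis_def)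
      have dI: "d \<in> \<int>" unfolding d_def by auto
      have sL: "s $ j \<in> \<int>" "\<bar>s $ j\<bar> \<le> real m" for j using Suc.prems(1) unfolding lattice_box_def by auto
      have "\<bar>s $ i - d\<bar> \<le> real m" using ab sL(2)[of i] by linarith
      then have s'L: "s' \<in> lattice_box m"
        unfolding lattice_box_def using sL dI by (auto simp: s'i)
      have sum: "(\<Sum>j\<in>UNIV. \<bar>s $ j\<bar>) = (\<Sum>j\<in>UNIV. \<bar>s' $ j\<bar>) + 1"
      proof -
        have "(\<Sum>j\<in>UNIV. \<bar>s $ j\<bar>) = \<bar>s $ i\<bar> + (\<Sum>j\<in>UNIV - {i}. \<bar>s $ j\<bar>)"
          by (rule sum.remove) auto
        moreover have "(\<Sum>j\<in>UNIV. \<bar>s' $ j\<bar>) = \<bar>s' $ i\<bar> + (\<Sum>j\<in>UNIV - {i}. \<bar>s' $ j\<bar>)"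
          by (rule sum.remove) auto
        moreover have "(\<Sum>j\<in>UNIV - {i}. \<bar>s' $ j\<bar>) = (\<Sum>j\<in>UNIV - {i}. \<bar>s $ j\<bar>)"
          by (intro sum.cong) (auto simp: s'i)
        ultimately show ?thesis using ab by (simp add: s'i)
      qed
      have "\<bar>g s' - g 0\<bar> \<le> B * (\<Sum>j\<in>UNIV. \<bar>s' $ j\<bar>)"
        using Suc.prems(2) sum by (intro Suc.IH s'L) simp
      moreover have "\<bar>g s - g s'\<bar> \<le> B"
      proof (cases "k > 0")
        case True
        then have "s = s' + unit_vec i" unfolding s'_def d_def by simp
        then show ?thesis using step[OF s'L, of i] by simp
      next
        case False
        then have "s' = s + unit_vec i" unfolding s'_def d_def by simp
        then show ?thesis using step[OF Suc.prems(1), of i] by (simp add: abs_minus_commute)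
      qed
      ultimately have "\<bar>g s - g 0\<bar> \<le> B * (\<Sum>j\<in>UNIV. \<bar>s' $ j\<bar>) + B" by linarith
      then show ?thesis unfolding sum by (simp add: algebra_simps)
    qed simp
  qed
  have le: "(\<Sum>i\<in>UNIV. \<bar>s $ i\<bar>) \<le> real CARD('n) * real m"
    using sum_bounded_above[of UNIV "\<lambda>i. \<bar>s $ i\<bar>" "real m"] s unfolding lattice_box_def by auto
  then have "(\<Sum>i\<in>UNIV. \<bar>s $ i\<bar>) \<le> real (CARD('n) * m)" by simp
  from main[OF s this] have "\<bar>g s - g 0\<bar> \<le> B * (\<Sum>i\<in>UNIV. \<bar>s $ i\<bar>)" .
  also have "\<dots> \<le> B * (real CARD('n) * real m)" using le B by (rule mult_left_mono)
  finally show ?thesis .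
qed

definition quad :: "real \<Rightarrow> real^'n \<Rightarrow> real^'n^'n \<Rightarrow> real^'n \<Rightarrow> real" where
  "quad a b A z = a + b \<bullet> z + 1/2 * (z \<bullet> (A *v z))"

lemma sym_mat_inner: "sym_mat A \<Longrightarrow> x \<bullet> (A *v y) = y \<bullet> (A *v x)"
  unfolding sym_mat_def by (metis dot_lmul_matrix inner_commute vector_transpose_matrix)

lemma quad_add:
  assumes "sym_mat A"
  shows "quad a b A (x + h) = quad a b A x + (b + A *v x) \<bullet> h + 1/2 * (h \<bullet> (A *v h))"
  unfolding quad_def using sym_mat_inner[OF assms, of x h]
  by (simp add: algebra_simps inner_commute[of "A *v x" h])

text \<open>Discrete Taylor expansion: the bound on third differences is summed along lattice paths
  three times, for second differences, first differences and values. Each summation costs a factor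
  \<open>CARD('n) * m\<close>.\<close>

lemma lattice_taylor:
  fixes f :: "real^'n \<Rightarrow> real"
  assumes third: "\<And>s i j l. s \<in> lattice_box m \<Longrightarrow>
      \<bar>diff2 f (unit_vec i) (unit_vec l) (s + unit_vec j) - diff2 f (unit_vec i) (unit_vec l) s\<bar> \<le> B"
    and B: "B \<ge> 0"
  defines "A \<equiv> (\<chi> i j. diff2 f (unit_vec i) (unit_vec j) 0)"
  shows "\<exists>b. \<forall>s\<in>lattice_box m. \<bar>f s - quad (f 0) b A s\<bar> \<le> B * (real CARD('n) * real m)^3"
proof -
  define c where "c = real CARD('n) * real m"
  have c0: "c \<ge> 0" unfolding c_def by simp
  have symA: "sym_mat A"
    unfolding sym_mat_def A_def by (simp add: vec_eq_iff transpose_def diff2_commute)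
  \<comment> \<open>This choice makes the first differences of \<open>f\<close> and of the quadratic
    agree at \<open>0\<close>; the half diagonal entry is the quadratic part of \<open>quad\<close>
    at a unit vector.\<close>
  define b where "b = (\<chi> i. f (unit_vec i) - f 0 - A $ i $ i / 2)"
  define q where "q s = f s - quad (f 0) b A s" for s
  have comp: "(A *v x) \<bullet> unit_vec i = (A *v x) $ i" for x i by (simp add: inner_axis)
  have Aij: "(A *v unit_vec j) $ i = A $ i $ j" for i j
    by (simp add: matrix_vector_mul_component inner_axis)
  have dP: "quad (f 0) b A (s + unit_vec i) - quad (f 0) b A s = b $ i + (A *v s) $ i + A $ i $ i / 2" for s i
    unfolding quad_add[OF symA] by (simp add: inner_add_left comp inner_axis inner_commute[of "unit_vec i"] Aij)
  have dq0: "q (0 + unit_vec i) - q 0 = 0" for i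
    using dP[of 0 i] unfolding q_def b_def by simp
  have ddq: "(q (s + unit_vec j + unit_vec i) - q (s + unit_vec j)) - (q (s + unit_vec i) - q s)
     = diff2 f (unit_vec i) (unit_vec j) s - diff2 f (unit_vec i) (unit_vec j) 0" for s i j
  proof -
    have "diff2 f (unit_vec i) (unit_vec j) 0 = A $ i $ j" unfolding A_def by simp
    moreover have "(quad (f 0) b A (s + unit_vec j + unit_vec i) - quad (f 0) b A (s + unit_vec j))
      - (quad (f 0) b A (s + unit_vec i) - quad (f 0) b A s) = A $ i $ j"
      unfolding dP by (simp add: matrix_vector_right_distrib Aij)
    ultimately show ?thesis unfolding q_def diff2_def by (simp add: add.commute add.left_commute)
  qed
  have 1: "\<bar>diff2 f (unit_vec i) (unit_vec j) s - diff2 f (unit_vec i) (unit_vec j) 0\<bar> \<le> B * c" if "s \<in> lattice_box m" for s i j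
    unfolding c_def by (rule lattice_path_bound[where g = "\<lambda>s. diff2 f (unit_vec i) (unit_vec j) s", OF third that B])
  have 2: "\<bar>q (s + unit_vec i) - q s\<bar> \<le> B * c * c" if "s \<in> lattice_box m" for s i
  proof -
    have "\<bar>(q (s + unit_vec i) - q s) - (q (0 + unit_vec i) - q 0)\<bar> \<le> B * c * (real CARD('n) * real m)"

      by (rule lattice_path_bound[where g = "\<lambda>s. q (s + unit_vec i) - q s", OF _ that])
        (use 1 ddq B c0 in auto)
    then show ?thesis unfolding dq0 c_def[symmetric] by simp
  qed
  have 3: "\<bar>q s - q 0\<bar> \<le> B * c * c * c" if "s \<in> lattice_box m" for s
    unfolding c_def by (rule lattice_path_bound[where g = q, OF 2[unfolded c_def] that]) (use B in auto)
  have "q 0 = 0" unfolding q_def quad_def by simp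
  then show ?thesis
    using 3 unfolding q_def c_def[symmetric] by (auto intro!: exI[of _ b] simp: power3_eq_cube mult.assoc)
qed

section \<open>Quadratic approximation on one ball\<close>

lemma semiconvex_affine:
  assumes "semiconvex c h"
  shows "semiconvex (c * t\<^sup>2) (\<lambda>z. h (x + t *\<^sub>R z))"
  unfolding semiconvex_iff
proof (intro allI impI)
  fix y z and l :: real assume l: "0 \<le> l \<and> l \<le> 1"
  have e: "x + t *\<^sub>R (l *\<^sub>R y + (1 - l) *\<^sub>R z) = l *\<^sub>R (x + t *\<^sub>R y) + (1 - l) *\<^sub>R (x + t *\<^sub>R z)"
    by (simp add: algebra_simps)
  have "x + t *\<^sub>R y - (x + t *\<^sub>R z) = t *\<^sub>R (y - z)" by (simp add: algebra_simps)
  then have n: "(norm (x + t *\<^sub>R y - (x + t *\<^sub>R z)))\<^sup>2 = t\<^sup>2 * (norm (y - z))\<^sup>2"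
    by (simp add: power_mult_distrib)
  show "h (x + t *\<^sub>R (l *\<^sub>R y + (1 - l) *\<^sub>R z)) \<le> l * h (x + t *\<^sub>R y) + (1 - l) * h (x + t *\<^sub>R z)
     + c * t\<^sup>2 / 2 * (l * (1 - l) * (norm (y - z))\<^sup>2)"
    using assms[unfolded semiconvex_iff, rule_format, OF l, of "x + t *\<^sub>R y" "x + t *\<^sub>R z"]
    unfolding e n by (simp add: mult_ac)
qed

lemma quad_convex_combination:
  assumes "sym_mat A"
  shows "quad a b A (l *\<^sub>R x + (1 - l) *\<^sub>R y) =
    l * quad a b A x + (1 - l) * quad a b A y - 1/2 * (l * (1 - l) * ((x - y) \<bullet> (A *v (x - y))))"
proof -
  have s: "y \<bullet> (A *v x) = x \<bullet> (A *v y)" by (rule sym_mat_inner[OF assms])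
  show ?thesis
    unfolding quad_def
    by (simp add: matrix_vector_right_distrib matrix_vector_mult_diff_distrib matrix_vector_mult_scaleR
        inner_add_left inner_add_right inner_diff_left inner_diff_right s algebra_simps diff_divide_distrib add_divide_distrib)
qed

lemma matrix_form_bound:
  fixes A :: "real^'n^'n"
  assumes "\<And>i j. \<bar>A $ i $ j\<bar> \<le> c"
  shows "\<bar>x \<bullet> (A *v x)\<bar> \<le> c * (real CARD('n))\<^sup>2 * (norm x)\<^sup>2"
proof -
  have c: "c \<ge> 0" using assms[of undefined undefined] by linarith
  have "x \<bullet> (A *v x) = (\<Sum>i\<in>UNIV. \<Sum>j\<in>UNIV. x $ i * (A $ i $ j * x $ j))"
    unfolding inner_vec_def matrix_vector_mult_def by (simp add: sum_distrib_left)
  then have "\<bar>x \<bullet> (A *v x)\<bar> \<le> (\<Sum>i\<in>UNIV. \<bar>\<Sum>j\<in>UNIV. x $ i * (A $ i $ j * x $ j)\<bar>)"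
    by (simp only: sum_abs)
  also have "\<dots> \<le> (\<Sum>i\<in>UNIV. \<Sum>j\<in>UNIV. \<bar>x $ i * (A $ i $ j * x $ j)\<bar>)"
    by (intro sum_mono sum_abs)
  also have "\<dots> \<le> (\<Sum>i\<in>(UNIV::'n set). \<Sum>j\<in>(UNIV::'n set). norm x * (c * norm x))"
    unfolding abs_mult
    by (intro sum_mono mult_mono assms component_le_norm_cart mult_nonneg_nonneg c) auto
  also have "\<dots> = c * (real CARD('n))\<^sup>2 * (norm x)\<^sup>2" by (simp add: power2_eq_square)
  finally show ?thesis .
qed

lemma semiconvex_quad:
  fixes A :: "real^'n^'n"
  assumes "sym_mat A" "\<And>x. \<bar>x \<bullet> (A *v x)\<bar> \<le> c * (norm x)\<^sup>2"
  shows "semiconvex c (quad a b A)" "semiconvex c (\<lambda>x. - quad a b A x)"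
proof -
  have *: "\<bar>1/2 * (l * (1 - l) * ((x - y) \<bullet> (A *v (x - y))))\<bar> \<le> c/2 * (l * (1 - l) * (norm (x - y))\<^sup>2)"
    if l: "0 \<le> l \<and> l \<le> 1" for l x y
  proof -
    have "\<bar>1/2 * (l * (1 - l) * ((x - y) \<bullet> (A *v (x - y))))\<bar> = 1/2 * (l * (1 - l)) * \<bar>(x - y) \<bullet> (A *v (x - y))\<bar>"
      using l by (simp add: abs_mult)
    also have "\<dots> \<le> 1/2 * (l * (1 - l)) * (c * (norm (x - y))\<^sup>2)"
      using l assms(2) by (intro mult_left_mono) auto
    finally show ?thesis by (simp add: mult_ac)
  qed
  show "semiconvex c (quad a b A)"
    unfolding semiconvex_iff quad_convex_combination[OF assms(1)]
  proof (intro allI impI)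
    fix x y and l :: real assume "0 \<le> l \<and> l \<le> 1"
    from *[OF this, of x y] show "l * quad a b A x + (1 - l) * quad a b A y - 1/2 * (l * (1 - l) * ((x - y) \<bullet> (A *v (x - y))))
      \<le> l * quad a b A x + (1 - l) * quad a b A y + c/2 * (l * (1 - l) * (norm (x - y))\<^sup>2)"
      by linarith
  qed
  show "semiconvex c (\<lambda>x. - quad a b A x)"
    unfolding semiconvex_iff quad_convex_combination[OF assms(1)]
  proof (intro allI impI)
    fix x y and l :: real assume "0 \<le> l \<and> l \<le> 1"
    from *[OF this, of x y] show "- (l * quad a b A x + (1 - l) * quad a b A y - 1/2 * (l * (1 - l) * ((x - y) \<bullet> (A *v (x - y)))))
      \<le> l * - quad a b A x + (1 - l) * - quad a b A y + c/2 * (l * (1 - l) * (norm (x - y))\<^sup>2)"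
      unfolding mult_minus_right by linarith
  qed
qed

lemma One_inner_Basis:
  fixes i :: "'a::euclidean_space"
  assumes "i \<in> Basis"
  shows "One \<bullet> i = 1"
  using assms by (simp add: inner_sum_left inner_Basis sum.If_cases)

text \<open>On the unit cell containing \<open>z\<close>, adding a quadratic makes \<open>G\<close>
  convex, so it is bounded by its values at the vertices, where the quadratic is at most
  \<open>c/2 * CARD('n)\<close>. Rounding up reaches the box of size \<open>Suc m\<close>.\<close>

lemma lattice_interpolation:
  fixes G :: "real^'n \<Rightarrow> real"
  assumes G: "semiconvex c G" and c: "c \<ge> 0"
    and le: "\<And>s. s \<in> lattice_box (Suc m) \<Longrightarrow> G s \<le> b" and z: "\<And>i. \<bar>z $ i\<bar> \<le> real m"
  shows "G z \<le> b + c/2 * real CARD('n)"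
proof -
  define s where "s = (\<chi> i. real_of_int \<lfloor>z $ i\<rfloor>)"
  let ?V = "{v::real^'n. \<forall>i. v $ i = 0 \<or> v $ i = 1}"
  let ?k = "\<lambda>y. G (s + 1 *\<^sub>R y) + c/2 * (norm y)\<^sup>2"
  have "convex_on UNIV ?k"
    using semiconvex_affine[OF G, of 1 s] unfolding semiconvex_def by simp
  then have cv: "convex_on (convex hull ?V) ?k" by (rule convex_on_subset) auto
  have "?k v \<le> b + c/2 * real CARD('n)" if v: "v \<in> ?V" for v
  proof -
    have "s + v \<in> lattice_box (Suc m)"
      unfolding lattice_box_def
    proof (intro CollectI allI conjI)
      fix i
      have vi: "v $ i = 0 \<or> v $ i = 1" using v by auto
      then show "(s + v) $ i \<in> \<int>" unfolding s_def by auto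
      have "- int m \<le> \<lfloor>z $ i\<rfloor>" "\<lfloor>z $ i\<rfloor> \<le> int m"
        using z[of i] by (auto simp: le_floor_iff floor_le_iff abs_le_iff)
      then have "- real m \<le> real_of_int \<lfloor>z $ i\<rfloor>" "real_of_int \<lfloor>z $ i\<rfloor> \<le> real m" by linarith+
      then show "\<bar>(s + v) $ i\<bar> \<le> real (Suc m)" using vi unfolding s_def by auto
    qed
    moreover have "(norm v)\<^sup>2 \<le> real CARD('n)"
    proof -
      have "(norm v)\<^sup>2 = (\<Sum>i\<in>UNIV. v $ i * v $ i)" unfolding power2_norm_eq_inner inner_vec_def by simp
      also have "\<dots> \<le> (\<Sum>i\<in>(UNIV::'n set). 1)"
      proof (rule sum_mono)
        fix i
        have "v $ i = 0 \<or> v $ i = 1" using v by auto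
        then show "v $ i * v $ i \<le> 1" by auto
      qed
      finally show ?thesis by simp
    qed
    then have "c/2 * (norm v)\<^sup>2 \<le> c/2 * real CARD('n)" using c by (intro mult_left_mono) auto
    ultimately show ?thesis using le[of "s + v"] unfolding scaleR_one by linarith
  qed
  then have "\<forall>y\<in>convex hull ?V. ?k y \<le> b + c/2 * real CARD('n)"
    using convex_on_convex_hull_bound[OF cv] by blast
  moreover have "z - s \<in> convex hull ?V"
  proof -
    have V: "?V = {x. \<forall>i\<in>Basis. x \<bullet> i = 0 \<or> x \<bullet> i = 1}"
      by (auto simp: Basis_vec_def inner_axis)
    note One = One_inner_Basis[where 'a = "real^'n"]
    have "0 \<le> (z - s) $ i \<and> (z - s) $ i \<le> 1" for i unfolding s_def by simp linarith
    then have "z - s \<in> cbox 0 One"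
      unfolding mem_box by (clarsimp simp only: One zero_le_one inner_zero_left) (auto simp: Basis_vec_def inner_axis)
    then show ?thesis unfolding V unit_interval_convex_hull .
  qed
  ultimately have "?k (z - s) \<le> b + c/2 * real CARD('n)" by blast
  moreover have "c/2 * (norm (z - s))\<^sup>2 \<ge> 0" using c by simp
  ultimately show ?thesis by (simp only: scaleR_one add_diff_cancel_left' add.commute[of s] diff_add_cancel)
qed

lemma third_difference_small:
  fixes f :: "real^'n \<Rightarrow> real"
  defines "E \<equiv> range unit_vec \<union> {unit_vec i + unit_vec j |i j. True}"
  assumes reg: "\<And>u v s. u \<in> E \<Longrightarrow> v \<in> E \<Longrightarrow> s \<in> lattice_box (Suc m) \<Longrightarrow>
      \<bar>diff2 f u v s - diff2 f u v (s + u)\<bar> \<le> k"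
    and s: "s \<in> lattice_box m"
  shows "\<bar>diff2 f (unit_vec i) (unit_vec l) (s + unit_vec j) - diff2 f (unit_vec i) (unit_vec l) s\<bar> \<le> 3/2 * k"
proof -
  \<comment> \<open>In the polarization identity the mixed difference sits one step
    \<open>d1\<close> after the base point. Starting one step back puts it at \<open>s\<close>, at
    the price of a larger box.\<close>
  define x where "x = s - unit_vec i"
  have box: "s + d *\<^sub>R unit_vec i \<in> lattice_box (Suc m)" if "d = 1 \<or> d = - 1" for d :: real
    unfolding lattice_box_def
  proof (intro CollectI allI conjI)
    fix q
    have "s $ q \<in> \<int>" "\<bar>s $ q\<bar> \<le> real m" using s unfolding lattice_box_def by auto
    then show "(s + d *\<^sub>R unit_vec i) $ q \<in> \<int>" "\<bar>(s + d *\<^sub>R unit_vec i) $ q\<bar> \<le> real (Suc m)"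
      using that by (auto simp: axis_def)
  qed
  have x: "x \<in> lattice_box (Suc m)" "x + unit_vec i + unit_vec i \<in> lattice_box (Suc m)"
    using box[of "-1"] box[of 1] unfolding x_def by auto
  have E: "unit_vec a \<in> E" "unit_vec a + unit_vec b \<in> E" for a b unfolding E_def by auto
  have eq: "2 * (diff2 f (unit_vec i) (unit_vec l) (s + unit_vec j) - diff2 f (unit_vec i) (unit_vec l) s) =
    (diff2 f (unit_vec i + unit_vec j) (unit_vec l) (x + (unit_vec i + unit_vec j)) - diff2 f (unit_vec i + unit_vec j) (unit_vec l) x)
    - (diff2 f (unit_vec i) (unit_vec l) (x + unit_vec i) - diff2 f (unit_vec i) (unit_vec l) x)
    - (diff2 f (unit_vec j) (unit_vec l) (x + unit_vec i + unit_vec i + unit_vec j) - diff2 f (unit_vec j) (unit_vec l) (x + unit_vec i + unit_vec i))"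
    using diff3_polarization[of f "unit_vec i" "unit_vec l" x "unit_vec j"] unfolding x_def by simp
  have aux: "\<bar>d\<bar> \<le> 3/2 * k" if "2 * d = (P' - P) - (Q' - Q) - (R' - R)"
    "\<bar>P - P'\<bar> \<le> k" "\<bar>Q - Q'\<bar> \<le> k" "\<bar>R - R'\<bar> \<le> k" for d P P' Q Q' R R' :: real
    using that by linarith
  show ?thesis
    by (rule aux[OF eq reg[OF E(2) E(1) x(1)] reg[OF E(1) E(1) x(1)] reg[OF E(1) E(1) x(2)]])
qed

text \<open>In units of the step \<open>t\<close>, the Taylor error on the lattice and the cost of
  filling the cells add up to \<open>Kc * t\<^sup>2\<close>, with \<open>Kc\<close> independent of
  \<open>m\<close>. On the ball of radius \<open>r = t * m\<close> this is at most
  \<open>del * r\<^sup>2\<close> once \<open>m\<close> is large. The index type lets several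
  functions share one point and one radius.\<close>

theorem coarse_quadratic:
  fixes h :: "'b::finite \<Rightarrow> real^'n \<Rightarrow> real"
  assumes h: "\<And>b. semiconvex C (h b)" "\<And>b. semiconvex C (\<lambda>x. - h b x)" and C: "C \<ge> 0"
    and K: "bounded K" "\<not> negligible K" and del: "del > 0"
  shows "\<exists>x r a p A. x \<in> K \<and> 0 < r \<and> r < del \<and> (\<forall>b. sym_mat (A b)) \<and>
    (\<forall>b y. norm (y - x) \<le> r \<longrightarrow> \<bar>h b y - quad (a b) (p b) (A b) (y - x)\<bar> \<le> del * r\<^sup>2)"
proof -
  let ?n = "real CARD('n)"
  have n1: "?n \<ge> 1" by (simp add: Suc_leI)
  define Kc where "Kc = 1 + C * (1 + ?n\<^sup>2) * ?n / 2"
  have Kc: "Kc \<ge> 1" unfolding Kc_def using C n1 by simp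
  obtain m :: nat where m: "Kc / del \<le> real m" using real_arch_simple by blast
  have mpos: "real m > 0" using m divide_pos_pos[of Kc del] Kc del by linarith
  then have m1: "real m \<ge> 1" by simp
  have "Kc \<le> del * real m" using m del by (simp add: pos_divide_le_eq mult.commute)
  also have "\<dots> \<le> del * (real m)\<^sup>2" using m1 del by (simp add: power2_eq_square)
  finally have Km: "Kc \<le> del * (real m)\<^sup>2" .
  define c where "c = (?n * real (Suc m))^3"
  have c: "c > 0" unfolding c_def using n1 by simp
  \<comment> \<open>This makes the lattice Taylor error \<open>3/2 * kap * t\<^sup>2 * c\<close>
    equal to \<open>3/4 * t\<^sup>2\<close>.\<close>
  define kap where "kap = 1 / (2 * c)"
  have kap: "kap > 0" unfolding kap_def using c by simp
  \<comment> \<open>Sums of two unit vectors are included because polarization needs repeated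
    differences in those directions.\<close>
  define E :: "(real^'n) set" where "E = range unit_vec \<union> {unit_vec i + unit_vec j |i j. True}"
  have "E = range unit_vec \<union> (\<lambda>(i, j). unit_vec i + unit_vec j) ` UNIV" unfolding E_def by auto
  then have finE: "finite E" by simp
  have normE: "norm u \<le> 2" if "u \<in> E" for u
    using that norm_triangle_ineq[of "unit_vec _ :: real^'n" "unit_vec _"]
    unfolding E_def by (auto intro: order_trans[OF norm_triangle_ineq])
  define a where "a = (\<lambda>(b, u, v) t x. diff2 (h b) (t *\<^sub>R u) (t *\<^sub>R v) x / t\<^sup>2)"
  have hcont: "continuous_on UNIV (h b)" for b
  proof -
    have "continuous_on UNIV (\<lambda>x. (h b x + C/2 * (norm x)\<^sup>2) - C/2 * (norm x)\<^sup>2)"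
      by (intro continuous_intros convex_on_continuous[OF open_UNIV] h(1)[unfolded semiconvex_def])
    then show ?thesis by simp
  qed
  have hc: "continuous_on UNIV (\<lambda>x. h b (g x))" if "continuous_on UNIV g" for b and g :: "real^'n \<Rightarrow> real^'n"
    using continuous_on_compose2[OF hcont[of b] that] by auto
  \<comment> \<open>The bound on \<open>t\<close> gives \<open>r \<le> del / 2\<close>. Of the two
    successors in the box, one serves the cell corners and the other the recentring in
    \<open>third_difference_small\<close>.\<close>
  have "\<exists>t x. 0 < t \<and> t \<le> del / (2 * real m) \<and> x \<in> K \<and>
    (\<forall>i\<in>UNIV \<times> E \<times> E. \<forall>s\<in>lattice_box (Suc (Suc m)).
      \<bar>a i t (x + t *\<^sub>R s) - a i t (x + t *\<^sub>R s + t *\<^sub>R (fst (snd i)))\<bar> \<le> kap)"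
  proof (rule multiscale_regular_point[where V = "\<lambda>i. snd (snd i)" and C = "4 * C"])
    show "continuous_on UNIV (a i t)" if "t > 0" for i t
    proof -
      obtain b u v where i: "i = (b, u, v)" by (cases i) auto
      show ?thesis unfolding i a_def diff2_def prod.case
        using that by (intro continuous_intros hc) auto
    qed
    show "\<bar>a i t x\<bar> \<le> 4 * C" if i: "i \<in> UNIV \<times> E \<times> E" and t: "t > 0" for i t x
    proof -
      obtain b u v where i': "i = (b, u, v)" by (cases i) auto
      then have uv: "norm u \<le> 2" "norm v \<le> 2" using i normE by auto
      have "\<bar>diff2 (h b) (t *\<^sub>R u) (t *\<^sub>R v) x\<bar> \<le> C * ((norm (t *\<^sub>R u))\<^sup>2 + (norm (t *\<^sub>R v))\<^sup>2) / 2"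
        by (rule semiconvex_diff2_bound[OF h])
      also have "\<dots> = C * t\<^sup>2 * ((norm u)\<^sup>2 + (norm v)\<^sup>2) / 2" by (simp add: power_mult_distrib algebra_simps)
      also have "\<dots> \<le> C * t\<^sup>2 * (2\<^sup>2 + 2\<^sup>2) / 2"
        using uv C by (intro divide_right_mono mult_left_mono add_mono power_mono) auto
      finally show ?thesis unfolding i' a_def using t by (simp add: divide_le_eq)
    qed
    show "a i (2 * t) x = (a i t x + a i t (x + t *\<^sub>R fst (snd i)) + a i t (x + t *\<^sub>R snd (snd i))
        + a i t (x + t *\<^sub>R (fst (snd i) + snd (snd i)))) / 4" if t: "t > 0" for i t x
    proof -
      obtain b u v where i: "i = (b, u, v)" by (cases i) auto
      have two: "(2*t) *\<^sub>R w = t *\<^sub>R w + t *\<^sub>R w" for w :: "real^'n" by (metis mult_2 scaleR_add_left)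
      have "(2 * t)\<^sup>2 = 4 * t\<^sup>2" by (simp add: power_mult_distrib)
      then show ?thesis unfolding i a_def prod.case fst_conv snd_conv two diff2_double using t
        by (simp add: scaleR_add_right add.assoc add_divide_distrib)
    qed
  next
    show "finite ((UNIV :: 'b set) \<times> E \<times> E)" using finE by (intro finite_cartesian_product) auto
    show "0 < del / (2 * real m)" using del mpos by simp
  qed (fact finite_lattice_box kap K)+
  then obtain t x where t: "0 < t" "t \<le> del / (2 * real m)" and x: "x \<in> K"
    and reg: "\<And>b u v s. u \<in> E \<Longrightarrow> v \<in> E \<Longrightarrow> s \<in> lattice_box (Suc (Suc m)) \<Longrightarrow>
      \<bar>a (b, u, v) t (x + t *\<^sub>R s) - a (b, u, v) t (x + t *\<^sub>R s + t *\<^sub>R u)\<bar> \<le> kap"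
    by force
  define f where "f b z = h b (x + t *\<^sub>R z)" for b z
  have df: "diff2 (h b) (t *\<^sub>R u) (t *\<^sub>R v) (x + t *\<^sub>R s) = diff2 (f b) u v s" for b u v s
    unfolding diff2_def f_def by (simp add: scaleR_add_right add.assoc)
  have fsc: "semiconvex (C * t\<^sup>2) (f b)" "semiconvex (C * t\<^sup>2) (\<lambda>z. - f b z)" for b
    using semiconvex_affine[OF h(1)[of b], of t x] semiconvex_affine[OF h(2)[of b], of t x] unfolding f_def by auto
  have reg': "\<bar>diff2 (f b) u v s - diff2 (f b) u v (s + u)\<bar> \<le> kap * t\<^sup>2"
    if "u \<in> E" "v \<in> E" "s \<in> lattice_box (Suc (Suc m))" for b u v s
  proof -
    have "a (b, u, v) t (x + t *\<^sub>R s) = diff2 (f b) u v s / t\<^sup>2"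
      unfolding a_def using df by simp
    moreover have "a (b, u, v) t (x + t *\<^sub>R s + t *\<^sub>R u) = diff2 (f b) u v (s + u) / t\<^sup>2"
      unfolding a_def using df[of b u v "s + u"] by (simp add: scaleR_add_right add.assoc)
    ultimately have "\<bar>diff2 (f b) u v s - diff2 (f b) u v (s + u)\<bar> / t\<^sup>2 \<le> kap"
      using reg[OF that, of b] by (simp add: diff_divide_distrib[symmetric])
    then show ?thesis using t by (simp add: pos_divide_le_eq)
  qed
  define A0 where "A0 b = (\<chi> i j. diff2 (f b) (unit_vec i) (unit_vec j) 0)" for b
  have B0: "0 \<le> 3/2 * (kap * t\<^sup>2)" using kap by simp
  have "\<exists>p. \<forall>s\<in>lattice_box (Suc m). \<bar>f b s - quad (f b 0) p (A0 b) s\<bar> \<le> 3/2 * (kap * t\<^sup>2) * c" for b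
    unfolding c_def A0_def
    by (rule lattice_taylor[OF third_difference_small B0]) (use reg' in \<open>auto simp: E_def\<close>)
  then obtain p0 where p0: "\<And>b s. s \<in> lattice_box (Suc m) \<Longrightarrow> \<bar>f b s - quad (f b 0) (p0 b) (A0 b) s\<bar> \<le> 3/2 * (kap * t\<^sup>2) * c"
    by metis
  have "3/2 * (kap * t\<^sup>2) * c = 3/4 * t\<^sup>2" unfolding kap_def using c by simp
  then have p0: "\<bar>f b s - quad (f b 0) (p0 b) (A0 b) s\<bar> \<le> t\<^sup>2" if "s \<in> lattice_box (Suc m)" for b s
    using p0[OF that, of b] zero_le_power2[of t] by linarith
  have symA: "sym_mat (A0 b)" for b
    unfolding sym_mat_def A0_def by (simp add: vec_eq_iff transpose_def diff2_commute)
  have "\<bar>A0 b $ i $ j\<bar> \<le> C * t\<^sup>2" for b i j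
    unfolding A0_def using semiconvex_diff2_bound[OF fsc, of b "unit_vec i" "unit_vec j" 0] by simp
  then have "\<bar>z \<bullet> (A0 b *v z)\<bar> \<le> C * t\<^sup>2 * ?n\<^sup>2 * (norm z)\<^sup>2" for b z
    by (rule matrix_form_bound)
  note qsc = semiconvex_quad[OF symA this]
  have bound: "\<bar>f b z - quad (f b 0) (p0 b) (A0 b) z\<bar> \<le> Kc * t\<^sup>2" if z: "norm z \<le> real m" for b z
  proof -
    have zi: "\<bar>z $ i\<bar> \<le> real m" for i using component_le_norm_cart[of z i] z by linarith
    have eq: "t\<^sup>2 + (C * t\<^sup>2 + C * t\<^sup>2 * ?n\<^sup>2) / 2 * ?n = Kc * t\<^sup>2" unfolding Kc_def by (simp add: field_simps)
    have c0: "0 \<le> C * t\<^sup>2 + C * t\<^sup>2 * ?n\<^sup>2" using C by simp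
    have "f b z + - quad (f b 0) (p0 b) (A0 b) z \<le> Kc * t\<^sup>2" unfolding eq[symmetric]
      by (rule lattice_interpolation[OF semiconvex_add[OF fsc(1) qsc(2)] c0 _ zi]) (use p0 in \<open>force simp: abs_le_iff\<close>)
    moreover have "- f b z + quad (f b 0) (p0 b) (A0 b) z \<le> Kc * t\<^sup>2" unfolding eq[symmetric]
      by (rule lattice_interpolation[OF semiconvex_add[OF fsc(2) qsc(1)] c0 _ zi]) (use p0 in \<open>force simp: abs_le_iff\<close>)
    ultimately show ?thesis by (simp add: abs_le_iff)
  qed
  define r where "r = t * real m"
  define p where "p b = (1/t) *\<^sub>R p0 b" for b
  define A where "A b = (1/t\<^sup>2) *\<^sub>R A0 b" for b
  have "r > 0" unfolding r_def using t mpos by simp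
  moreover have "r \<le> del / 2" unfolding r_def using t(2) mpos by (simp add: field_simps)
  then have "r < del" using del by simp
  moreover have "sym_mat (A b)" for b
    using symA[of b] unfolding sym_mat_def A_def by (simp add: vec_eq_iff transpose_def)
  moreover have "\<bar>h b y - quad (f b 0) (p b) (A b) (y - x)\<bar> \<le> del * r\<^sup>2" if y: "norm (y - x) \<le> r" for b y
  proof -
    define z where "z = (1/t) *\<^sub>R (y - x)"
    have yz: "y - x = t *\<^sub>R z" unfolding z_def using t by simp
    then have y': "y = x + t *\<^sub>R z" by (simp add: algebra_simps)
    have "t * norm z \<le> t * real m" using y t unfolding yz r_def by simp
    then have "norm z \<le> real m" using t by simp
    from bound[OF this, of b] have "\<bar>h b y - quad (f b 0) (p0 b) (A0 b) z\<bar> \<le> Kc * t\<^sup>2"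
      unfolding f_def y' by simp
    moreover have "quad (f b 0) (p b) (A b) (y - x) = quad (f b 0) (p0 b) (A0 b) z"
      unfolding yz quad_def p_def A_def using t
      by (simp add: scaleR_matrix_vector_assoc[symmetric] matrix_vector_mult_scaleR power2_eq_square)
    moreover have "Kc * t\<^sup>2 \<le> del * (real m)\<^sup>2 * t\<^sup>2" using Km by (rule mult_right_mono) simp
    ultimately show ?thesis unfolding r_def by (simp add: power_mult_distrib mult_ac)
  qed
  ultimately show ?thesis
    using x by (intro exI[of _ x] exI[of _ r] exI[of _ "\<lambda>b. f b 0"] exI[of _ p] exI[of _ A]) simp
qed

section \<open>Interior maxima\<close>

definition smat :: "real \<Rightarrow> real^'n^'n" where "smat t = t *\<^sub>R mat 1"

lemma smat_mult: "smat t *v x = t *\<^sub>R (x :: real^'n)"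
  unfolding smat_def by (simp flip: scaleR_matrix_vector_assoc)

lemma sym_smat: "sym_mat (smat t)"
  unfolding sym_mat_def smat_def by (simp add: vec_eq_iff transpose_def mat_def)

lemma sym_mat_add: "sym_mat A \<Longrightarrow> sym_mat B \<Longrightarrow> sym_mat (A + B)"
  unfolding sym_mat_def by (simp add: vec_eq_iff transpose_def)

lemma sym_mat_minus: "sym_mat A \<Longrightarrow> sym_mat (- A)"
  unfolding sym_mat_def by (simp add: vec_eq_iff transpose_def)

lemma mat_norm_smat: "mat_norm (smat t :: real^'n^'n) = \<bar>t\<bar>"
proof -
  have "mat_norm (smat t :: real^'n^'n) = onorm (\<lambda>x :: real^'n. t *\<^sub>R x)"
    unfolding mat_norm_def by (rule arg_cong[of _ _ onorm]) (rule ext, rule smat_mult)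
  also have "\<dots> = \<bar>t\<bar> * onorm (\<lambda>x :: real^'n. x)" by (rule onorm_scaleR) (rule bounded_linear_ident)
  finally show ?thesis by (simp add: onorm_id)
qed

lemma psd_smat: "t \<ge> 0 \<Longrightarrow> psd_mat (smat t)"
  unfolding psd_mat_def by (simp add: smat_mult)

lemma mat_norm_nonneg: "0 \<le> mat_norm (N :: real^'n^'n)"
  unfolding mat_norm_def by (intro onorm_pos_le matrix_vector_mul_bounded_linear)

lemma ellip_mono:
  assumes "ellip_class lam Lam F" "sym_mat M" "sym_mat N" "psd_mat N"
  shows "F M \<le> F (M + N)"
proof -
  have "0 < lam" "lam * mat_norm N \<le> F (M + N) - F M" using assms unfolding ellip_class_def by auto
  moreover have "0 \<le> lam * mat_norm N" using mat_norm_nonneg[of N] calculation(1) by simp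
  ultimately show ?thesis by linarith
qed

lemma ellip_smat:
  assumes "ellip_class lam Lam F" "sym_mat M" "t \<ge> 0"
  shows "F M + lam * t \<le> F (M + smat t)" "F (M + smat t) \<le> F M + Lam * t"
proof -
  have "lam * mat_norm (smat t :: real^'a^'a) \<le> F (M + smat t) - F M \<and>
    F (M + smat t) - F M \<le> Lam * mat_norm (smat t :: real^'a^'a)"
    using assms sym_smat psd_smat unfolding ellip_class_def by blast
  then show "F M + lam * t \<le> F (M + smat t)" "F (M + smat t) \<le> F M + Lam * t"
    using assms(3) by (auto simp: mat_norm_smat)
qed

text \<open>Quadratic tests from above suffice in the half balls. A supersolution \<open>v\<close>
  enters through \<open>- v\<close>, for which a test with Hessian \<open>A\<close> gives
  information on \<open>F (- A)\<close>.\<close>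

definition quad_above :: "(real^'n \<Rightarrow> real) \<Rightarrow> real^'n \<Rightarrow> real^'n \<Rightarrow> real^'n^'n \<Rightarrow> bool" where
  "quad_above u x p A \<longleftrightarrow> sym_mat A \<and>
     (\<exists>r>0. \<forall>h. norm h < r \<longrightarrow> u (x + h) \<le> u x + p \<bullet> h + 1/2 * (h \<bullet> (A *v h)))"

lemma continuous_on_quad: "continuous_on S (quad a b A)"
  unfolding quad_def[abs_def]
  by (intro continuous_intros linear_continuous_on matrix_vector_mul_bounded_linear)

text \<open>Raising the Hessian by \<open>32 * del\<close> adds \<open>4 * del * r\<^sup>2\<close>
  at distance \<open>r / 2\<close>. This beats the approximation errors at that distance and at the
  centre, each at most \<open>del * r\<^sup>2\<close>, so \<open>U\<close> minus the quadratic has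
  its maximum strictly inside.\<close>

lemma quad_above_near_quadratic:
  fixes U h :: "real^'n \<Rightarrow> real"
  assumes usc: "usc (cball x r) U" and r: "r > 0" and del: "del > 0" and A: "sym_mat A"
    and le: "\<And>y. norm (y - x) \<le> r \<Longrightarrow> U y \<le> h y" and eq: "U x = h x"
    and app: "\<And>y. norm (y - x) \<le> r \<Longrightarrow> \<bar>h y - quad a b A (y - x)\<bar> \<le> del * r\<^sup>2"
  shows "\<exists>y p. norm (y - x) < r / 2 \<and> quad_above U y p (A + smat (32 * del))"
proof -
  let ?B = "A + smat (32 * del)"
  have B: "sym_mat ?B" using A sym_smat by (rule sym_mat_add)
  have qB: "quad a b ?B z = quad a b A z + 16 * del * (norm z)\<^sup>2" for z
    unfolding quad_def
    by (simp add: matrix_vector_mult_add_rdistrib smat_mult inner_add_right power2_norm_eq_inner algebra_simps)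
  let ?G = "\<lambda>y. U y + - quad a b ?B (y - x)"
  have c: "continuous_on (cball x (r/2)) (\<lambda>y. - quad a b ?B (y - x))"
    by (intro continuous_intros continuous_on_compose2[OF continuous_on_quad[of UNIV]]) auto
  have "usc (cball x (r/2)) U" using usc by (rule usc_subset) (use r in auto)
  then have "usc (cball x (r/2)) ?G" using usc_continuous[OF c] by (rule usc_add)
  then obtain y where y: "y \<in> cball x (r/2)" "\<And>y'. y' \<in> cball x (r/2) \<Longrightarrow> ?G y' \<le> ?G y"
    using usc_attains_sup[of "cball x (r/2)" ?G] r by auto
  have rr: "del * r\<^sup>2 > 0" using del r by simp
  have Gx: "?G x \<ge> - (del * r\<^sup>2)"
    using app[of x] eq r unfolding qB by (simp add: abs_le_iff)
  have "norm (y - x) \<noteq> r / 2"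
  proof
    assume n: "norm (y - x) = r / 2"
    have "16 * del * (norm (y - x))\<^sup>2 = 4 * (del * r\<^sup>2)" unfolding n by (simp add: power2_eq_square)
    moreover have "norm (y - x) \<le> r" using n r by simp
    then have "U y - quad a b A (y - x) \<le> del * r\<^sup>2" using app[of y] le[of y] by (simp add: abs_le_iff)
    ultimately have "?G y \<le> - 3 * (del * r\<^sup>2)" unfolding qB by linarith
    then show False using y(2)[of x] Gx rr r by simp
  qed
  then have n: "norm (y - x) < r / 2" using y(1) by (simp add: dist_norm norm_minus_commute)
  have "quad_above U y (b + ?B *v (y - x)) ?B"
    unfolding quad_above_def
  proof (intro conjI B exI[of _ "r/2 - norm (y - x)"] allI impI)
    fix h :: "real^'n" assume "norm h < r / 2 - norm (y - x)"
    then have "norm (y + h - x) \<le> r / 2" using norm_triangle_ineq[of "y - x" h] by (simp add: algebra_simps)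
    then have "?G (y + h) \<le> ?G y" by (intro y(2)) (simp add: dist_norm norm_minus_commute)
    moreover have "y + h - x = (y - x) + h" by simp
    ultimately show "U (y + h) \<le> U y + (b + ?B *v (y - x)) \<bullet> h + 1/2 * (h \<bullet> (?B *v h))"
      using quad_add[OF B, of a b "y - x" h] by simp
  qed (use n in simp)
  then show ?thesis using n by blast
qed

text \<open>Semiconvexity puts a paraboloid of slope \<open>p\<close> below \<open>s\<close> at
  \<open>x\<close>, and the contact at \<open>x'\<close> puts an affine function of slope
  \<open>q\<close> above \<open>s\<close>. They are compared at \<open>x' + z\<close> with
  \<open>z\<close> along \<open>p - q\<close>; the factor \<open>1/(4*c)\<close> lets the quadratic
  term absorb only half of the linear one.\<close>

lemma semiconvex_contact_Lipschitz:
  fixes s :: "'a::euclidean_space \<Rightarrow> real"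
  assumes s: "semiconvex c s" and c: "c > 0"
    and p: "\<And>y. s y - p \<bullet> y \<le> s x - p \<bullet> x" and q: "\<And>y. s y - q \<bullet> y \<le> s x' - q \<bullet> x'"
  shows "norm (p - q) \<le> 4 * c * norm (x - x')"
proof -
  define d v where "d = x' - x" and "v = p - q"
  define z where "z = (1/(4*c)) *\<^sub>R v"
  have "s x + p \<bullet> (d + z) - c * (norm (d + z))\<^sup>2 \<le> s (x + (d + z))"
    using semiconvex_second_difference[OF s, where x = x and z = "d + z"] p[of "x - (d + z)"]
    by (simp add: inner_diff_right inner_add_right)
  also have "\<dots> = s (x' + z)" unfolding d_def by (simp add: algebra_simps)
  also have "\<dots> \<le> s x + p \<bullet> d + q \<bullet> z"
    using q[of "x' + z"] p[of x'] unfolding d_def by (simp add: inner_diff_right inner_add_right)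
  finally have "v \<bullet> z \<le> c * (norm (d + z))\<^sup>2" unfolding v_def by (simp add: inner_add_right inner_diff_left)
  also have "(norm (d + z))\<^sup>2 \<le> 2 * (norm d)\<^sup>2 + 2 * (norm z)\<^sup>2"
  proof -
    have "0 \<le> (norm (d - z))\<^sup>2" by simp
    then show ?thesis unfolding power2_norm_eq_inner by (simp add: algebra_simps inner_commute)
  qed
  finally have "v \<bullet> z \<le> c * (2 * (norm d)\<^sup>2 + 2 * (norm z)\<^sup>2)" using c by (simp add: mult_left_mono)
  moreover have "v \<bullet> z = (norm v)\<^sup>2 / (4*c)" unfolding z_def by (simp add: power2_norm_eq_inner)
  moreover have "(norm z)\<^sup>2 = (norm v)\<^sup>2 / (16 * c\<^sup>2)" unfolding z_def using c by (simp add: power_divide power_mult_distrib)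
  ultimately have "(norm v)\<^sup>2 / (4*c) \<le> 2 * c * (norm d)\<^sup>2 + (norm v)\<^sup>2 / (8*c)"
    using c by (simp add: power2_eq_square field_simps)
  then have "(norm v)\<^sup>2 \<le> 16 * c\<^sup>2 * (norm d)\<^sup>2" using c by (simp add: power2_eq_square field_simps)
  also have "\<dots> = (4 * c * norm d)\<^sup>2" by (simp add: power_mult_distrib)
  finally have "norm v \<le> 4 * c * norm d" by (rule power2_le_imp_le) (use c in simp)
  then show ?thesis unfolding v_def d_def by (simp add: norm_minus_commute)
qed

lemma (in sup_convolution) semiconvex_conv:
  assumes "Z = UNIV" "S \<noteq> {}"
  shows "semiconvex (1/e) conv"
proof (rule semiconvex_touching)
  fix x
  have "x \<in> dom" using assms unfolding dom_def by auto
  from lower_paraboloid[OF this]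
  show "\<exists>p. \<forall>z. conv x + p \<bullet> z - 1/e/2 * (norm z)\<^sup>2 \<le> conv (x + z)"
    using assms(1) e by (intro exI[of _ "(1/e) *\<^sub>R (arg x - x)"]) (auto simp: field_simps)
qed

lemma quad_above_sup_conv:
  fixes u :: "real^'n \<Rightarrow> real"
  assumes "sup_convolution Z S e u" "x \<in> sup_convolution.dom Z S"
    and "quad_above (sup_conv Z S e u) x p A" "sup_convolution.arg Z S e u x \<in> interior S"
  shows "quad_above u (sup_convolution.arg Z S e u x) p A"
proof -
  interpret sup_convolution Z S e u by fact
  obtain r where r: "r > 0" "\<And>h. norm h < r \<Longrightarrow> conv (x + h) \<le> conv x + p \<bullet> h + 1/2 * (h \<bullet> (A *v h))"
    using assms(3) unfolding quad_above_def by auto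
  obtain r' where r': "r' > 0" "ball (arg x) r' \<subseteq> S"
    using assms(4) mem_interior by blast
  show ?thesis
    unfolding quad_above_def
  proof (intro conjI exI[of _ "min r r'"] allI impI)
    show "sym_mat A" using assms(3) unfolding quad_above_def by simp
    fix h :: "real^'n" assume h: "norm h < min r r'"
    then have "arg x + h \<in> S" using r'(2) by (auto simp: dist_norm)
    from increment[OF assms(2) this] r(2)[of h] h
    show "u (arg x + h) \<le> u (arg x) + p \<bullet> h + 1/2 * (h \<bullet> (A *v h))" by simp
  qed (use r r' in auto)
qed


text \<open>The inverse of \<open>X\<close> on its image is Lipschitz and therefore maps null sets
  to null sets.\<close>

lemma not_negligible_expansive_image:
  fixes X :: "'a::euclidean_space \<Rightarrow> 'a"
  assumes D: "\<not> negligible D" and X: "\<And>p q. p \<in> D \<Longrightarrow> q \<in> D \<Longrightarrow> norm (p - q) \<le> B * norm (X p - X q)"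
  shows "\<not> negligible (X ` D)"
proof
  assume n: "negligible (X ` D)"
  have inj: "inj_on X D" using X by (intro inj_onI) force
  define Y where "Y = inv_into D X"
  have Y: "Y (X p) = p" if "p \<in> D" for p unfolding Y_def using inj that by (rule inv_into_f_f)
  have "\<exists>T C. open T \<and> x \<in> T \<and> (\<forall>y\<in>X ` D \<inter> T. norm (Y y - Y x) \<le> C * norm (y - x))" if "x \<in> X ` D" for x
  proof (rule exI[of _ UNIV], rule exI[of _ B], safe)
    show "norm (Y (X q) - Y x) \<le> B * norm (X q - x)" if "q \<in> D" for q
      using \<open>x \<in> X ` D\<close> X[OF that] Y[OF that] Y by auto
  qed auto
  then have "negligible (Y ` (X ` D))"
    by (rule negligible_locally_Lipschitz_image[OF order_refl n])
  moreover have "Y ` (X ` D) = D" using Y by (force simp: image_image)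
  ultimately show False using D by simp
qed

text \<open>The letters \<open>a\<close>, \<open>b\<close> are values of \<open>h1\<close>,
  \<open>h2\<close> and \<open>q\<close>, \<open>r\<close> those of their quadratics, with index 0
  at the centre. The weights 1, 1, 2 make an error of \<open>4 * D\<close> for each
  function.\<close>

lemma second_difference_transfer:
  fixes m n D :: real
  assumes "a1 + b1 + (a2 + b2) \<le> 2 * (a0 + b0)" "q1 + q2 - 2 * q0 = m" "r1 + r2 - 2 * r0 = n"
    "q1 \<le> a1 + D" "q2 \<le> a2 + D" "a0 \<le> q0 + D" "r1 \<le> b1 + D" "r2 \<le> b2 + D" "b0 \<le> r0 + D"
  shows "m + n \<le> 8 * D"
proof -
  have "m \<le> a1 + a2 - 2 * a0 + 4 * D" using assms(2,4,5,6) by linarith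
  moreover have "n \<le> b1 + b2 - 2 * b0 + 4 * D" using assms(3,7,8,9) by linarith
  moreover have "a1 + a2 + b1 + b2 \<le> 2 * a0 + 2 * b0" using assms(1) by simp
  ultimately show ?thesis by linarith
qed

text \<open>The function \<open>w\<close> is minus a supersolution. Constants \<open>c1\<close>,
  \<open>c2\<close> in place of right-hand sides allow \<open>u\<close> and \<open>w\<close> to be
  tested at different points, so that only Hessians are compared.\<close>

theorem interior_no_max:
  fixes F :: "real^'n^'n \<Rightarrow> real" and u w :: "real^'n \<Rightarrow> real"
  assumes F: "ellip_class lam Lam F" and rho: "rho > 0"
    and u: "usc (cball xb rho) u" and w: "usc (cball xb rho) w"
    and M: "\<And>y. y \<in> cball xb rho \<Longrightarrow> \<bar>u y\<bar> \<le> M" "\<And>y. y \<in> cball xb rho \<Longrightarrow> \<bar>w y\<bar> \<le> M"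
    and sub: "\<And>x p A. x \<in> ball xb rho \<Longrightarrow> quad_above u x p A \<Longrightarrow> c1 \<le> F A"
    and super: "\<And>x p A. x \<in> ball xb rho \<Longrightarrow> quad_above w x p A \<Longrightarrow> F (- A) \<le> c2"
    and c: "c2 < c1" and max: "\<And>y. y \<in> cball xb rho \<Longrightarrow> u y + w y \<le> u xb + w xb"
  shows False
proof -
  let ?S = "cball xb rho"
  have Lam: "Lam > 0" using F unfolding ellip_class_def by linarith
  \<comment> \<open>The penalty \<open>eta\<close> makes the maximum strict; its price
    \<open>2 * eta * Lam\<close> is half of the gap \<open>c1 - c2\<close>.\<close>
  define eta where "eta = (c1 - c2) / (4 * Lam)"
  have eta: "eta > 0" unfolding eta_def using c Lam by simp
  define c1' where "c1' = c1 - 2 * eta * Lam"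
  have c1': "c1' - c2 = (c1 - c2) / 2" unfolding c1'_def eta_def using Lam by (simp add: field_simps)
  define u' where "u' y = u y - eta * (norm (y - xb))\<^sup>2" for y
  define M' where "M' = M + eta * rho\<^sup>2"
  have M0: "M \<ge> 0" using M(1)[of xb] rho by force
  then have M'0: "M' \<ge> 0" unfolding M'_def using eta by simp
  have u'M: "\<bar>u' y\<bar> \<le> M'" if "y \<in> ?S" for y
  proof -
    have "(norm (y - xb))\<^sup>2 \<le> rho\<^sup>2" using that by (intro power_mono) (auto simp: dist_norm norm_minus_commute)
    then have "eta * (norm (y - xb))\<^sup>2 \<le> eta * rho\<^sup>2" "0 \<le> eta * (norm (y - xb))\<^sup>2" using eta by simp_all
    then show ?thesis using M(1)[OF that] unfolding u'_def M'_def by linarith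
  qed
  have wM: "\<bar>w y\<bar> \<le> M'" if "y \<in> ?S" for y
  proof -
    have "0 \<le> eta * rho\<^sup>2" using eta by simp
    then show ?thesis using M(2)[OF that] unfolding M'_def by linarith
  qed
  have usc': "usc ?S u'"
  proof -
    have "usc ?S (\<lambda>y. u y + - (eta * (norm (y - xb))\<^sup>2))"
      by (intro usc_add u usc_continuous continuous_intros)
    then show ?thesis unfolding u'_def by simp
  qed
  have sub': "c1' \<le> F A" if x: "x \<in> ball xb rho" and q: "quad_above u' x p A" for x p A
  proof -
    obtain r where r: "r > 0" "\<And>h. norm h < r \<Longrightarrow> u' (x + h) \<le> u' x + p \<bullet> h + 1/2 * (h \<bullet> (A *v h))"
      and A: "sym_mat A" using q unfolding quad_above_def by auto
    have "quad_above u x (p + (2 * eta) *\<^sub>R (x - xb)) (A + smat (2 * eta))"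
      unfolding quad_above_def
    proof (intro conjI exI[of _ r] allI impI r(1) sym_mat_add A sym_smat)
      fix h :: "real^'n" assume "norm h < r"
      from r(2)[OF this] have "u (x + h) - eta * (norm (x + h - xb))\<^sup>2 \<le> u x - eta * (norm (x - xb))\<^sup>2 + p \<bullet> h + 1/2 * (h \<bullet> (A *v h))"
        unfolding u'_def .
      moreover have "(norm (x + h - xb))\<^sup>2 = (norm (x - xb))\<^sup>2 + 2 * ((x - xb) \<bullet> h) + h \<bullet> h"
        unfolding power2_norm_eq_inner by (simp add: algebra_simps inner_commute)
      then have "eta * (norm (x + h - xb))\<^sup>2 = eta * (norm (x - xb))\<^sup>2 + 2 * eta * ((x - xb) \<bullet> h) + eta * (h \<bullet> h)"
        by (simp only: distrib_left mult.assoc mult.left_commute)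
      moreover have "(p + (2 * eta) *\<^sub>R (x - xb)) \<bullet> h = p \<bullet> h + 2 * eta * ((x - xb) \<bullet> h)"
        by (simp add: inner_add_left)
      moreover have "h \<bullet> ((A + smat (2 * eta)) *v h) = h \<bullet> (A *v h) + 2 * (eta * (h \<bullet> h))"
        by (simp add: matrix_vector_mult_add_rdistrib smat_mult inner_add_right)
      ultimately show "u (x + h) \<le> u x + (p + (2 * eta) *\<^sub>R (x - xb)) \<bullet> h + 1/2 * (h \<bullet> ((A + smat (2 * eta)) *v h))"
        by linarith
    qed
    from sub[OF x this] have "c1 \<le> F (A + smat (2 * eta))" .
    also have "\<dots> \<le> F A + Lam * (2 * eta)" by (rule ellip_smat(2)[OF F A]) (use eta in simp)
    also have "Lam * (2 * eta) = 2 * eta * Lam" by simp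
    finally show ?thesis unfolding c1'_def by linarith
  qed
  have strict: "u' y + w y < u' xb + w xb" if "y \<in> ?S" "y \<noteq> xb" for y
  proof -
    have "eta * (norm (y - xb))\<^sup>2 > 0" using that(2) eta by simp
    then show ?thesis using max[OF that(1)] unfolding u'_def by simp
  qed
  have "\<exists>e0>0. \<forall>e p y z. 0 < e \<and> e \<le> e0 \<and> norm p \<le> e \<and> y \<in> ?S \<and> z \<in> ?S \<and>
    u' xb + w xb - p \<bullet> xb \<le> u' y + w z - (norm (y - z))\<^sup>2 / (4*e) - p \<bullet> ((1/2) *\<^sub>R (y + z)) \<longrightarrow>
    dist y xb < rho/4 \<and> dist z xb < rho/4"
    by (rule doubling_near[OF compact_cball usc' w _ u'M wM strict]) (use rho in auto)
  then obtain e0 where e0: "e0 > 0" and near: "\<And>e p y z. \<lbrakk>0 < e; e \<le> e0; norm p \<le> e; y \<in> ?S; z \<in> ?S;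
    u' xb + w xb - p \<bullet> xb \<le> u' y + w z - (norm (y - z))\<^sup>2 / (4*e) - p \<bullet> ((1/2) *\<^sub>R (y + z))\<rbrakk> \<Longrightarrow>
    dist y xb < rho/4 \<and> dist z xb < rho/4"
    by blast
  \<comment> \<open>The bound \<open>e0\<close> localizes the doubled maximizers, \<open>1\<close>
    and \<open>rho/4\<close> together give \<open>e * e \<le> rho/4\<close> for the shift by
    \<open>(e/2) *\<^sub>R p\<close>, and the last one keeps \<open>arg\<close> within
    \<open>rho/4\<close>.\<close>
  define e where "e = min (min e0 1) (min (rho/4) (rho\<^sup>2 / (64 * (M' + 1))))"
  have e: "0 < e" "e \<le> e0" "e \<le> 1" "e \<le> rho/4" "e \<le> rho\<^sup>2 / (64 * (M' + 1))"
  proof -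
    have "rho\<^sup>2 / (64 * (M' + 1)) > 0" using rho M'0 by simp
    then show "0 < e" unfolding e_def using e0 rho by simp
  qed (simp_all only: e_def min.coboundedI1 min.coboundedI2 order_refl)
  have eM: "4 * e * M' \<le> (rho/4)\<^sup>2"
  proof -
    have "e * (64 * (M' + 1)) \<le> rho\<^sup>2" using e(5) M'0 by (simp add: pos_le_divide_eq)
    then have "64 * (e * M') + 64 * e \<le> rho\<^sup>2" by (simp add: algebra_simps)
    moreover have "(rho/4)\<^sup>2 = rho\<^sup>2 / 16" by (simp add: power_divide)
    ultimately show ?thesis using e(1) by simp
  qed
  have ee: "e * e \<le> rho / 4" using mult_mono[OF e(4) e(3)] e(1) rho by simp
  interpret U: sup_convolution UNIV ?S e u'
    by (rule sup_convolution.intro[OF compact_cball subspace_UNIV e(1) usc'])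
  interpret W: sup_convolution UNIV ?S e w
    by (rule sup_convolution.intro[OF compact_cball subspace_UNIV e(1) w])
  have dom: "U.dom = UNIV" unfolding U.dom_def using rho by (auto intro: exI[of _ xb])
  have Sne: "?S \<noteq> {}" using rho by simp
  have "\<exists>x. dist x xb \<le> 3/8 * rho \<and> (\<forall>x'. U.conv x' + W.conv x' - p \<bullet> x' \<le> U.conv x + W.conv x - p \<bullet> x)"
    if p: "p \<in> cball 0 e" for p
  proof -
    have pe: "norm p \<le> e" using p by simp
    obtain y z where yz: "y \<in> ?S" "z \<in> ?S"
      and mx: "\<And>y' z'. y' \<in> ?S \<Longrightarrow> z' \<in> ?S \<Longrightarrow> y' - z' \<in> UNIV \<Longrightarrow> u' y' + w z' - (norm (y' - z'))\<^sup>2 / (4*e) - p \<bullet> ((1/2) *\<^sub>R (y' + z'))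
      \<le> u' y + w z - (norm (y - z))\<^sup>2 / (4*e) - p \<bullet> ((1/2) *\<^sub>R (y + z))"
      using doubling_attained[OF compact_cball Sne subspace_UNIV usc' w e(1), of p] by blast
    have "dist y xb < rho/4 \<and> dist z xb < rho/4"
    proof (rule near[OF e(1,2) pe yz])
      have xx: "(1/2) *\<^sub>R (xb + xb) = xb" by (rule scaleR_half_double)
      have "xb \<in> ?S" using rho by simp
      from mx[OF this this UNIV_I] show "u' xb + w xb - p \<bullet> xb \<le> u' y + w z - (norm (y - z))\<^sup>2 / (4*e) - p \<bullet> ((1/2) *\<^sub>R (y + z))"
        unfolding xx diff_self norm_zero by (simp only: power_zero_numeral div_0 diff_zero)
    qed
    then have n: "norm (y - xb) < rho/4" "norm (z - xb) < rho/4" by (auto simp: dist_norm)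
    let ?x = "(1/2) *\<^sub>R (y + z) - (e/2) *\<^sub>R p"
    have "?x - xb = (1/2) *\<^sub>R ((y - xb) + (z - xb)) - (e/2) *\<^sub>R p"
      by (simp add: vec_eq_iff field_simps)
    then have "norm (?x - xb) \<le> norm ((1/2) *\<^sub>R ((y - xb) + (z - xb))) + norm ((e/2) *\<^sub>R p)"
      by (metis norm_triangle_ineq4)
    also have "\<dots> \<le> (rho/4 + rho/4)/2 + (e * e)/2"
    proof (rule add_mono)
      show "norm ((1/2) *\<^sub>R ((y - xb) + (z - xb))) \<le> (rho/4 + rho/4)/2"
        using n norm_triangle_ineq[of "y - xb" "z - xb"] by simp
      show "norm ((e/2) *\<^sub>R p) \<le> (e * e)/2" using pe e(1) by simp
    qed
    also have "\<dots> \<le> 3/8 * rho" using ee by simp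
    finally have "dist ?x xb \<le> 3/8 * rho" by (simp add: dist_norm)
    moreover have "U.conv x' + W.conv x' - p \<bullet> x' \<le> U.conv ?x + W.conv ?x - p \<bullet> ?x" for x'
      by (rule sup_conv_sum_max[OF U.sup_convolution_axioms W.sup_convolution_axioms UNIV_I yz UNIV_I mx refl])
        (use dom in auto)
    ultimately show ?thesis by blast
  qed
  then obtain X where X: "\<And>p. p \<in> cball 0 e \<Longrightarrow> dist (X p) xb \<le> 3/8 * rho"
    "\<And>p x'. p \<in> cball 0 e \<Longrightarrow> U.conv x' + W.conv x' - p \<bullet> x' \<le> U.conv (X p) + W.conv (X p) - p \<bullet> X p"
    by metis
  define K where "K = X ` cball 0 e"
  have Usc: "semiconvex (1/e) U.conv" and Wsc: "semiconvex (1/e) W.conv"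
    using U.semiconvex_conv W.semiconvex_conv Sne by auto
  have Lip: "norm (p - q) \<le> 4 * (1/e + 1/e) * norm (X p - X q)" if "p \<in> cball 0 e" "q \<in> cball 0 e" for p q
    by (rule semiconvex_contact_Lipschitz[OF semiconvex_add[OF Usc Wsc]]) (use X(2) that e(1) in auto)
  have "\<not> negligible (cball (0::real^'n) e)"
    using open_not_negligible[of "ball (0::real^'n) e"] e(1) negligible_subset[OF _ ball_subset_cball] by auto
  then have "\<not> negligible K"
    unfolding K_def using Lip by (rule not_negligible_expansive_image)
  note K = this
  have "bounded (cball xb (3/8 * rho))" "K \<subseteq> cball xb (3/8 * rho)"
    unfolding K_def using X(1) by (auto simp: dist_commute)
  then have Kb: "bounded K" by (rule bounded_subset)
  have UW: "U.conv x + W.conv x \<le> M' + M'" for x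
  proof (rule add_mono)
    show "U.conv x \<le> M'" using u'M dom by (intro U.conv_le) (force simp: abs_le_iff)+
    show "W.conv x \<le> M'" using wM dom by (intro W.conv_le) (force simp: abs_le_iff)+
  qed
  have e0': "0 \<le> 1/e" using e(1) by simp
  obtain h1 h2 where h: "\<forall>x. U.conv x \<le> h1 x" "\<forall>x. W.conv x \<le> h2 x" "concave_on UNIV (\<lambda>x. h1 x + h2 x)"
    "semiconvex (3*(1/e)) h1" "semiconvex (3*(1/e)) (\<lambda>x. - h1 x)"
    "semiconvex (3*(1/e)) h2" "semiconvex (3*(1/e)) (\<lambda>x. - h2 x)"
    and contact: "\<forall>x p. (\<forall>y. U.conv y + W.conv y - p \<bullet> y \<le> U.conv x + W.conv x - p \<bullet> x) \<longrightarrow> h1 x = U.conv x \<and> h2 x = W.conv x"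
    using C11_majorants[OF Usc Wsc UW e0'] by blast
  note h' = h(1)[rule_format] h(2)[rule_format]
  \<comment> \<open>The matrices \<open>B1\<close> and \<open>- B2\<close> will be ordered up to
    \<open>72 * del\<close>: 8 from the concavity of \<open>h1 + h2\<close> tested at distance
    \<open>r\<close>, and 32 from each touching paraboloid. With 144 in the denominator this costs
    at most half of the remaining gap.\<close>
  define del where "del = min (rho/8) ((c1' - c2) / (144 * Lam))"
  have del0: "del > 0" "del \<le> rho/8" unfolding del_def using rho Lam c1' c by auto
  have "del \<le> (c1' - c2) / (144 * Lam)" unfolding del_def by simp
  then have "del * (144 * Lam) \<le> c1' - c2" using Lam by (simp add: pos_le_divide_eq)
  then have del: "del > 0" "del \<le> rho/8" "72 * del * Lam < c1' - c2" using del0 c c1' by auto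
  have "\<exists>x r a p A. x \<in> K \<and> 0 < r \<and> r < del \<and> (\<forall>i::bool. sym_mat (A i)) \<and>
    (\<forall>i y. norm (y - x) \<le> r \<longrightarrow> \<bar>(if i then h1 else h2) y - quad (a i) (p i) (A i) (y - x)\<bar> \<le> del * r\<^sup>2)"
  proof (rule coarse_quadratic[of "3*(1/e)"])
    show "semiconvex (3*(1/e)) (if i then h1 else h2)" for i using h by simp
    show "semiconvex (3*(1/e)) (\<lambda>x. - (if i then h1 else h2) x)" for i using h by simp
  qed (use e0' K Kb del(1) in auto)
  then obtain x r a b A where x: "x \<in> K" and r: "0 < r" "r < del" and A: "\<And>i::bool. sym_mat (A i)"
    and app: "\<And>i y. norm (y - x) \<le> r \<Longrightarrow> \<bar>(if i then h1 else h2) y - quad (a i) (b i) (A i) (y - x)\<bar> \<le> del * r\<^sup>2"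
    by blast
  obtain p where p: "p \<in> cball 0 e" "x = X p" using x unfolding K_def by auto
  have xd: "dist x xb \<le> 3/8 * rho" using X(1) p by simp
  have eq: "h1 x = U.conv x" "h2 x = W.conv x" using contact[rule_format, where x = x and p = p] X(2)[OF p(1)] unfolding p(2) by auto
  have usU: "usc (cball x r) U.conv" "usc (cball x r) W.conv"
    using U.usc_conv W.usc_conv dom by (auto intro: usc_subset)
  define B1 B2 where "B1 = A True + smat (32 * del)" and "B2 = A False + smat (32 * del)"
  obtain y1 p1 where y1: "norm (y1 - x) < r/2" "quad_above U.conv y1 p1 B1"
    using quad_above_near_quadratic[OF usU(1) r(1) del(1) A h'(1) eq(1)[symmetric] app[of _ True, simplified]]
    unfolding B1_def by blast
  obtain y2 p2 where y2: "norm (y2 - x) < r/2" "quad_above W.conv y2 p2 B2"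
    using quad_above_near_quadratic[OF usU(2) r(1) del(1) A h'(2) eq(2)[symmetric] app[of _ False, simplified]]
    unfolding B2_def by blast
  have yd: "dist y xb < rho/2" if "norm (y - x) < r/2" for y
    using dist_triangle[of y xb x] that xd r del(2) by (simp add: dist_norm)
  have arg: "z \<in> ball xb rho" if "dist y xb < rho/2" "(norm (y - z))\<^sup>2 \<le> 4 * e * M'" for y z
  proof -
    have "norm (y - z) \<le> rho/4"
      by (rule power2_le_imp_le[OF order_trans[OF that(2) eM]]) (use rho in simp)
    then show ?thesis using dist_triangle[of z xb y] that(1) rho by (simp add: dist_norm norm_minus_commute)
  qed
  have a1: "U.arg y1 \<in> ball xb rho"
    by (rule arg[OF yd[OF y1(1)] U.arg_near[OF _ u'M]]) (use yd[OF y1(1)] rho in \<open>auto simp: dist_commute\<close>)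
  have a2: "W.arg y2 \<in> ball xb rho"
    by (rule arg[OF yd[OF y2(1)] W.arg_near[OF _ wM]]) (use yd[OF y2(1)] rho in \<open>auto simp: dist_commute\<close>)
  have "c1' \<le> F B1"
    by (rule sub'[OF a1 quad_above_sup_conv[OF U.sup_convolution_axioms _ y1(2)]]) (use dom a1 in auto)
  moreover have "F (- B2) \<le> c2"
    by (rule super[OF a2 quad_above_sup_conv[OF W.sup_convolution_axioms _ y2(2)]]) (use dom a2 in auto)
  moreover have "F B1 \<le> F (- B2) + Lam * (72 * del)"
  proof -
    have sB: "sym_mat B1" "sym_mat B2" unfolding B1_def B2_def using A sym_smat sym_mat_add by blast+
    define N where "N = (- B2 + smat (72 * del)) + - B1"
    have sN: "sym_mat N" unfolding N_def using sB sym_smat by (intro sym_mat_add sym_mat_minus)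
    have zz: "z \<bullet> (A True *v z) + z \<bullet> (A False *v z) \<le> 8 * (del * r\<^sup>2)" if z: "norm z = r" for z
    proof -
      let ?D = "del * r\<^sup>2"
      have "semiconvex 0 (\<lambda>x. - (h1 x + h2 x))"
        using h(3) unfolding semiconvex_def concave_on_def by simp
      from semiconvex_second_difference[OF this, of z x]
      have 1: "h1 (x + z) + h2 (x + z) + (h1 (x - z) + h2 (x - z)) \<le> 2 * (h1 x + h2 x)" by simp
      have "quad c d B z + quad c d B (- z) - 2 * quad c d B 0 = z \<bullet> (B *v z)" for c d and B :: "real^'n^'n"

      proof -
        have "B *v (- z) = - (B *v z)" by (simp add: matrix_vector_mult_def vec_eq_iff sum_negf)
        then show ?thesis unfolding quad_def by simp
      qed
      note 2 = this[of "a True" "b True" "A True"] this[of "a False" "b False" "A False"]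
      have 3: "quad (a True) (b True) (A True) z \<le> h1 (x + z) + ?D"
        "quad (a True) (b True) (A True) (- z) \<le> h1 (x - z) + ?D"
        "h1 x \<le> quad (a True) (b True) (A True) 0 + ?D"
        "quad (a False) (b False) (A False) z \<le> h2 (x + z) + ?D"
        "quad (a False) (b False) (A False) (- z) \<le> h2 (x - z) + ?D"
        "h2 x \<le> quad (a False) (b False) (A False) 0 + ?D"
        using app[of "x + z" True] app[of "x - z" True] app[of x True]
          app[of "x + z" False] app[of "x - z" False] app[of x False] z r(1)
        by (simp_all add: abs_le_iff)
      show ?thesis
        using second_difference_transfer[OF 1 2 3] .
    qed
    have "psd_mat N"
      unfolding psd_mat_def
    proof
      fix xi :: "real^'n"
      have "xi \<bullet> (A True *v xi) + xi \<bullet> (A False *v xi) \<le> 8 * del * (norm xi)\<^sup>2"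
      proof (cases "xi = 0")
        case False
        define t where "t = r / norm xi"
        have t: "t > 0" "norm (t *\<^sub>R xi) = r" unfolding t_def using False r by auto
        have "t\<^sup>2 * (xi \<bullet> (A True *v xi) + xi \<bullet> (A False *v xi)) \<le> 8 * (del * r\<^sup>2)"
          using zz[OF t(2)] by (simp add: matrix_vector_mult_scaleR power2_eq_square algebra_simps)
        also have "r\<^sup>2 = t\<^sup>2 * (norm xi)\<^sup>2" using t by (simp add: power_mult_distrib[symmetric])
        finally have "t\<^sup>2 * (xi \<bullet> (A True *v xi) + xi \<bullet> (A False *v xi)) \<le> t\<^sup>2 * (8 * del * (norm xi)\<^sup>2)"
          by (simp add: mult_ac)
        then show ?thesis using t(1) by simp
      qed simp
      moreover have "xi \<bullet> (N *v xi) = 8 * del * (norm xi)\<^sup>2 - (xi \<bullet> (A True *v xi) + xi \<bullet> (A False *v xi))"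
      proof -
        have m: "(- B) *v xi = - (B *v xi)" for B :: "real^'n^'n"
          by (simp add: matrix_vector_mult_def vec_eq_iff sum_negf)
        have t: "xi \<bullet> (t *\<^sub>R xi) = t * (norm xi)\<^sup>2" for t by (simp add: power2_norm_eq_inner)
        show ?thesis unfolding N_def B1_def B2_def matrix_vector_mult_add_rdistrib m smat_mult
            minus_add_distrib inner_add_right inner_minus_right t
          by algebra
      qed
      ultimately show "0 \<le> xi \<bullet> (N *v xi)" by simp
    qed
    from ellip_mono[OF F sB(1) sN this] have "F B1 \<le> F (- B2 + smat (72 * del))" unfolding N_def by simp
    also have "\<dots> \<le> F (- B2) + Lam * (72 * del)"
      by (rule ellip_smat(2)[OF F sym_mat_minus[OF sB(2)]]) (use del(1) in simp)
    finally show ?thesis .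
  qed
  ultimately show False using del(3) by (simp add: mult_ac)
qed

section \<open>Normal slopes at the interface\<close>

definition tang :: "'n \<Rightarrow> real^'n \<Rightarrow> real^'n::finite" where
  "tang k h = h - (h $ k) *\<^sub>R unit_vec k"

definition kk_mat :: "'n \<Rightarrow> real^'n^'n::finite" where
  "kk_mat k = (\<chi> i j. if i = k \<and> j = k then 1 else 0)"

lemma inner_unit_vec: "x \<bullet> unit_vec k = x $ k" "unit_vec k \<bullet> x = x $ k"
  by (simp_all add: inner_axis inner_axis')

lemma tang_nth [simp]: "tang k h $ k = 0"
  unfolding tang_def by (simp add: axis_def)

lemma tang_add: "tang k (x + y) = tang k x + tang k y"
  unfolding tang_def by (simp add: algebra_simps)

lemma tang_id: "z $ k = 0 \<Longrightarrow> tang k z = z"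
  unfolding tang_def by simp

lemma tang_unit_vec: "tang k (c *\<^sub>R unit_vec k) = 0"
  unfolding tang_def by (simp add: axis_def)

lemma norm_tang: "(norm h)\<^sup>2 = (norm (tang k h))\<^sup>2 + (h $ k)\<^sup>2"
  unfolding tang_def power2_norm_eq_inner
  by (simp add: inner_diff_left inner_diff_right inner_unit_vec power2_eq_square)

lemma norm_tang_le: "norm (tang k h) \<le> norm h"
  by (rule power2_le_imp_le) (simp_all add: norm_tang[of h k])

lemma norm_le_tang: "norm h \<le> norm (tang k h) + \<bar>h $ k\<bar>"
proof (rule power2_le_imp_le)
  show "(norm h)\<^sup>2 \<le> (norm (tang k h) + \<bar>h $ k\<bar>)\<^sup>2"
    unfolding norm_tang[of h k] power2_sum by simp
qed simp

lemma tang_continuous [continuous_intros]: "continuous_on S (tang k)"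
  unfolding tang_def[abs_def] by (intro continuous_intros)

lemma kk_mat_mult: "kk_mat k *v x = (x $ k) *\<^sub>R unit_vec k"
proof -
  have "(\<Sum>j\<in>UNIV. (if i = k \<and> j = k then 1 else 0) * x $ j) = (if i = k then x $ k else 0)" for i
  proof -
    have "(\<Sum>j\<in>UNIV. (if i = k \<and> j = k then 1 else 0) * x $ j) = (\<Sum>j\<in>UNIV. if j = k then (if i = k then x $ k else 0) else 0)"
      by (intro sum.cong) auto
    then show ?thesis by simp
  qed
  then show ?thesis
    unfolding kk_mat_def by (simp add: vec_eq_iff matrix_vector_mult_def axis_def)
qed

lemma sym_kk_mat: "sym_mat (t *\<^sub>R kk_mat k)"
  unfolding sym_mat_def kk_mat_def by (simp add: vec_eq_iff transpose_def)

lemma scaleR_kk_mat_mult: "(t *\<^sub>R kk_mat k) *v x = (t * x $ k) *\<^sub>R unit_vec k"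
  by (simp add: kk_mat_mult flip: scaleR_matrix_vector_assoc)

lemma psd_kk_mat: "t \<ge> 0 \<Longrightarrow> psd_mat (t *\<^sub>R kk_mat k)"
  unfolding psd_mat_def by (simp add: scaleR_kk_mat_mult inner_unit_vec mult.assoc)

lemma mat_norm_kk_mat: "t \<ge> 0 \<Longrightarrow> t \<le> mat_norm (t *\<^sub>R kk_mat k)"
proof -
  assume t: "t \<ge> 0"
  have "norm ((t *\<^sub>R kk_mat k) *v unit_vec k) \<le> onorm (\<lambda>x. (t *\<^sub>R kk_mat k) *v x) * norm (unit_vec k :: real^'a)"
    by (rule onorm) (rule matrix_vector_mul_bounded_linear)
  moreover have "norm ((t *\<^sub>R kk_mat k) *v unit_vec k) = t" using t by (simp add: scaleR_kk_mat_mult)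
  moreover have "norm (unit_vec k :: real^'a) = 1" by simp
  ultimately show ?thesis unfolding mat_norm_def by (simp only: mult_1_right)
qed

text \<open>The Hessian of the barrier \<open>c |x|\<^sup>2 - m c x\<^sub>k\<^sup>2\<close>: concave enough in the normal direction to
  make it a strict supersolution.\<close>

definition barrier_mat :: "'n \<Rightarrow> real \<Rightarrow> real \<Rightarrow> real^'n^'n::finite" where
  "barrier_mat k m c = smat (2*c) + (- (2*m*c)) *\<^sub>R kk_mat k"

lemma sym_barrier_mat: "sym_mat (barrier_mat k m c)"
  unfolding barrier_mat_def by (intro sym_mat_add sym_smat sym_kk_mat)

lemma barrier_mat_form: "1/2 * (h \<bullet> (barrier_mat k m c *v h)) = c * (norm h)\<^sup>2 - m * c * (h $ k)\<^sup>2"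
  unfolding barrier_mat_def
  by (simp add: matrix_vector_mult_add_rdistrib smat_mult scaleR_kk_mat_mult inner_diff_right inner_add_right inner_unit_vec
      dot_square_norm power2_eq_square algebra_simps)

text \<open>The isotropic part raises \<open>F\<close> by at most \<open>2 * Lam * c\<close>, while
  the normal part lowers it by at least \<open>2 * lam * m * c = 2 * (Lam + 1) * c\<close>. This
  fixes \<open>m\<close>.\<close>

lemma barrier_mat_supersolution:
  assumes F: "ellip_class lam Lam F" and c: "c \<ge> 0" and m: "m = (Lam + 1) / lam"
  shows "F (barrier_mat k m c) \<le> - 2 * c"
proof -
  have lam: "lam > 0" "Lam \<ge> lam" "F 0 = 0" using F unfolding ellip_class_def by auto
  have m0: "m > 0" unfolding m using lam by simp
  let ?N = "(2*m*c) *\<^sub>R kk_mat k :: real^'a^'a"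
  have "lam * mat_norm ?N \<le> F (barrier_mat k m c + ?N) - F (barrier_mat k m c)"
    using F sym_barrier_mat[of k m c] sym_kk_mat psd_kk_mat[of "2*m*c" k] m0 c unfolding ellip_class_def by auto
  moreover have "barrier_mat k m c + ?N = smat (2*c)" unfolding barrier_mat_def by (simp flip: scaleR_add_left)
  moreover have "F (0 + smat (2*c)) \<le> F 0 + Lam * (2*c)"
    by (rule ellip_smat(2)[OF F]) (use c in \<open>auto simp: sym_mat_def vec_eq_iff transpose_def\<close>)
  moreover have "lam * (2*m*c) \<le> lam * mat_norm ?N"
    using mat_norm_kk_mat[of "2*m*c" k] m0 c lam(1) by (intro mult_left_mono) auto
  moreover have "lam * (2*m*c) = 2 * (Lam + 1) * c" unfolding m using lam(1) by simp
  ultimately show ?thesis using lam(3) by (simp add: algebra_simps)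
qed

text \<open>If \<open>U\<close> exceeded the quadratic somewhere, the maximum of the difference
  would be an interior point where the quadratic itself is an admissible test, against the strict
  inequality \<open>F M < - K0\<close>.\<close>

lemma quadratic_comparison:
  fixes F :: "real^'n^'n \<Rightarrow> real" and K0 :: real
  assumes R: "compact R" and usc: "usc R U" and M: "sym_mat M" and F: "F M < - K0"
    and pts: "\<And>h. h \<in> R \<Longrightarrow> U h \<le> quad a b M h \<or> h \<in> interior R \<and> (\<forall>p A. quad_above U h p A \<longrightarrow> - K0 \<le> F A)"
    and h: "h \<in> R"
  shows "U h \<le> quad a b M h"
proof -
  have "usc R (\<lambda>h. U h + - quad a b M h)"
    by (intro usc_add usc usc_continuous continuous_intros continuous_on_quad)
  then obtain y where y: "y \<in> R" "\<And>y'. y' \<in> R \<Longrightarrow> U y' + - quad a b M y' \<le> U y + - quad a b M y"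
    using usc_attains_sup[OF R, of "\<lambda>h. U h + - quad a b M h"] h by blast
  have "U y \<le> quad a b M y"
  proof (rule ccontr)
    assume "\<not> ?thesis"
    then have i: "y \<in> interior R" and s: "\<And>p A. quad_above U y p A \<Longrightarrow> - K0 \<le> F A" using pts[OF y(1)] by auto
    obtain r where r: "r > 0" "ball y r \<subseteq> R" using i mem_interior by blast
    have "quad_above U y (b + M *v y) M"
      unfolding quad_above_def
    proof (intro conjI M exI[of _ r] r(1) allI impI)
      fix h :: "real^'n" assume "norm h < r"
      then have "y + h \<in> R" using r(2) by (auto simp: dist_norm)
      from y(2)[OF this] show "U (y + h) \<le> U y + (b + M *v y) \<bullet> h + 1/2 * (h \<bullet> (M *v h))"
        unfolding quad_add[OF M] by simp
    qed
    from s[OF this] F show False by linarith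
  qed
  then show ?thesis using y(2)[OF h] by simp
qed

section \<open>One-sided barriers and normal slopes on half cylinders\<close>

definition slab :: "'n \<Rightarrow> real \<Rightarrow> real \<Rightarrow> real \<Rightarrow> (real^'n::finite) set" where
  "slab k sg r t = {h. norm (tang k h) \<le> r \<and> 0 \<le> sg * h $ k \<and> sg * h $ k \<le> t}"

lemma compact_slab:
  assumes "sg = 1 \<or> sg = - 1"
  shows "compact (slab k sg r t)"
proof -
  have "norm h \<le> r + t" if "h \<in> slab k sg r t" for h
    using norm_le_tang[of h k] that assms unfolding slab_def by auto
  then have "bounded (slab k sg r t)" unfolding bounded_iff by blast
  moreover have "slab k sg r t = {h. norm (tang k h) \<le> r} \<inter> {h. 0 \<le> sg * h $ k} \<inter> {h. sg * h $ k \<le> t}"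
    unfolding slab_def by auto
  moreover have "closed {h. norm (tang k h) \<le> r}" "closed {h :: real^'a. 0 \<le> sg * h $ k}" "closed {h :: real^'a. sg * h $ k \<le> t}"
    by (intro closed_Collect_le continuous_intros)+
  ultimately show ?thesis unfolding compact_eq_bounded_closed by auto
qed

lemma interior_slab:
  assumes "norm (tang k h) < r" "0 < sg * h $ k" "sg * h $ k < t"
  shows "h \<in> interior (slab k sg r t)"
proof -
  have "open ({h. norm (tang k h) < r} \<inter> {h. 0 < sg * h $ k} \<inter> {h. sg * h $ k < t})"
    by (intro open_Int open_Collect_less continuous_intros)
  moreover have "{h. norm (tang k h) < r} \<inter> {h. 0 < sg * h $ k} \<inter> {h. sg * h $ k < t} \<subseteq> slab k sg r t"
    unfolding slab_def by auto
  ultimately show ?thesis using assms by (auto intro: interiorI)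
qed

text \<open>The contact point is moved to \<open>0\<close>, with its value and tangential slope
  subtracted, so that \<open>U\<close> is at most quadratic on the flat part.
  \<open>tangential\<close> is what tangential sup-convolution provides, \<open>K0\<close> is all
  that remains of the right-hand side, and \<open>sg\<close> selects the side of the
  interface.\<close>

locale half_slab_sub =
  fixes k :: "'n::finite" and sg rho K0 M c lam Lam m :: real and F :: "real^'n^'n \<Rightarrow> real" and U :: "real^'n \<Rightarrow> real"
  assumes F: "ellip_class lam Lam F" and sg: "sg = 1 \<or> sg = - 1" and rho: "rho > 0" and K0: "K0 \<ge> 0" and c: "c \<ge> 0"
    and usc: "usc (slab k sg rho rho) U" and M: "\<And>h. h \<in> slab k sg rho rho \<Longrightarrow> \<bar>U h\<bar> \<le> M"
    and sub: "\<And>h p A. h \<in> slab k sg rho rho \<Longrightarrow> norm (tang k h) < rho \<Longrightarrow> 0 < sg * h $ k \<Longrightarrow> sg * h $ k < rho \<Longrightarrow>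
      quad_above U h p A \<Longrightarrow> - K0 \<le> F A"
    and flat: "\<And>h. h \<in> slab k sg rho rho \<Longrightarrow> h $ k = 0 \<Longrightarrow> U h \<le> c * (norm h)\<^sup>2"
    and tangential: "\<And>h. h \<in> slab k sg rho rho \<Longrightarrow> \<exists>q. \<forall>z. z $ k = 0 \<and> h + z \<in> slab k sg rho rho \<longrightarrow>
      U h + q \<bullet> z - c * (norm z)\<^sup>2 \<le> U (h + z)"
    and m: "m = (Lam + 1) / lam"
begin

text \<open>The normal slopes of functions dominating \<open>U\<close> on one side up to a quadratic
  error; their infimum is the best one-sided slope of a test function.\<close>

definition slope where
  "slope a \<longleftrightarrow> (\<exists>C r. 0 < r \<and> 0 \<le> C \<and>
     (\<forall>h. norm h < r \<and> 0 \<le> sg * h $ k \<longrightarrow> U h \<le> a * (sg * h $ k) + C * (norm h)\<^sup>2))"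

lemma m1: "m \<ge> 1"
proof -
  have "0 < lam" "lam \<le> Lam" using F unfolding ellip_class_def by auto
  then show ?thesis unfolding m by (simp add: pos_le_divide_eq)
qed

lemma sg_sq: "(sg * x)\<^sup>2 = x\<^sup>2"
  using sg by auto

lemma barrier:
  assumes r: "0 < r" "r \<le> rho" and t: "0 < t" "t \<le> rho" and c1: "c1 \<ge> c" "c1 > K0"
    and side: "\<And>h. h \<in> slab k sg r t \<Longrightarrow> norm (tang k h) = r \<Longrightarrow> U h \<le> b * (sg * h $ k) + c1 * (norm h)\<^sup>2 - m * c1 * (h $ k)\<^sup>2"
    and top: "\<And>h. h \<in> slab k sg r t \<Longrightarrow> sg * h $ k = t \<Longrightarrow> U h \<le> b * (sg * h $ k) + c1 * (norm h)\<^sup>2 - m * c1 * (h $ k)\<^sup>2"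
  shows "slope b" "\<And>h. h \<in> slab k sg r t \<Longrightarrow> U h \<le> b * (sg * h $ k) + c1 * (norm h)\<^sup>2"
proof -
  let ?q = "quad 0 ((b * sg) *\<^sub>R unit_vec k) (barrier_mat k m c1)"
  have q: "?q h = b * (sg * h $ k) + c1 * (norm h)\<^sup>2 - m * c1 * (h $ k)\<^sup>2" for h
    unfolding quad_def barrier_mat_form by (simp add: inner_unit_vec)
  have sub': "slab k sg r t \<subseteq> slab k sg rho rho" unfolding slab_def using r t by auto
  have c10: "c1 \<ge> 0" using c c1 by simp
  have le: "U h \<le> ?q h" if h: "h \<in> slab k sg r t" for h
  proof (rule quadratic_comparison[OF compact_slab[OF sg] usc_subset[OF usc sub'] sym_barrier_mat _ _ h])
    show "F (barrier_mat k m c1) < - K0"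
      using barrier_mat_supersolution[OF F c10 m, of k] c1 K0 by linarith
    fix y assume y: "y \<in> slab k sg r t"
    then have y': "y \<in> slab k sg rho rho" using sub' by auto
    consider "norm (tang k y) = r" | "sg * y $ k = t" | "y $ k = 0" | "norm (tang k y) < r" "0 < sg * y $ k" "sg * y $ k < t"
      using y sg unfolding slab_def by fastforce
    then show "U y \<le> ?q y \<or> y \<in> interior (slab k sg r t) \<and> (\<forall>p A. quad_above U y p A \<longrightarrow> - K0 \<le> F A)"
    proof cases
      case 1 then show ?thesis using side[OF y] q by simp
    next
      case 2 then show ?thesis using top[OF y] q by simp
    next
      case 3
      have "c * (norm y)\<^sup>2 \<le> c1 * (norm y)\<^sup>2" using c1 by (intro mult_right_mono) auto
      then have "U y \<le> ?q y" unfolding q using flat[OF y' 3] 3 by simp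
      then show ?thesis by blast
    next
      case 4
      then show ?thesis using interior_slab[of k y r sg t] sub[OF y'] r t by auto
    qed
  qed
  have "m * c1 * (h $ k)\<^sup>2 \<ge> 0" for h :: "real^'n" using m1 c10 by simp
  then show le': "U h \<le> b * (sg * h $ k) + c1 * (norm h)\<^sup>2" if "h \<in> slab k sg r t" for h
    using le[OF that] unfolding q by (smt (verit))
  have "h \<in> slab k sg r t" if "norm h < min r t" "0 \<le> sg * h $ k" for h
    using that norm_tang_le[of k h] component_le_norm_cart[of h k] sg unfolding slab_def by auto
  then show "slope b" unfolding slope_def
    using le' c10 r t by (intro exI[of _ c1] exI[of _ "min r t"]) auto
qed

lemma slope_exists: "\<exists>b. slope b"
proof -
  have M0: "M \<ge> 0"
  proof -
    have "0 \<in> slab k sg rho rho" unfolding slab_def tang_def using rho by simp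
    then show ?thesis using M by force
  qed
  \<comment> \<open>\<open>M / rho\<^sup>2\<close> takes care of the lateral side, where
    \<open>norm h \<ge> rho\<close>. In \<open>b\<close> below, \<open>M / rho\<close> takes care of
    the top and \<open>m * c1 * rho\<close> offsets the negative normal term of the barrier.\<close>
  define c1 where "c1 = max (c + K0 + 1) (M / rho\<^sup>2)"
  have c1: "c1 \<ge> c" "c1 > K0" "c1 \<ge> 0" unfolding c1_def using c K0 by auto
  have "M / rho\<^sup>2 \<le> c1" unfolding c1_def by simp
  then have c1M: "M \<le> c1 * rho\<^sup>2" using rho by (simp add: pos_divide_le_eq)
  define b where "b = M / rho + m * c1 * rho"
  have mc: "m * c1 \<ge> 0" using m1 c1 by simp
  have t: "m * c1 * (h $ k)\<^sup>2 \<le> m * c1 * rho * (sg * h $ k)" if "h \<in> slab k sg rho rho" for h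
  proof -
    have "(sg * h $ k)\<^sup>2 \<le> rho * (sg * h $ k)"
      unfolding power2_eq_square using that unfolding slab_def by (intro mult_right_mono) auto
    then show ?thesis unfolding sg_sq using mult_left_mono[OF _ mc] by (simp add: mult.assoc)
  qed
  have "slope b"
  proof (rule barrier(1)[OF rho order_refl rho order_refl c1(1,2)])
    fix h assume h: "h \<in> slab k sg rho rho"
    have U: "U h \<le> M" using M[OF h] by simp
    have tp: "0 \<le> sg * h $ k" using h unfolding slab_def by auto
    have bt: "b * (sg * h $ k) = M / rho * (sg * h $ k) + m * c1 * rho * (sg * h $ k)"
      unfolding b_def by (simp add: distrib_right)
    have Mt: "M / rho * (sg * h $ k) \<ge> 0" using M0 rho tp by simp
    {
      assume "norm (tang k h) = rho"
      then have "rho\<^sup>2 \<le> (norm h)\<^sup>2" using norm_tang_le[of k h] rho by (intro power_mono) auto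
      then have "c1 * rho\<^sup>2 \<le> c1 * (norm h)\<^sup>2" using c1(3) by (rule mult_left_mono)
      then show "U h \<le> b * (sg * h $ k) + c1 * (norm h)\<^sup>2 - m * c1 * (h $ k)\<^sup>2"
        using U c1M t[OF h] bt Mt by linarith
    next
      assume "sg * h $ k = rho"
      then have "M / rho * (sg * h $ k) = M" using rho by simp
      moreover have "c1 * (norm h)\<^sup>2 \<ge> 0" using c1(3) by simp
      ultimately show "U h \<le> b * (sg * h $ k) + c1 * (norm h)\<^sup>2 - m * c1 * (h $ k)\<^sup>2"
        using U t[OF h] bt by linarith
    }
  qed
  then show ?thesis ..
qed


text \<open>At height \<open>s\<^sup>2\<close> a tangential move of length \<open>s\<close> keeps
  the upper bound of order \<open>s\<^sup>2\<close>, so the outward component of the tangential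
  slope \<open>q\<close> is at most of order \<open>s\<close>. Returning to the axis over a distance
  at most \<open>kp * s\<^sup>2\<close> can then lower \<open>U\<close> only by order
  \<open>s^3\<close>, less than the assumed drop \<open>d/2 * s\<^sup>2\<close>.\<close>

lemma flat_oscillation:
  assumes a: "\<And>h. norm h < r1 \<Longrightarrow> 0 \<le> sg * h $ k \<Longrightarrow> U h \<le> a * (sg * h $ k) + C * (norm h)\<^sup>2"
    and C: "C \<ge> 0" and d: "d > 0" and kp: "kp \<ge> 1"
    and s: "0 < s" "s \<le> 1" "(kp + 2) * s \<le> rho" "(kp + 2) * s < r1"
      "((d/2 + C * (2 * kp\<^sup>2 + 1) + 2 * C + c) * kp + c * kp\<^sup>2) * s < d/2"
    and axis: "U ((sg * s\<^sup>2) *\<^sub>R unit_vec k) \<le> (a - d) * s\<^sup>2"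
    and z: "z $ k = 0" "norm z \<le> kp * s\<^sup>2"
  shows "U (z + (sg * s\<^sup>2) *\<^sub>R unit_vec k) \<le> (a - d/2) * s\<^sup>2"
proof (rule ccontr)
  let ?e = "(sg * s\<^sup>2) *\<^sub>R unit_vec k :: real^'n" and ?B = "d/2 + C * (2 * kp\<^sup>2 + 1) + 2 * C + c"
  assume neg: "\<not> ?thesis"
  have s2: "s\<^sup>2 \<le> s" using s(1,2) by (simp add: power2_eq_square)
  have B0: "?B \<ge> 0" using d C c by simp
  have z0: "z \<noteq> 0"
  proof
    assume "z = 0"
    then have "(a - d/2) * s\<^sup>2 < (a - d) * s\<^sup>2" using neg axis by simp
    then show False using d s(1) by simp
  qed
  have sgk: "sg * (sg * x) = x" for x using sg by auto
  have nz: "norm z \<le> kp * s" using z(2) mult_left_mono[OF s2, of kp] kp by linarith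
  have inS: "w + ?e \<in> slab k sg rho rho" if "w $ k = 0" "norm w \<le> (kp + 1) * s" for w
  proof -
    have "norm (tang k (w + ?e)) = norm w" using that(1) by (simp add: tang_add tang_unit_vec tang_id)
    moreover have "(kp + 1) * s \<le> (kp + 2) * s" "s \<le> (kp + 2) * s"
      using s(1) kp mult_right_mono[of 1 "kp + 2" s] by (auto simp: algebra_simps)
    moreover have "s\<^sup>2 \<le> rho" using s2 calculation(3) s(3) by linarith
    ultimately show ?thesis unfolding slab_def using that s(3) by (simp add: sgk)
  qed
  have "norm z \<le> (kp + 1) * s" using nz s(1) by (simp add: algebra_simps)
  then obtain q where q: "\<And>y. y $ k = 0 \<Longrightarrow> (z + ?e) + y \<in> slab k sg rho rho \<Longrightarrow>
      U (z + ?e) + q \<bullet> y - c * (norm y)\<^sup>2 \<le> U (z + ?e + y)"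
    using tangential[OF inS[OF z(1)]] by blast
  \<comment> \<open>Going outward along the ray of \<open>z\<close> makes
    \<open>q \<bullet> z\<close> a positive multiple of \<open>q \<bullet> w\<close>, which is
    bounded above.\<close>
  define w where "w = (s / norm z) *\<^sub>R z"
  have w: "w $ k = 0" "norm w = s" unfolding w_def using z(1) z0 s(1) by auto
  have zw: "norm (z + w) \<le> (kp + 1) * s" using norm_triangle_ineq[of z w] nz w(2) by (simp add: algebra_simps)
  have zwe: "z + w + ?e \<in> slab k sg rho rho" by (rule inS) (use z w zw in auto)
  have "(norm (z + w))\<^sup>2 \<le> 2 * (kp * s\<^sup>2)\<^sup>2 + 2 * s\<^sup>2"
  proof -
    have "0 \<le> (norm (z - w))\<^sup>2" by simp
    then have "(norm (z + w))\<^sup>2 \<le> 2 * (norm z)\<^sup>2 + 2 * (norm w)\<^sup>2"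
      unfolding power2_norm_eq_inner by (simp add: algebra_simps inner_commute)
    moreover have "(norm z)\<^sup>2 \<le> (kp * s\<^sup>2)\<^sup>2" using z(2) by (rule power_mono) simp
    ultimately show ?thesis unfolding w(2) by linarith
  qed
  moreover have "(norm (z + w + ?e))\<^sup>2 = (norm (z + w))\<^sup>2 + (s\<^sup>2)\<^sup>2"
    using norm_tang[of "z + w + ?e" k] z(1) w(1) sg_sq[of "s\<^sup>2"] by (simp add: tang_add tang_unit_vec tang_id)
  moreover have s4: "(s\<^sup>2)\<^sup>2 \<le> s\<^sup>2" using s2 s(1,2) by (simp add: power2_eq_square mult_le_one)
  moreover have "(kp * s\<^sup>2)\<^sup>2 \<le> kp\<^sup>2 * s\<^sup>2" using s4 by (simp add: power_mult_distrib mult_left_mono)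
  ultimately have n2: "(norm (z + w + ?e))\<^sup>2 \<le> (2 * kp\<^sup>2 + 1 + 2) * s\<^sup>2" by (simp add: algebra_simps)
  have "norm (z + w + ?e) \<le> (kp + 1) * s + s"
    using norm_triangle_ineq[of "z + w" ?e] zw s2 sg by (auto simp: abs_mult)
  then have lt: "norm (z + w + ?e) < r1" using s(4) by (simp add: algebra_simps)
  have tk: "sg * (z + w + ?e) $ k = s\<^sup>2" using z(1) w(1) by (simp add: sgk)
  have "U (z + w + ?e) \<le> a * s\<^sup>2 + C * (norm (z + w + ?e))\<^sup>2"
    using a[OF lt] unfolding tk by simp
  also have "\<dots> \<le> a * s\<^sup>2 + C * ((2 * kp\<^sup>2 + 1 + 2) * s\<^sup>2)"
    using n2 C by (intro add_left_mono mult_left_mono)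
  finally have up: "U (z + w + ?e) \<le> a * s\<^sup>2 + C * ((2 * kp\<^sup>2 + 1 + 2) * s\<^sup>2)" .
  have zew: "z + ?e + w = z + w + ?e" by simp
  have "U (z + ?e) + q \<bullet> w - c * s\<^sup>2 \<le> U (z + w + ?e)"
    using q[OF w(1)] zwe unfolding zew w(2) by blast
  then have "q \<bullet> w \<le> ?B * s\<^sup>2" using up neg by (simp add: algebra_simps)
  moreover have "q \<bullet> w = s * (q \<bullet> z) / norm z" unfolding w_def by simp
  ultimately have "s * (q \<bullet> z) \<le> ?B * s\<^sup>2 * norm z" using z0 by (simp add: pos_divide_le_eq)
  then have "s * (q \<bullet> z) \<le> s * (?B * s * norm z)" by (simp add: power2_eq_square mult_ac)
  then have "q \<bullet> z \<le> ?B * s * norm z" using s(1) by simp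
  also have "\<dots> \<le> ?B * s * (kp * s\<^sup>2)" using B0 s(1) z(2) by (intro mult_left_mono) auto
  finally have qz: "q \<bullet> z \<le> ?B * kp * s * s\<^sup>2" by (simp add: mult_ac)
  have "?e \<in> slab k sg rho rho" using inS[of 0] kp s(1) by simp
  then have "U (z + ?e) + q \<bullet> (- z) - c * (norm (- z))\<^sup>2 \<le> U (z + ?e + - z)"
    by (intro q) (use z(1) in auto)
  then have "U (z + ?e) - q \<bullet> z - c * (norm z)\<^sup>2 \<le> U ?e" by simp
  moreover have "c * (norm z)\<^sup>2 \<le> c * kp\<^sup>2 * s * s\<^sup>2"
  proof -
    have "(norm z)\<^sup>2 \<le> (kp * s\<^sup>2)\<^sup>2" using z(2) by (rule power_mono) simp
    also have "\<dots> = kp\<^sup>2 * (s\<^sup>2 * s\<^sup>2)" by (simp add: power2_eq_square mult_ac)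
    also have "\<dots> \<le> kp\<^sup>2 * (s * s\<^sup>2)" using s2 by (intro mult_left_mono mult_right_mono) auto
    finally have "c * (norm z)\<^sup>2 \<le> c * (kp\<^sup>2 * (s * s\<^sup>2))" using c by (rule mult_left_mono)
    then show ?thesis by (simp add: mult_ac)
  qed
  ultimately have "(a - d/2) * s\<^sup>2 - (?B * kp + c * kp\<^sup>2) * s * s\<^sup>2 < (a - d) * s\<^sup>2"
    using neg axis qz by (simp add: algebra_simps)
  then have "(d/2) * s\<^sup>2 < ((?B * kp + c * kp\<^sup>2) * s) * s\<^sup>2" by (simp add: algebra_simps)
  moreover have "((?B * kp + c * kp\<^sup>2) * s) * s\<^sup>2 < (d/2) * s\<^sup>2"
    using s(1,5) by (intro mult_strict_right_mono) auto
  ultimately show False by simp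
qed

text \<open>At a height \<open>r\<close> with a low axis value, \<open>flat_oscillation\<close>
  makes the whole disc of radius \<open>kp * r\<close> low. The barrier on the half cylinder below
  it, with the old bound on the lateral side and the better one on top, carries a smaller slope down
  to the contact point.\<close>

lemma slope_improves:
  assumes a: "slope a" and d: "d > 0"
    and freq: "\<And>r0. r0 > 0 \<Longrightarrow> \<exists>r. 0 < r \<and> r < r0 \<and> U ((sg * r) *\<^sub>R unit_vec k) \<le> (a - d) * r"
  shows "slope (a - d/4)"
proof -
  obtain C0 r1 where C0: "C0 \<ge> 0" and r1: "r1 > 0"
    and up0: "\<And>h. norm h < r1 \<Longrightarrow> 0 \<le> sg * h $ k \<Longrightarrow> U h \<le> a * (sg * h $ k) + C0 * (norm h)\<^sup>2"
    using a unfolding slope_def by auto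
  define C where "C = C0 + c + K0 + 1"
  have C: "C \<ge> 0" "C \<ge> c" "C > K0" unfolding C_def using C0 c K0 by auto
  have up: "U h \<le> a * (sg * h $ k) + C * (norm h)\<^sup>2" if "norm h < r1" "0 \<le> sg * h $ k" for h
  proof -
    have "C0 * (norm h)\<^sup>2 \<le> C * (norm h)\<^sup>2" unfolding C_def using c K0 by (intro mult_right_mono) auto
    then show ?thesis using up0[OF that] by linarith
  qed
  \<comment> \<open>With \<open>kp = 2 * m\<close> the lateral correction costs
    \<open>m * d / (2 * kp\<^sup>2) = d / (8 * m) \<le> d / 8\<close> in the slope. Together with
    \<open>m * C * r \<le> d / 8\<close> this leaves \<open>d / 4\<close> of the gain
    \<open>d / 2\<close>.\<close>
  define kp where "kp = 2 * m"
  have kp: "kp \<ge> 1" unfolding kp_def using m1 by simp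
  define L where "L = (d/2 + C * (2 * kp\<^sup>2 + 1) + 2 * C + c) * kp + c * kp\<^sup>2"
  have L: "L \<ge> 0" unfolding L_def using d C c kp by simp
  \<comment> \<open>In turn: \<open>s \<le> 1\<close>, room inside the half cylinder of size
    \<open>rho\<close>, room inside the radius \<open>r1\<close>, the smallness required by
    \<open>flat_oscillation\<close>, and \<open>m * C * r \<le> d / 8\<close>.\<close>
  define s0 where "s0 = min (min 1 (rho / (kp + 2))) (min (r1 / (2 * (kp + 2))) (min (d / (4 * (L + 1))) (d / (8 * m * (C + 1)))))"
  have s0: "s0 > 0" unfolding s0_def using rho r1 d L C m1 kp by simp
  have "s0 \<le> 1" "s0 \<le> rho / (kp + 2)" "s0 \<le> r1 / (2 * (kp + 2))" "s0 \<le> d / (4 * (L + 1))" "s0 \<le> d / (8 * m * (C + 1))"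
    unfolding s0_def by (simp_all only: min.coboundedI1 min.coboundedI2 order_refl)
  then have s0': "s0 \<le> 1" "s0 * (kp + 2) \<le> rho" "s0 * (2 * (kp + 2)) \<le> r1" "s0 * (4 * (L + 1)) \<le> d" "s0 * (8 * m * (C + 1)) \<le> d"
    using kp L C m1 by (simp_all add: pos_le_divide_eq)
  obtain r where r: "0 < r" "r < s0\<^sup>2" "U ((sg * r) *\<^sub>R unit_vec k) \<le> (a - d) * r" using freq[of "s0\<^sup>2"] s0 by auto
  define s where "s = sqrt r"
  have s: "s > 0" "s\<^sup>2 = r" unfolding s_def using r by auto
  have ss: "s < s0" using r(2) s0 unfolding s(2)[symmetric] by (simp add: power_less_imp_less_base)
  have s1: "s \<le> 1" using ss s0' by simp
  have rs: "r \<le> s" unfolding s(2)[symmetric] using s(1) s1 by (simp add: power2_eq_square)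
  have f1: "(kp + 2) * s \<le> rho"
  proof -
    have "s * (kp + 2) \<le> s0 * (kp + 2)" using ss kp by (intro mult_right_mono) auto
    then show ?thesis using s0'(2) by (simp add: mult.commute)
  qed
  have f2: "(kp + 2) * s < r1"
  proof -
    have "s * (kp + 2) < s0 * (2 * (kp + 2))" using ss kp s(1) s0 by (intro mult_strict_mono) auto
    then show ?thesis using s0'(3) by (simp add: mult.commute)
  qed
  have f3: "L * s < d / 2"
  proof -
    have "s * (4 * (L + 1)) \<le> s0 * (4 * (L + 1))" using ss L by (intro mult_right_mono) auto
    then have "4 * (L * s) + 4 * s \<le> d" using s0'(4) by (simp add: algebra_simps)
    then show ?thesis using s(1) d by linarith
  qed
  have f4: "m * C * r \<le> d / 8"
  proof -
    have "r * (8 * m * (C + 1)) \<le> s0 * (8 * m * (C + 1))" using rs ss m1 C by (intro mult_right_mono) auto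
    then have "8 * (m * C * r) + 8 * (m * r) \<le> d" using s0'(5) by (simp add: algebra_simps)
    moreover have "m * r \<ge> 0" using m1 r by simp
    ultimately show ?thesis by linarith
  qed
  have disc: "U h \<le> (a - d/2) * r" if h: "norm (tang k h) \<le> kp * r" "sg * h $ k = r" for h
  proof -
    have "h $ k = sg * r" using h(2) sg by auto
    then have "tang k h + (sg * s\<^sup>2) *\<^sub>R unit_vec k = h" unfolding tang_def s(2) by simp
    moreover have "U (tang k h + (sg * s\<^sup>2) *\<^sub>R unit_vec k) \<le> (a - d/2) * s\<^sup>2"
      by (rule flat_oscillation[OF up C(1) d kp s(1) s1 f1 f2 f3[unfolded L_def]]) (use h r(3) s(2) in auto)
    ultimately show ?thesis unfolding s(2) by simp
  qed
  have kpr: "kp * r > 0" "kp * r \<le> rho" "r \<le> rho" "kp * r + r < r1"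
  proof -
    have k1: "kp * r \<le> kp * s" using rs kp by (intro mult_left_mono) auto
    have k2: "(kp + 2) * s = kp * s + 2 * s" by (simp add: algebra_simps)
    have k3: "kp * s \<ge> 0" using kp s(1) by simp
    show "kp * r > 0" using kp r(1) by simp
    show "kp * r \<le> rho" "r \<le> rho" using k1 k2 k3 f1 rs s(1) by linarith+
    show "kp * r + r < r1" using k1 k2 k3 f2 rs s(1) by linarith
  qed
  \<comment> \<open>The added term contributes \<open>d/2 * r\<close> on the lateral side, which
    pays for lowering the slope by \<open>d/2\<close> up to height \<open>r\<close>.\<close>
  define c1 where "c1 = C + d / (2 * kp\<^sup>2 * r)"
  have c1: "c1 \<ge> c" "c1 > K0" "c1 \<ge> 0" "c1 \<ge> C"
  proof -
    have "d / (2 * kp\<^sup>2 * r) \<ge> 0" using d r kp by simp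
    then show "c1 \<ge> c" "c1 > K0" "c1 \<ge> 0" "c1 \<ge> C" unfolding c1_def using C by linarith+
  qed
  have c1r: "c1 * (kp * r)\<^sup>2 = C * (kp * r)\<^sup>2 + d/2 * r"
    unfolding c1_def using kp r(1) by (simp add: field_simps power2_eq_square)
  have mc1r: "m * c1 * r \<le> d / 4"
  proof -
    have "m * c1 * r = m * C * r + m * d / (2 * kp\<^sup>2)" unfolding c1_def using r(1) kp by (simp add: field_simps)
    also have "m * d / (2 * kp\<^sup>2) = d / (8 * m)" unfolding kp_def using m1 by (simp add: field_simps power2_eq_square)
    also have "d / (8 * m) \<le> d / 8" using d m1 by (simp add: field_simps)
    finally show ?thesis using f4 by linarith
  qed
  define b where "b = a - d/2 + m * c1 * r"
  have mc: "m * c1 \<ge> 0" using m1 c1 by simp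
  have tt: "m * c1 * (h $ k)\<^sup>2 \<le> m * c1 * r * (sg * h $ k)" if "h \<in> slab k sg (kp * r) r" for h
  proof -
    have "(sg * h $ k)\<^sup>2 \<le> r * (sg * h $ k)"
      unfolding power2_eq_square using that unfolding slab_def by (intro mult_right_mono) auto
    then show ?thesis unfolding sg_sq using mult_left_mono[OF _ mc] by (simp add: mult.assoc)
  qed
  have bt: "b * (sg * h $ k) = (a - d/2) * (sg * h $ k) + m * c1 * r * (sg * h $ k)" for h :: "real^'n"
    unfolding b_def by (simp add: algebra_simps)
  have side: "U h \<le> b * (sg * h $ k) + c1 * (norm h)\<^sup>2 - m * c1 * (h $ k)\<^sup>2"
    if h: "h \<in> slab k sg (kp * r) r" and n: "norm (tang k h) = kp * r" for h
  proof -
    have tp: "0 \<le> sg * h $ k" "sg * h $ k \<le> r" using h unfolding slab_def by auto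
    have "\<bar>h $ k\<bar> \<le> r" using tp sg by auto
    then have "norm h < r1" using norm_le_tang[of h k] n kpr(4) by simp
    then have "U h \<le> a * (sg * h $ k) + C * (norm h)\<^sup>2" using up tp by simp
    moreover have nn: "(norm h)\<^sup>2 = (kp * r)\<^sup>2 + (h $ k)\<^sup>2" using norm_tang[of h k] n by simp
    moreover have "c1 * (norm h)\<^sup>2 = C * (kp * r)\<^sup>2 + d/2 * r + c1 * (h $ k)\<^sup>2"
      unfolding nn using c1r by (simp add: distrib_left)
    moreover have "C * (norm h)\<^sup>2 = C * (kp * r)\<^sup>2 + C * (h $ k)\<^sup>2" unfolding nn by (simp add: distrib_left)
    moreover have "C * (h $ k)\<^sup>2 \<le> c1 * (h $ k)\<^sup>2" using c1 by (intro mult_right_mono) auto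
    moreover have "d/2 * (sg * h $ k) \<le> d/2 * r" using tp d by (intro mult_left_mono) auto
    moreover have "(a - d/2) * (sg * h $ k) = a * (sg * h $ k) - d/2 * (sg * h $ k)" by (simp add: algebra_simps)
    ultimately show ?thesis
      using bt[of h] tt[OF h] by linarith
  qed
  have top: "U h \<le> b * (sg * h $ k) + c1 * (norm h)\<^sup>2 - m * c1 * (h $ k)\<^sup>2"
    if h: "h \<in> slab k sg (kp * r) r" and n: "sg * h $ k = r" for h
  proof -
    have "U h \<le> (a - d/2) * r" by (rule disc) (use h n in \<open>auto simp: slab_def\<close>)
    moreover have "c1 * (norm h)\<^sup>2 \<ge> 0" using c1 by simp
    ultimately show ?thesis
      using bt[of h] tt[OF h] unfolding n by linarith
  qed
  have le: "U h \<le> b * (sg * h $ k) + c1 * (norm h)\<^sup>2" if "h \<in> slab k sg (kp * r) r" for h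
    by (rule barrier(2)[OF kpr(1,2) r(1) kpr(3) c1(1,2) _ _ that]) (fact side top)+
  show ?thesis
    unfolding slope_def
  proof (rule exI[of _ c1], rule exI[of _ r], intro conjI allI impI)
    fix h :: "real^'n" assume h: "norm h < r \<and> 0 \<le> sg * h $ k"
    have "r \<le> kp * r" using kp r(1) by simp
    then have hs: "h \<in> slab k sg (kp * r) r"
      using h norm_tang_le[of k h] component_le_norm_cart[of h k] sg unfolding slab_def by auto
    have "b \<le> a - d/4" unfolding b_def using mc1r by simp
    then have "b * (sg * h $ k) \<le> (a - d/4) * (sg * h $ k)" using h by (intro mult_right_mono) auto
    then show "U h \<le> (a - d/4) * (sg * h $ k) + c1 * (norm h)\<^sup>2" using le[OF hs] by linarith
  qed (use r c1 in auto)
qed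

text \<open>A slope within \<open>d/4\<close> of the infimum cannot be lowered by
  \<open>d/4\<close>, so \<open>slope_improves\<close>, read contrapositively, bounds the axis
  values from below. The lower bound \<open>lo\<close> will come from the slopes on the other side
  of the interface.\<close>

lemma sharp_slope:
  assumes low: "\<And>b. slope b \<Longrightarrow> lo \<le> b" and d: "d > 0"
  shows "\<exists>a r0. slope a \<and> r0 > 0 \<and> (\<forall>r. 0 < r \<and> r < r0 \<longrightarrow> (a - d) * r < U ((sg * r) *\<^sub>R unit_vec k))"
proof -
  obtain a where a: "slope a" "\<not> slope (a - d/4)"
  proof -
    have ne: "{b. slope b} \<noteq> {}" using slope_exists by auto
    have bd: "bdd_below {b. slope b}" using low by (auto intro!: bdd_belowI[of _ lo])
    have "Inf {b. slope b} < Inf {b. slope b} + d/4" using d by simp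
    then obtain a where a: "slope a" "a < Inf {b. slope b} + d/4" using cInf_lessD[OF ne] by blast
    then have "\<not> slope (a - d/4)" using cInf_lower[OF _ bd, of "a - d/4"] by fastforce
    then show thesis using that a by blast
  qed
  then obtain r0 where "r0 > 0" "\<And>r. 0 < r \<Longrightarrow> r < r0 \<Longrightarrow> \<not> U ((sg * r) *\<^sub>R unit_vec k) \<le> (a - d) * r"
    using slope_improves[OF a(1) d] by blast
  then show ?thesis using a(1) by (intro exI[of _ a] exI[of _ r0]) (auto simp: not_le)
qed

end

section \<open>Interface conditions\<close>

text \<open>Tests by kinks with a common linear part \<open>p\<close>: \<open>a\<close> and
  \<open>b\<close> are slopes measured away from the interface on the two sides, so the jump of the
  normal derivative is \<open>a + b\<close>.\<close>

definition jump_ge :: "'n \<Rightarrow> real \<Rightarrow> (real^'n::finite \<Rightarrow> real) \<Rightarrow> real^'n \<Rightarrow> bool" where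
  "jump_ge k c u x \<longleftrightarrow> (\<forall>p a b C. (\<exists>r>0. \<forall>h. norm h < r \<longrightarrow>
     u (x + h) \<le> u x + p \<bullet> h + a * max (h $ k) 0 + b * max (- (h $ k)) 0 + C * (norm h)\<^sup>2) \<longrightarrow> c \<le> a + b)"

text \<open>The dual operator turns minus a supersolution into a subsolution, so the one-sided slope
  theory serves both functions.\<close>

lemma ellip_dual:
  assumes "ellip_class lam Lam F"
  shows "ellip_class lam Lam (\<lambda>A. - F (- A))"
  unfolding ellip_class_def
proof (intro conjI allI impI)
  show "0 < lam" "lam \<le> Lam" "- F (- 0) = 0" using assms unfolding ellip_class_def by auto
  fix M N :: "real^'a^'a" assume MN: "sym_mat M \<and> sym_mat N \<and> psd_mat N"
  then have "sym_mat (- (M + N))" by (intro sym_mat_minus sym_mat_add) auto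
  then have "lam * mat_norm N \<le> F (- (M + N) + N) - F (- (M + N)) \<and> F (- (M + N) + N) - F (- (M + N)) \<le> Lam * mat_norm N"
    using assms MN unfolding ellip_class_def by blast
  then show "lam * mat_norm N \<le> - F (- (M + N)) - - F (- M)" "- F (- (M + N)) - - F (- M) \<le> Lam * mat_norm N"
    by auto
qed

text \<open>A slope from each side together form an admissible kink, whence
  \<open>c1 \<le> a + b\<close>. As slopes exist on both sides, this also bounds those of either
  side from below, as \<open>sharp_slope\<close> demands.\<close>

lemma sharp_slopes:
  fixes u :: "real^'n \<Rightarrow> real" and Fs :: "real \<Rightarrow> real^'n^'n \<Rightarrow> real"
  assumes F: "\<And>sg. sg = 1 \<or> sg = - 1 \<Longrightarrow> ellip_class lam Lam (Fs sg)" and rho: "rho > 0" and K0: "K0 \<ge> 0" and c: "c \<ge> 0"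
    and usc: "\<And>sg. sg = 1 \<or> sg = - 1 \<Longrightarrow> usc (slab k sg rho rho) (\<lambda>h. u (x + h))"
    and M: "\<And>sg h. sg = 1 \<or> sg = - 1 \<Longrightarrow> h \<in> slab k sg rho rho \<Longrightarrow> \<bar>u (x + h)\<bar> \<le> M"
    and sub: "\<And>sg h p A. sg = 1 \<or> sg = - 1 \<Longrightarrow> h \<in> slab k sg rho rho \<Longrightarrow> 0 < sg * h $ k \<Longrightarrow>
      quad_above u (x + h) p A \<Longrightarrow> - K0 \<le> Fs sg A"
    and p: "p $ k = 0"
    and flat: "\<And>sg h. sg = 1 \<or> sg = - 1 \<Longrightarrow> h \<in> slab k sg rho rho \<Longrightarrow> h $ k = 0 \<Longrightarrow> u (x + h) \<le> u x + p \<bullet> h + c * (norm h)\<^sup>2"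
    and tangential: "\<And>sg h. sg = 1 \<or> sg = - 1 \<Longrightarrow> h \<in> slab k sg rho rho \<Longrightarrow> \<exists>q. \<forall>z. z $ k = 0 \<longrightarrow>
      u (x + h) + q \<bullet> z - c * (norm z)\<^sup>2 \<le> u (x + h + z)"
    and jump: "jump_ge k c1 u x" and d: "d > 0"
  shows "\<exists>a b r0. r0 > 0 \<and> c1 \<le> a + b \<and> (\<forall>r. 0 < r \<and> r < r0 \<longrightarrow>
    (a - d) * r < u (x + r *\<^sub>R unit_vec k) - u x \<and> (b - d) * r < u (x - r *\<^sub>R unit_vec k) - u x)"
proof -
  define U where "U h = u (x + h) - u x - p \<bullet> h" for h
  have nrm: "norm h \<le> 2 * rho" if "sg = 1 \<or> sg = - 1" "h \<in> slab k sg rho rho" for sg h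
    using norm_le_tang[of h k] that unfolding slab_def by auto
  have loc: "half_slab_sub k sg rho K0 (2 * M + norm p * (2 * rho)) c lam Lam ((Lam + 1) / lam) (Fs sg) U" if sg: "sg = 1 \<or> sg = - 1" for sg
  proof (rule half_slab_sub.intro[OF F[OF sg] sg rho K0 c])
    have "usc (slab k sg rho rho) (\<lambda>h. u (x + h) + (- u x - p \<bullet> h))"
      by (intro usc_add usc[OF sg] usc_continuous continuous_intros)
    then show "usc (slab k sg rho rho) U" unfolding U_def by (simp add: algebra_simps)
  next
    fix h assume h: "h \<in> slab k sg rho rho"
    have "0 \<in> slab k sg rho rho" unfolding slab_def tang_def using rho by simp
    then have "\<bar>u x\<bar> \<le> M" using M[OF sg, of 0] by simp
    moreover have "\<bar>p \<bullet> h\<bar> \<le> norm p * (2 * rho)"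
      using Cauchy_Schwarz_ineq2[of p h] mult_left_mono[OF nrm[OF sg h] norm_ge_zero[of p]] by linarith
    ultimately show "\<bar>U h\<bar> \<le> 2 * M + norm p * (2 * rho)" using M[OF sg h] unfolding U_def by linarith
  next
    fix h q A assume h: "h \<in> slab k sg rho rho" "norm (tang k h) < rho" "0 < sg * h $ k" "sg * h $ k < rho" and q: "quad_above U h q A"
    then obtain r where r: "r > 0" "\<And>y. norm y < r \<Longrightarrow> U (h + y) \<le> U h + q \<bullet> y + 1/2 * (y \<bullet> (A *v y))"
      and A: "sym_mat A" unfolding quad_above_def by auto
    have "quad_above u (x + h) (q + p) A"
      unfolding quad_above_def
    proof (intro conjI A exI[of _ r] r(1) allI impI)
      fix y :: "real^'n" assume "norm y < r"
      from r(2)[OF this] show "u (x + h + y) \<le> u (x + h) + (q + p) \<bullet> y + 1/2 * (y \<bullet> (A *v y))"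
        unfolding U_def by (simp add: inner_add_left inner_add_right add.assoc)
    qed
    then show "- K0 \<le> Fs sg A" by (rule sub[OF sg h(1,3)])
  next
    fix h assume "h \<in> slab k sg rho rho" "h $ k = 0"
    from flat[OF sg this] show "U h \<le> c * (norm h)\<^sup>2" unfolding U_def by simp
  next
    fix h assume "h \<in> slab k sg rho rho"
    then obtain q where "\<And>z. z $ k = 0 \<Longrightarrow> u (x + h) + q \<bullet> z - c * (norm z)\<^sup>2 \<le> u (x + h + z)"
      using tangential[OF sg] by blast
    then show "\<exists>q. \<forall>z. z $ k = 0 \<and> h + z \<in> slab k sg rho rho \<longrightarrow> U h + q \<bullet> z - c * (norm z)\<^sup>2 \<le> U (h + z)"
      unfolding U_def by (intro exI[of _ "q - p"]) (simp add: inner_diff_left inner_add_right algebra_simps)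
  qed (rule refl)
  interpret P: half_slab_sub k 1 rho K0 "2 * M + norm p * (2 * rho)" c lam Lam "(Lam + 1) / lam" "Fs 1" U
    using loc[of 1] by simp
  interpret N: half_slab_sub k "- 1" rho K0 "2 * M + norm p * (2 * rho)" c lam Lam "(Lam + 1) / lam" "Fs (- 1)" U
    using loc[of "- 1"] by simp
  have sum: "c1 \<le> a + b" if pa: "P.slope a" and nb: "N.slope b" for a b
  proof -
    obtain C r where r: "r > 0" "C \<ge> 0" "\<And>h. norm h < r \<Longrightarrow> 0 \<le> h $ k \<Longrightarrow> U h \<le> a * (h $ k) + C * (norm h)\<^sup>2"
      using pa unfolding P.slope_def by auto
    obtain C' r' where r': "r' > 0" "C' \<ge> 0" "\<And>h. norm h < r' \<Longrightarrow> h $ k \<le> 0 \<Longrightarrow> U h \<le> b * (- (h $ k)) + C' * (norm h)\<^sup>2"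
      using nb unfolding N.slope_def by auto
    have "u (x + h) \<le> u x + p \<bullet> h + a * max (h $ k) 0 + b * max (- (h $ k)) 0 + (C + C') * (norm h)\<^sup>2"
      if h: "norm h < min r r'" for h
    proof (cases "h $ k \<ge> 0")
      case True
      have "C * (norm h)\<^sup>2 \<le> (C + C') * (norm h)\<^sup>2" using r'(2) by (intro mult_right_mono) auto
      then show ?thesis using r(3)[of h] h True unfolding U_def by (simp add: max_def)
    next
      case False
      have "C' * (norm h)\<^sup>2 \<le> (C + C') * (norm h)\<^sup>2" using r(2) by (intro mult_right_mono) auto
      then show ?thesis using r'(3)[of h] h False unfolding U_def by (simp add: max_def)
    qed
    then show ?thesis using jump r(1) r'(1) unfolding jump_ge_def by (metis min_less_iff_conj)
  qed
  obtain b0 where b0: "N.slope b0" using N.slope_exists by blast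
  have "\<exists>a r0. P.slope a \<and> r0 > 0 \<and> (\<forall>r. 0 < r \<and> r < r0 \<longrightarrow> (a - d) * r < U ((1 * r) *\<^sub>R unit_vec k))"
    by (rule P.sharp_slope[of "c1 - b0", OF _ d]) (use sum b0 in force)
  then obtain a r1 where a: "P.slope a" "r1 > 0" "\<And>r. 0 < r \<Longrightarrow> r < r1 \<Longrightarrow> (a - d) * r < U (r *\<^sub>R unit_vec k)" by auto
  have "\<exists>b r0. N.slope b \<and> r0 > 0 \<and> (\<forall>r. 0 < r \<and> r < r0 \<longrightarrow> (b - d) * r < U ((- 1 * r) *\<^sub>R unit_vec k))"
    by (rule N.sharp_slope[of "c1 - a", OF _ d]) (use sum a(1) in force)
  then obtain b r2 where b: "N.slope b" "r2 > 0" "\<And>r. 0 < r \<Longrightarrow> r < r2 \<Longrightarrow> (b - d) * r < U (- (r *\<^sub>R unit_vec k))" by auto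
  have pe: "p \<bullet> unit_vec k = 0" using p by (simp add: inner_unit_vec)
  show ?thesis
  proof (rule exI[of _ a], rule exI[of _ b], rule exI[of _ "min r1 r2"], intro conjI allI impI)
    fix r assume r: "0 < r \<and> r < min r1 r2"
    show "(a - d) * r < u (x + r *\<^sub>R unit_vec k) - u x" using a(3)[of r] r pe unfolding U_def by simp
    show "(b - d) * r < u (x - r *\<^sub>R unit_vec k) - u x" using b(3)[of r] r pe unfolding U_def by simp
  qed (use a(2) b(2) sum[OF a(1) b(1)] in auto)
qed

section \<open>From the viscosity definitions to quadratic and kinked tests\<close>

lemma C2_on_quad:
  assumes A: "sym_mat A" and d: "d > 0"
  shows "C2_on (ball x d) (\<lambda>y. quad a p A (y - x)) (\<lambda>y. p + A *v (y - x)) (\<lambda>y. A)"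
  unfolding C2_on_def
proof (intro conjI ballI open_ball continuous_on_const)
  fix y
  have l: "((\<lambda>y. A *v (y - x)) has_derivative (\<lambda>h. A *v h)) (at y)"
    by (rule bounded_linear.has_derivative[OF matrix_vector_mul_bounded_linear]) (auto intro!: derivative_eq_intros)
  show "((\<lambda>y. p + A *v (y - x)) has_derivative (\<lambda>h. A *v h)) (at y)"
    using has_derivative_add[OF has_derivative_const[of p] l] by simp
  have "((\<lambda>y. quad a p A (y - x)) has_derivative (\<lambda>h. p \<bullet> h + 1/2 * ((y - x) \<bullet> (A *v h) + h \<bullet> (A *v (y - x))))) (at y)"
    unfolding quad_def by (rule derivative_eq_intros l refl | simp)+
  moreover have "p \<bullet> h + 1/2 * ((y - x) \<bullet> (A *v h) + h \<bullet> (A *v (y - x))) = (p + A *v (y - x)) \<bullet> h" for h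
    using sym_mat_inner[OF A, of "y - x" h]
    by (simp add: inner_add_left inner_add_right inner_commute[of h])
  ultimately show "((\<lambda>y. quad a p A (y - x)) has_derivative (\<lambda>h. (p + A *v (y - x)) \<bullet> h)) (at y)" by simp
qed

lemma quad_above_touch:
  assumes "quad_above u x p A"
  shows "touch_above (\<lambda>y. quad (u x) p A (y - x)) u x"
proof -
  obtain r where r: "r > 0" "\<And>h. norm h < r \<Longrightarrow> u (x + h) \<le> u x + p \<bullet> h + 1/2 * (h \<bullet> (A *v h))"
    using assms unfolding quad_above_def by auto
  have "u y \<le> quad (u x) p A (y - x)" if "y \<in> ball x r" for y
    using r(2)[of "y - x"] that unfolding quad_def by (simp add: dist_norm norm_minus_commute)
  then show ?thesis unfolding touch_above_def using r(1) by (auto simp: quad_def)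
qed

lemma touch_below_minus: "touch_above \<phi> (\<lambda>x. - v x) x \<Longrightarrow> touch_below (\<lambda>y. - \<phi> y) v x"
  unfolding touch_above_def touch_below_def by (metis add.inverse_inverse neg_le_iff_le)

lemma C2_on_minus: "C2_on S \<phi> G H \<Longrightarrow> C2_on S (\<lambda>y. - \<phi> y) (\<lambda>y. - G y) (\<lambda>y. - H y)"
proof -
  assume a: "C2_on S \<phi> G H"
  have m: "(- A) *v h = - (A *v h)" for A :: "real^'a^'a" and h by (simp add: matrix_vector_mult_def vec_eq_iff sum_negf)
  show ?thesis
    unfolding C2_on_def m inner_minus_left
    using a unfolding C2_on_def by (blast intro: continuous_on_minus has_derivative_minus)
qed

text \<open>The one test function that suffices at the interface: two paraboloids of the same opening
  glued along the hyperplane.\<close>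

definition kink :: "'n \<Rightarrow> real^'n \<Rightarrow> real \<Rightarrow> real^'n \<Rightarrow> real \<Rightarrow> real \<Rightarrow> real \<Rightarrow> real^'n::finite \<Rightarrow> real" where
  "kink k x c p a b C y = c + p \<bullet> (y - x) + a * max ((y - x) $ k) 0 + b * max (- ((y - x) $ k)) 0 + C * (norm (y - x))\<^sup>2"

lemma kink_pieces:
  assumes "x $ k = 0"
  shows "continuous_on S (kink k x c p a b C)"
    "y \<in> closure (ball x d \<inter> {y. y $ k > 0}) \<Longrightarrow> kink k x c p a b C y = quad c (p + a *\<^sub>R unit_vec k) (smat (2*C)) (y - x)"
    "y \<in> closure (ball x d \<inter> {y. y $ k < 0}) \<Longrightarrow> kink k x c p a b C y = quad c (p - b *\<^sub>R unit_vec k) (smat (2*C)) (y - x)"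
proof -
  show "continuous_on S (kink k x c p a b C)" unfolding kink_def[abs_def] by (intro continuous_intros)
  have q: "quad c q (smat (2*C)) z = c + q \<bullet> z + C * (norm z)\<^sup>2" for q z :: "real^'a"
    unfolding quad_def smat_mult by (simp add: dot_square_norm)
  {
    assume y: "y \<in> closure (ball x d \<inter> {y. y $ k > 0})"
    have "closure (ball x d \<inter> {y. y $ k > 0}) \<subseteq> {y. 0 \<le> y $ k}"
      by (rule closure_minimal) (auto intro!: closed_Collect_le continuous_intros)
    then have "(y - x) $ k \<ge> 0" using y assms by auto
    then show "kink k x c p a b C y = quad c (p + a *\<^sub>R unit_vec k) (smat (2*C)) (y - x)"
      unfolding kink_def q by (simp add: inner_add_left inner_unit_vec max_def)
  next
    assume y: "y \<in> closure (ball x d \<inter> {y. y $ k < 0})"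
    have "closure (ball x d \<inter> {y. y $ k < 0}) \<subseteq> {y. y $ k \<le> 0}"
      by (rule closure_minimal) (auto intro!: closed_Collect_le continuous_intros)
    then have "(y - x) $ k \<le> 0" using y assms by auto
    then show "kink k x c p a b C y = quad c (p - b *\<^sub>R unit_vec k) (smat (2*C)) (y - x)"
      unfolding kink_def q by (simp add: inner_diff_left inner_unit_vec max_def algebra_simps)
  }
qed

lemma visc_sub_quad_above:
  assumes "visc_sub k Fp Fm fp fm g u" "quad_above u x p A"
  shows "x \<in> Bplus k \<Longrightarrow> fp x \<le> Fp A" "x \<in> Bminus k \<Longrightarrow> fm x \<le> Fm A"
proof -
  have A: "sym_mat A" using assms(2) unfolding quad_above_def by auto
  note t = C2_on_quad[OF A zero_less_one, of x "u x" p] quad_above_touch[OF assms(2)]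
  show "fp x \<le> Fp A" if "x \<in> Bplus k"
    by (rule assms(1)[unfolded visc_sub_def, THEN conjunct2, THEN conjunct1, rule_format])
      (rule conjI[OF that conjI[OF zero_less_one conjI[OF t]]])
  show "fm x \<le> Fm A" if "x \<in> Bminus k"
    by (rule assms(1)[unfolded visc_sub_def, THEN conjunct2, THEN conjunct2, THEN conjunct1, rule_format])
      (rule conjI[OF that conjI[OF zero_less_one conjI[OF t]]])
qed

lemma visc_super_quad_above:
  assumes "visc_super k Fp Fm fp fm g v" "quad_above (\<lambda>x. - v x) x p A"
  shows "x \<in> Bplus k \<Longrightarrow> Fp (- A) \<le> fp x" "x \<in> Bminus k \<Longrightarrow> Fm (- A) \<le> fm x"
proof -
  have A: "sym_mat A" using assms(2) unfolding quad_above_def by auto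
  note t = C2_on_minus[OF C2_on_quad[OF A zero_less_one, of x "- v x" p]] touch_below_minus[OF quad_above_touch[OF assms(2)]]
  show "Fp (- A) \<le> fp x" if "x \<in> Bplus k"
    by (rule assms(1)[unfolded visc_super_def, THEN conjunct2, THEN conjunct1, rule_format])
      (rule conjI[OF that conjI[OF zero_less_one conjI[OF t]]])
  show "Fm (- A) \<le> fm x" if "x \<in> Bminus k"
    by (rule assms(1)[unfolded visc_super_def, THEN conjunct2, THEN conjunct2, THEN conjunct1, rule_format])
      (rule conjI[OF that conjI[OF zero_less_one conjI[OF t]]])
qed

lemma kink_touch:
  assumes "r > 0" "\<And>h. norm h < r \<Longrightarrow> u (x + h) \<le> u x + p \<bullet> h + a * max (h $ k) 0 + b * max (- (h $ k)) 0 + C * (norm h)\<^sup>2"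
  shows "touch_above (kink k x (u x) p a b C) u x"
proof -
  have "u y \<le> kink k x (u x) p a b C y" if "y \<in> ball x r" for y
    using assms(2)[of "y - x"] that unfolding kink_def by (simp add: dist_norm norm_minus_commute)
  then show ?thesis unfolding touch_above_def using assms(1) by (auto simp: kink_def)
qed

lemma visc_sub_jump:
  assumes v: "visc_sub k Fp Fm fp fm g u" and x: "x \<in> Tflat k"
  shows "jump_ge k (g x) u x"
  unfolding jump_ge_def
proof (intro allI impI)
  fix p a b C
  assume "\<exists>r>0. \<forall>h. norm h < r \<longrightarrow> u (x + h) \<le> u x + p \<bullet> h + a * max (h $ k) 0 + b * max (- (h $ k)) 0 + C * (norm h)\<^sup>2"
  then have t: "touch_above (kink k x (u x) p a b C) u x" using kink_touch by blast
  have xk: "x $ k = 0" using x unfolding Tflat_def by auto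
  note pc = kink_pieces[OF xk, where p = p and a = a and b = b and C = C and c = "u x"]
  have 1: "C2_on (ball x 1) (\<lambda>y. quad (u x) (p + a *\<^sub>R unit_vec k) (smat (2*C)) (y - x)) (\<lambda>y. (p + a *\<^sub>R unit_vec k + smat (2*C) *v (y - x))) (\<lambda>y. smat (2*C))"
    "C2_on (ball x 1) (\<lambda>y. quad (u x) (p - b *\<^sub>R unit_vec k) (smat (2*C)) (y - x)) (\<lambda>y. (p - b *\<^sub>R unit_vec k + smat (2*C) *v (y - x))) (\<lambda>y. smat (2*C))"
    by (intro C2_on_quad sym_smat zero_less_one)+
  have 2: "\<forall>y\<in>closure (ball x 1 \<inter> {y. y $ k > 0}). kink k x (u x) p a b C y = quad (u x) (p + a *\<^sub>R unit_vec k) (smat (2*C)) (y - x)"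
    "\<forall>y\<in>closure (ball x 1 \<inter> {y. y $ k < 0}). kink k x (u x) p a b C y = quad (u x) (p - b *\<^sub>R unit_vec k) (smat (2*C)) (y - x)"
    using pc(2,3) by auto
  have 3: "continuous_on (ball x 1) (kink k x (u x) p a b C)"
    by (rule pc(1))
  note * = v[unfolded visc_sub_def, THEN conjunct2, THEN conjunct2, THEN conjunct2, rule_format,
      OF conjI[OF x conjI[OF zero_less_one conjI[OF 3 conjI[OF 1(1) conjI[OF 1(2) conjI[OF 2(1) conjI[OF 2(2) t]]]]]]]]
  then show "g x \<le> a + b" by simp
qed

lemma visc_super_jump:
  assumes v: "visc_super k Fp Fm fp fm g v" and x: "x \<in> Tflat k"
  shows "jump_ge k (- g x) (\<lambda>x. - v x) x"
  unfolding jump_ge_def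
proof (intro allI impI)
  fix p a b C
  assume "\<exists>r>0. \<forall>h. norm h < r \<longrightarrow> - v (x + h) \<le> - v x + p \<bullet> h + a * max (h $ k) 0 + b * max (- (h $ k)) 0 + C * (norm h)\<^sup>2"
  then obtain r where "r > 0" "\<And>h. norm h < r \<Longrightarrow> - v (x + h) \<le> - v x + p \<bullet> h + a * max (h $ k) 0 + b * max (- (h $ k)) 0 + C * (norm h)\<^sup>2"
    by blast
  from kink_touch[of r "\<lambda>x. - v x", OF this] have t: "touch_below (\<lambda>y. - kink k x (- v x) p a b C y) v x"
    by (rule touch_below_minus)
  have xk: "x $ k = 0" using x unfolding Tflat_def by auto
  note pc = kink_pieces[OF xk, where p = p and a = a and b = b and C = C and c = "- v x"]
  have 1: "C2_on (ball x 1) (\<lambda>y. - quad (- v x) (p + a *\<^sub>R unit_vec k) (smat (2*C)) (y - x)) (\<lambda>y. - (p + a *\<^sub>R unit_vec k + smat (2*C) *v (y - x))) (\<lambda>y. - smat (2*C))"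
    "C2_on (ball x 1) (\<lambda>y. - quad (- v x) (p - b *\<^sub>R unit_vec k) (smat (2*C)) (y - x)) (\<lambda>y. - (p - b *\<^sub>R unit_vec k + smat (2*C) *v (y - x))) (\<lambda>y. - smat (2*C))"
    by (intro C2_on_minus C2_on_quad sym_smat zero_less_one)+
  have 2: "\<forall>y\<in>closure (ball x 1 \<inter> {y. y $ k > 0}). - kink k x (- v x) p a b C y = - quad (- v x) (p + a *\<^sub>R unit_vec k) (smat (2*C)) (y - x)"
    "\<forall>y\<in>closure (ball x 1 \<inter> {y. y $ k < 0}). - kink k x (- v x) p a b C y = - quad (- v x) (p - b *\<^sub>R unit_vec k) (smat (2*C)) (y - x)"
    using pc(2,3) by auto
  have 3: "continuous_on (ball x 1) (\<lambda>y. - kink k x (- v x) p a b C y)"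
    using pc(1) by (rule continuous_on_minus)
  note * = v[unfolded visc_super_def, THEN conjunct2, THEN conjunct2, THEN conjunct2, rule_format,
      OF conjI[OF x conjI[OF zero_less_one conjI[OF 3 conjI[OF 1(1) conjI[OF 1(2) conjI[OF 2(1) conjI[OF 2(2) t]]]]]]]]
  then show "- g x \<le> a + b" by simp
qed


section \<open>Perturbation by a quadratic and a kink along the interface\<close>

definition perturb :: "'n \<Rightarrow> real \<Rightarrow> real^'n \<Rightarrow> real^'n^'n \<Rightarrow> real \<Rightarrow> (real^'n::finite \<Rightarrow> real) \<Rightarrow> real^'n \<Rightarrow> real" where
  "perturb k a b B z u x = u x + (quad a b B x + z * \<bar>x $ k\<bar>)"

lemma perturb_continuous: "continuous_on S (\<lambda>x. quad a b B x + z * \<bar>x $ k\<bar>)"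
  by (intro continuous_intros continuous_on_quad)

lemma usc_perturb: "usc S u \<Longrightarrow> usc S (perturb k a b B z u)"
  unfolding perturb_def[abs_def] by (rule usc_add[OF _ usc_continuous[OF perturb_continuous]])

lemma perturb_bounded:
  fixes u :: "real^'n \<Rightarrow> real"
  assumes "compact S" "\<And>x. x \<in> S \<Longrightarrow> \<bar>u x\<bar> \<le> M"
  shows "\<exists>M'. \<forall>x\<in>S. \<bar>perturb k a b B z u x\<bar> \<le> M'"
proof -
  have "bounded ((\<lambda>x. quad a b B x + z * \<bar>x $ k\<bar>) ` S)"
    by (intro compact_imp_bounded compact_continuous_image perturb_continuous assms(1))
  then obtain N where N: "\<And>x. x \<in> S \<Longrightarrow> \<bar>quad a b B x + z * \<bar>x $ k\<bar>\<bar> \<le> N"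
    unfolding bounded_iff by auto
  have "\<bar>perturb k a b B z u x\<bar> \<le> M + N" if "x \<in> S" for x
    using abs_triangle_ineq[of "u x" "quad a b B x + z * \<bar>x $ k\<bar>"] assms(2)[OF that] N[OF that]
    unfolding perturb_def by linarith
  then show ?thesis by blast
qed

text \<open>Off the interface the absolute value is linear near \<open>x\<close>, so only the
  Hessian of the quadratic is felt.\<close>

lemma perturb_quad_above:
  assumes q: "quad_above (perturb k a b B z u) x p A" and B: "sym_mat B" and x: "0 < sg * x $ k" and sg: "sg = 1 \<or> sg = - 1"
  shows "\<exists>p'. quad_above u x p' (A - B)"
proof -
  obtain r where r: "r > 0" "\<And>h. norm h < r \<Longrightarrow> perturb k a b B z u (x + h) \<le> perturb k a b B z u x + p \<bullet> h + 1/2 * (h \<bullet> (A *v h))"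
    and A: "sym_mat A" using q unfolding quad_above_def by auto
  have "sym_mat (A - B)" using sym_mat_add[OF A sym_mat_minus[OF B]] by simp
  moreover have "u (x + h) \<le> u x + (p - (b + B *v x) - (z * sg) *\<^sub>R unit_vec k) \<bullet> h + 1/2 * (h \<bullet> ((A - B) *v h))"
    if h: "norm h < min r (sg * x $ k)" for h
  proof -
    have hk: "\<bar>h $ k\<bar> < sg * x $ k" using component_le_norm_cart[of h k] h by simp
    have ab: "\<bar>(x + h) $ k\<bar> = sg * (x $ k + h $ k)" "\<bar>x $ k\<bar> = sg * x $ k" using hk x sg by auto
    have 1: "u (x + h) + (quad a b B (x + h) + z * \<bar>(x + h) $ k\<bar>) \<le> u x + (quad a b B x + z * \<bar>x $ k\<bar>) + p \<bullet> h + 1/2 * (h \<bullet> (A *v h))"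
      using r(2)[of h] h unfolding perturb_def by simp
    have 2: "h \<bullet> ((A - B) *v h) = h \<bullet> (A *v h) - h \<bullet> (B *v h)"
      by (simp add: matrix_vector_mult_diff_rdistrib inner_diff_right)
    have 3: "(p - (b + B *v x) - (z * sg) *\<^sub>R unit_vec k) \<bullet> h = p \<bullet> h - (b + B *v x) \<bullet> h - z * (sg * h $ k)"
      by (simp add: inner_diff_left inner_unit_vec)
    have 4: "z * (sg * (x $ k + h $ k)) = z * (sg * x $ k) + z * (sg * h $ k)" by (simp add: algebra_simps)
    show ?thesis using 1 unfolding quad_add[OF B] ab 2 3 4 right_diff_distrib by argo
  qed
  ultimately show ?thesis unfolding quad_above_def using r(1) x by (intro exI conjI exI[of _ "min r (sg * x $ k)"]) auto
qed

text \<open>The quadratic is smooth across the interface and only modifies \<open>p\<close> and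
  \<open>C\<close>, while the absolute value contributes the slope \<open>z\<close> on each
  side.\<close>

lemma perturb_jump:
  assumes j: "jump_ge k c u x" and B: "sym_mat B" and x: "x $ k = 0"
  shows "jump_ge k (c + 2 * z) (perturb k a b B z u) x"
  unfolding jump_ge_def
proof (intro allI impI)
  fix p a' b' C
  assume "\<exists>r>0. \<forall>h. norm h < r \<longrightarrow> perturb k a b B z u (x + h) \<le> perturb k a b B z u x + p \<bullet> h + a' * max (h $ k) 0 + b' * max (- (h $ k)) 0 + C * (norm h)\<^sup>2"
  then obtain r where r: "r > 0" "\<And>h. norm h < r \<Longrightarrow> perturb k a b B z u (x + h) \<le> perturb k a b B z u x + p \<bullet> h + a' * max (h $ k) 0 + b' * max (- (h $ k)) 0 + C * (norm h)\<^sup>2"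
    by blast
  let ?D = "onorm (\<lambda>h. B *v h)"
  have D: "- 1/2 * (h \<bullet> (B *v h)) \<le> ?D * (norm h)\<^sup>2" for h
  proof -
    have o: "norm (B *v h) \<le> ?D * norm h" by (rule onorm) (rule matrix_vector_mul_bounded_linear)
    have "\<bar>h \<bullet> (B *v h)\<bar> \<le> norm h * norm (B *v h)" by (rule Cauchy_Schwarz_ineq2)
    also have "\<dots> \<le> norm h * (?D * norm h)" using o by (rule mult_left_mono) simp
    also have "\<dots> = ?D * (norm h)\<^sup>2" by (simp add: power2_eq_square)
    finally show ?thesis by linarith
  qed
  have "u (x + h) \<le> u x + (p - (b + B *v x)) \<bullet> h + (a' - z) * max (h $ k) 0 + (b' - z) * max (- (h $ k)) 0 + (C + ?D) * (norm h)\<^sup>2"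
    if h: "norm h < r" for h
  proof -
    have 1: "u (x + h) + (quad a b B (x + h) + z * \<bar>(x + h) $ k\<bar>) \<le> u x + (quad a b B x + z * \<bar>x $ k\<bar>) + p \<bullet> h + a' * max (h $ k) 0 + b' * max (- (h $ k)) 0 + C * (norm h)\<^sup>2"
      using r(2)[OF h] unfolding perturb_def .
    have 2: "z * \<bar>(x + h) $ k\<bar> = z * max (h $ k) 0 + z * max (- (h $ k)) 0" "z * \<bar>x $ k\<bar> = 0" using x by (auto simp: max_def)
    have 3: "(a' - z) * max (h $ k) 0 = a' * max (h $ k) 0 - z * max (h $ k) 0"
      "(b' - z) * max (- (h $ k)) 0 = b' * max (- (h $ k)) 0 - z * max (- (h $ k)) 0"
      "(C + ?D) * (norm h)\<^sup>2 = C * (norm h)\<^sup>2 + ?D * (norm h)\<^sup>2"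
      "(p - (b + B *v x)) \<bullet> h = p \<bullet> h - (b + B *v x) \<bullet> h"
      by (simp_all add: algebra_simps)
    show ?thesis using 1 D[of h] unfolding quad_add[OF B] 2 3 by linarith
  qed
  then have "c \<le> (a' - z) + (b' - z)"
    using j r(1) unfolding jump_ge_def by blast
  then show "c + 2 * z \<le> a' + b'" by simp
qed

text \<open>As with paraboloids, \<open>increment\<close> translates the kink to
  \<open>arg x\<close>. For tangential \<open>Z\<close> this point has the same normal coordinate as
  \<open>x\<close>, so an interface condition is available there.\<close>

lemma jump_ge_sup_conv:
  assumes sc: "sup_convolution Z S e u" and x: "x \<in> sup_convolution.dom Z S"
    and j: "jump_ge k c u (sup_convolution.arg Z S e u x)" and i: "sup_convolution.arg Z S e u x \<in> interior S"
  shows "jump_ge k c (sup_conv Z S e u) x"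
proof -
  interpret sup_convolution Z S e u by fact
  show ?thesis
    unfolding jump_ge_def
  proof (intro allI impI)
    fix p a b C
    assume "\<exists>r>0. \<forall>h. norm h < r \<longrightarrow> conv (x + h) \<le> conv x + p \<bullet> h + a * max (h $ k) 0 + b * max (- (h $ k)) 0 + C * (norm h)\<^sup>2"
    then obtain r where r: "r > 0" "\<And>h. norm h < r \<Longrightarrow> conv (x + h) \<le> conv x + p \<bullet> h + a * max (h $ k) 0 + b * max (- (h $ k)) 0 + C * (norm h)\<^sup>2"
      by blast
    obtain r' where r': "r' > 0" "ball (arg x) r' \<subseteq> S" using i mem_interior by blast
    have "u (arg x + h) \<le> u (arg x) + p \<bullet> h + a * max (h $ k) 0 + b * max (- (h $ k)) 0 + C * (norm h)\<^sup>2"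
      if h: "norm h < min r r'" for h
    proof -
      have "arg x + h \<in> S" using r'(2) h by (auto simp: dist_norm)
      from increment[OF x this] r(2)[of h] h show ?thesis by simp
    qed
    then show "c \<le> a + b" using j r(1) r'(1) unfolding jump_ge_def by (metis min_less_iff_conj)
  qed
qed

text \<open>Because \<open>u + w\<close> is maximal at \<open>x\<close>, the increments of
  \<open>u\<close> and \<open>w\<close> along the axis add up to at most zero on each side. The
  sharp slopes approximate these increments from below, while the jump conditions force the four
  slopes to total at least \<open>c1 + c2\<close>.\<close>

lemma interface_no_max:
  fixes u w :: "real^'n \<Rightarrow> real" and Fs :: "real \<Rightarrow> real^'n^'n \<Rightarrow> real"
  assumes F: "\<And>sg. sg = 1 \<or> sg = - 1 \<Longrightarrow> ellip_class lam Lam (Fs sg)" and rho: "rho > 0" and K0: "K0 \<ge> 0" and c: "c \<ge> 0"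
    and uscu: "usc (cball x (2 * rho)) u" and uscw: "usc (cball x (2 * rho)) w"
    and Mu: "\<And>y. y \<in> cball x (2 * rho) \<Longrightarrow> \<bar>u y\<bar> \<le> M" and Mw: "\<And>y. y \<in> cball x (2 * rho) \<Longrightarrow> \<bar>w y\<bar> \<le> M"
    and sub: "\<And>sg y p A. sg = 1 \<or> sg = - 1 \<Longrightarrow> y \<in> cball x (2 * rho) \<Longrightarrow> 0 < sg * y $ k \<Longrightarrow> quad_above u y p A \<Longrightarrow> - K0 \<le> Fs sg A"
    and super: "\<And>sg y p A. sg = 1 \<or> sg = - 1 \<Longrightarrow> y \<in> cball x (2 * rho) \<Longrightarrow> 0 < sg * y $ k \<Longrightarrow> quad_above w y p A \<Longrightarrow> Fs sg (- A) \<le> K0"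
    and xk: "x $ k = 0"
    and tu: "\<And>y. y \<in> cball x (2 * rho) \<Longrightarrow> \<exists>q. q $ k = 0 \<and> (\<forall>z. z $ k = 0 \<longrightarrow> u y + q \<bullet> z - c * (norm z)\<^sup>2 \<le> u (y + z))"
    and tw: "\<And>y. y \<in> cball x (2 * rho) \<Longrightarrow> \<exists>q. q $ k = 0 \<and> (\<forall>z. z $ k = 0 \<longrightarrow> w y + q \<bullet> z - c * (norm z)\<^sup>2 \<le> w (y + z))"
    and ju: "jump_ge k c1 u x" and jw: "jump_ge k c2 w x" and c12: "c1 + c2 > 0"
    and max: "\<And>y. y \<in> cball x (2 * rho) \<Longrightarrow> u y + w y \<le> u x + w x"
  shows False
proof -
  have sl: "x + h \<in> cball x (2 * rho)" if "sg = 1 \<or> sg = - 1" "h \<in> slab k sg rho rho" for sg h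
    using norm_le_tang[of h k] that unfolding slab_def by (auto simp: dist_norm)
  have xx: "x \<in> cball x (2 * rho)" using rho by simp
  \<comment> \<open>Each of the four slopes may lose \<open>d\<close> along the axis, hence a
    quarter of the excess.\<close>
  define d where "d = (c1 + c2) / 4"
  have d: "d > 0" unfolding d_def using c12 by simp
  obtain qu where qu: "qu $ k = 0" "\<And>z. z $ k = 0 \<Longrightarrow> u x + qu \<bullet> z - c * (norm z)\<^sup>2 \<le> u (x + z)" using tu[OF xx] by blast
  obtain qw where qw: "qw $ k = 0" "\<And>z. z $ k = 0 \<Longrightarrow> w x + qw \<bullet> z - c * (norm z)\<^sup>2 \<le> w (x + z)" using tw[OF xx] by blast
  have us: "usc (slab k sg rho rho) (\<lambda>h. f (x + h))" if "usc (cball x (2 * rho)) f" "sg = 1 \<or> sg = - 1" for f sg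
    by (rule usc_compose[OF that(1)]) (use sl[OF that(2)] in \<open>auto intro!: continuous_intros\<close>)
  have sh: "0 < sg * (x + h) $ k" if "0 < sg * h $ k" for sg h using that xk by simp
  have Fd: "ellip_class lam Lam ((\<lambda>sg A. - Fs sg (- A)) sg)" if "sg = 1 \<or> sg = - 1" for sg
    using ellip_dual[OF F[OF that]] .
  have "\<exists>a b r0. r0 > 0 \<and> c1 \<le> a + b \<and> (\<forall>r. 0 < r \<and> r < r0 \<longrightarrow>
    (a - d) * r < u (x + r *\<^sub>R unit_vec k) - u x \<and> (b - d) * r < u (x - r *\<^sub>R unit_vec k) - u x)"
  \<comment> \<open>At the maximum, the lower tangential paraboloid of \<open>w\<close> with slope
    \<open>qw\<close> becomes an upper one for \<open>u\<close> with slope \<open>- qw\<close>; this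
    provides the bound on the flat part.\<close>
  proof (rule sharp_slopes[where p = "- qw" and M = M and k = k, OF F rho K0 c us[OF uscu] _ _ _ _ _ ju d])
    show "u (x + h) \<le> u x + - qw \<bullet> h + c * (norm h)\<^sup>2" if "sg = 1 \<or> sg = - 1" "h \<in> slab k sg rho rho" "h $ k = 0" for sg h
      using qw(2)[OF that(3)] max[OF sl[OF that(1,2)]] by simp
    show "\<exists>q. \<forall>z. z $ k = 0 \<longrightarrow> u (x + h) + q \<bullet> z - c * (norm z)\<^sup>2 \<le> u (x + h + z)" if "sg = 1 \<or> sg = - 1" "h \<in> slab k sg rho rho" for sg h
      using tu[OF sl[OF that]] by blast
    show "\<bar>u (x + h)\<bar> \<le> M" if "sg = 1 \<or> sg = - 1" "h \<in> slab k sg rho rho" for sg h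
      by (rule Mu[OF sl[OF that]])
    show "- K0 \<le> Fs sg A" if "sg = 1 \<or> sg = - 1" "h \<in> slab k sg rho rho" "0 < sg * h $ k" "quad_above u (x + h) p A" for sg h p A
      using sub[OF that(1) sl[OF that(1,2)] sh[OF that(3)] that(4)] by simp
    show "(- qw) $ k = 0" using qw(1) by simp
  qed
  then obtain a b r1 where ab: "r1 > 0" "c1 \<le> a + b" "\<And>r. 0 < r \<Longrightarrow> r < r1 \<Longrightarrow>
    (a - d) * r < u (x + r *\<^sub>R unit_vec k) - u x \<and> (b - d) * r < u (x - r *\<^sub>R unit_vec k) - u x" by blast
  have "\<exists>a b r0. r0 > 0 \<and> c2 \<le> a + b \<and> (\<forall>r. 0 < r \<and> r < r0 \<longrightarrow>
    (a - d) * r < w (x + r *\<^sub>R unit_vec k) - w x \<and> (b - d) * r < w (x - r *\<^sub>R unit_vec k) - w x)"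
  proof (rule sharp_slopes[where p = "- qu" and M = M and k = k and Fs = "\<lambda>sg A. - Fs sg (- A)", OF Fd rho K0 c us[OF uscw] _ _ _ _ _ jw d])
    show "w (x + h) \<le> w x + - qu \<bullet> h + c * (norm h)\<^sup>2" if "sg = 1 \<or> sg = - 1" "h \<in> slab k sg rho rho" "h $ k = 0" for sg h
      using qu(2)[OF that(3)] max[OF sl[OF that(1,2)]] by simp
    show "\<exists>q. \<forall>z. z $ k = 0 \<longrightarrow> w (x + h) + q \<bullet> z - c * (norm z)\<^sup>2 \<le> w (x + h + z)" if "sg = 1 \<or> sg = - 1" "h \<in> slab k sg rho rho" for sg h
      using tw[OF sl[OF that]] by blast
    show "\<bar>w (x + h)\<bar> \<le> M" if "sg = 1 \<or> sg = - 1" "h \<in> slab k sg rho rho" for sg h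
      by (rule Mw[OF sl[OF that]])
    show "- K0 \<le> - Fs sg (- A)" if "sg = 1 \<or> sg = - 1" "h \<in> slab k sg rho rho" "0 < sg * h $ k" "quad_above w (x + h) p A" for sg h p A
      using super[OF that(1) sl[OF that(1,2)] sh[OF that(3)] that(4)] by simp
    show "(- qu) $ k = 0" using qu(1) by simp
  qed
  then obtain a' b' r2 where ab': "r2 > 0" "c2 \<le> a' + b'" "\<And>r. 0 < r \<Longrightarrow> r < r2 \<Longrightarrow>
    (a' - d) * r < w (x + r *\<^sub>R unit_vec k) - w x \<and> (b' - d) * r < w (x - r *\<^sub>R unit_vec k) - w x" by blast
  define r where "r = min (min r1 r2) rho / 2"
  have r: "0 < r" "r < r1" "r < r2" "r \<le> 2 * rho" unfolding r_def using ab(1) ab'(1) rho by auto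
  have "x + r *\<^sub>R unit_vec k \<in> cball x (2 * rho)" "x - r *\<^sub>R unit_vec k \<in> cball x (2 * rho)"
    using r(1,4) by (auto simp: dist_norm)
  note m = max[OF this(1)] max[OF this(2)]
  have "(a - d) * r + (a' - d) * r < 0" "(b - d) * r + (b' - d) * r < 0"
    using ab(3)[OF r(1,2)] ab'(3)[OF r(1,3)] m by linarith+
  then have "(a + a' - 2 * d) * r < 0" "(b + b' - 2 * d) * r < 0" by (simp_all add: algebra_simps)
  then have "a + a' < 2 * d" "b + b' < 2 * d" using r(1) by (simp_all add: mult_less_0_iff)
  then show False using ab(2) ab'(2) unfolding d_def by simp
qed

section \<open>Comparison\<close>

lemma subspace_hyperplane: "subspace {z :: real^'n. z $ k = 0}"
  by (auto simp: subspace_def)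

text \<open>The bounds \<open>K + 1\<close> and \<open>K\<close> replace the right-hand sides. If
  the maximum of the convolved sum leaves the interface, their gap contradicts
  \<open>interior_no_max\<close>; otherwise \<open>interface_no_max\<close> applies, as the
  maximizers of both convolutions keep the normal coordinate.\<close>

lemma no_interface_max:
  fixes u w :: "real^'n \<Rightarrow> real" and Fs :: "real \<Rightarrow> real^'n^'n \<Rightarrow> real"
  assumes F: "\<And>sg. sg = 1 \<or> sg = - 1 \<Longrightarrow> ellip_class lam Lam (Fs sg)" and rho: "rho > 0" and K: "K \<ge> 0" and xk: "xb $ k = 0"
    and u: "usc (cball xb rho) u" and w: "usc (cball xb rho) w"
    and Mu: "\<And>y. y \<in> cball xb rho \<Longrightarrow> \<bar>u y\<bar> \<le> M" and Mw: "\<And>y. y \<in> cball xb rho \<Longrightarrow> \<bar>w y\<bar> \<le> M"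
    and sub: "\<And>sg y p A. sg = 1 \<or> sg = - 1 \<Longrightarrow> y \<in> ball xb rho \<Longrightarrow> 0 < sg * y $ k \<Longrightarrow> quad_above u y p A \<Longrightarrow> K + 1 \<le> Fs sg A"
    and super: "\<And>sg y p A. sg = 1 \<or> sg = - 1 \<Longrightarrow> y \<in> ball xb rho \<Longrightarrow> 0 < sg * y $ k \<Longrightarrow> quad_above w y p A \<Longrightarrow> Fs sg (- A) \<le> K"
    and ju: "\<And>y. y \<in> ball xb rho \<Longrightarrow> y $ k = 0 \<Longrightarrow> jump_ge k c1 u y"
    and jw: "\<And>y. y \<in> ball xb rho \<Longrightarrow> y $ k = 0 \<Longrightarrow> jump_ge k c2 w y" and c12: "c1 + c2 > 0"
    and strict: "\<And>y. y \<in> cball xb rho \<Longrightarrow> y \<noteq> xb \<Longrightarrow> u y + w y < u xb + w xb"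
  shows False
proof -
  let ?S = "cball xb rho" and ?Z = "{z :: real^'n. z $ k = 0}"
  have xbS: "xb \<in> ?S" using rho by simp
  have M0: "M \<ge> 0" using Mu[OF xbS] by linarith
  have "\<exists>e0>0. \<forall>e p y z. 0 < e \<and> e \<le> e0 \<and> norm p \<le> e \<and> y \<in> ?S \<and> z \<in> ?S \<and>
    u xb + w xb - p \<bullet> xb \<le> u y + w z - (norm (y - z))\<^sup>2 / (4*e) - p \<bullet> ((1/2) *\<^sub>R (y + z)) \<longrightarrow>
    dist y xb < rho/4 \<and> dist z xb < rho/4"
    by (rule doubling_near[OF compact_cball u w xbS Mu Mw strict]) (use rho in auto)
  then obtain e0 where e0: "e0 > 0" and near: "\<And>e p y z. \<lbrakk>0 < e; e \<le> e0; norm p \<le> e; y \<in> ?S; z \<in> ?S;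
    u xb + w xb - p \<bullet> xb \<le> u y + w z - (norm (y - z))\<^sup>2 / (4*e) - p \<bullet> ((1/2) *\<^sub>R (y + z))\<rbrakk> \<Longrightarrow>
    dist y xb < rho/4 \<and> dist z xb < rho/4"
    by blast
  define e where "e = min e0 (rho\<^sup>2 / (64 * (M + 1)))"
  have e: "0 < e" "e \<le> e0" "e \<le> rho\<^sup>2 / (64 * (M + 1))"
    unfolding e_def using e0 rho M0 by (simp_all add: min_def)
  have eM: "4 * e * M \<le> (rho/4)\<^sup>2"
  proof -
    have "e * (64 * (M + 1)) \<le> rho\<^sup>2" using e(3) M0 by (simp add: pos_le_divide_eq)
    then have "64 * (e * M) + 64 * e \<le> rho\<^sup>2" by (simp add: algebra_simps)
    moreover have "(rho/4)\<^sup>2 = rho\<^sup>2 / 16" by (simp add: power_divide)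
    ultimately show ?thesis using e(1) by simp
  qed
  interpret U: sup_convolution ?Z ?S e u
    by (rule sup_convolution.intro[OF compact_cball subspace_hyperplane e(1) u])
  interpret W: sup_convolution ?Z ?S e w
    by (rule sup_convolution.intro[OF compact_cball subspace_hyperplane e(1) w])
  have Sne: "?S \<noteq> {}" using rho by simp
  obtain y z where yz: "y \<in> ?S" "z \<in> ?S" "y - z \<in> ?Z"
    and mx: "\<And>y' z'. y' \<in> ?S \<Longrightarrow> z' \<in> ?S \<Longrightarrow> y' - z' \<in> ?Z \<Longrightarrow> u y' + w z' - (norm (y' - z'))\<^sup>2 / (4*e) - 0 \<bullet> ((1/2) *\<^sub>R (y' + z'))
      \<le> u y + w z - (norm (y - z))\<^sup>2 / (4*e) - 0 \<bullet> ((1/2) *\<^sub>R (y + z))"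
    using doubling_attained[OF compact_cball Sne subspace_hyperplane u w e(1), where p = 0] by blast
  have "dist y xb < rho/4 \<and> dist z xb < rho/4"
  proof (rule near[OF e(1,2) _ yz(1,2)])
    show "norm (0 :: real^'n) \<le> e" using e(1) by simp
    show "u xb + w xb - 0 \<bullet> xb \<le> u y + w z - (norm (y - z))\<^sup>2 / (4*e) - 0 \<bullet> ((1/2) *\<^sub>R (y + z))"
      using mx[OF xbS xbS] by simp
  qed
  then have n: "norm (y - xb) < rho/4" "norm (z - xb) < rho/4" by (auto simp: dist_norm)
  \<comment> \<open>The slope is \<open>0\<close>; the vanishing term keeps the form expected by
    \<open>sup_conv_sum_max\<close>.\<close>
  define x where "x = (1/2) *\<^sub>R (y + z) - (e/2) *\<^sub>R 0"
  have xd: "dist x xb < rho/4"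
  proof -
    have "x - xb = (1/2) *\<^sub>R ((y - xb) + (z - xb))" unfolding x_def by (simp add: vec_eq_iff field_simps)
    then show ?thesis using n norm_triangle_ineq[of "y - xb" "z - xb"] by (simp add: dist_norm)
  qed
  have Sd: "?S \<subseteq> U.dom" by (rule U.S_subset_dom)
  have domW: "W.dom = U.dom" unfolding U.dom_def W.dom_def ..
  have xmax: "U.conv x' + W.conv x' \<le> U.conv x + W.conv x" if "x' \<in> U.dom" for x'
    using sup_conv_sum_max[OF U.sup_convolution_axioms W.sup_convolution_axioms subspace_0[OF subspace_hyperplane] yz mx x_def that]
    by simp
  have inner: "x' \<in> ?S" "x' \<in> U.dom" "U.arg x' \<in> ball xb rho" "W.arg x' \<in> ball xb rho" "U.arg x' $ k = x' $ k" "W.arg x' $ k = x' $ k"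
    if x': "dist x' xb \<le> rho/2" for x'
  proof -
    show S: "x' \<in> ?S" using x' rho by (simp add: dist_commute)
    then show d: "x' \<in> U.dom" using Sd by auto
    have arg: "z \<in> ball xb rho" if "(norm (x' - z))\<^sup>2 \<le> 4 * e * M" for z
    proof -
      have "norm (x' - z) \<le> rho/4"
        by (rule power2_le_imp_le[OF order_trans[OF that eM]]) (use rho in simp)
      then show ?thesis using dist_triangle[of z xb x'] x' rho by (simp add: dist_norm norm_minus_commute)
    qed
    show "U.arg x' \<in> ball xb rho" by (rule arg[OF U.arg_near[OF S Mu]])
    show "W.arg x' \<in> ball xb rho" by (rule arg[OF W.arg_near[OF S Mw]])
    show "U.arg x' $ k = x' $ k" "W.arg x' $ k = x' $ k" using U.arg(2)[OF d] W.arg(2)[of x'] d domW by auto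
  qed
  have bU: "\<bar>U.conv x'\<bar> \<le> M" and bW: "\<bar>W.conv x'\<bar> \<le> M" if "x' \<in> ?S" for x'
  proof -
    have d: "x' \<in> U.dom" using that Sd by auto
    have "U.conv x' \<le> M" by (rule U.conv_le[OF d]) (use Mu in \<open>force simp: abs_le_iff\<close>)
    then show "\<bar>U.conv x'\<bar> \<le> M" using U.ge[OF that] Mu[OF that] by linarith
    have "W.conv x' \<le> M" by (rule W.conv_le[of x']) (use d domW Mw in \<open>force simp: abs_le_iff\<close>)+
    then show "\<bar>W.conv x'\<bar> \<le> M" using W.ge[OF that] Mw[OF that] by linarith
  qed
  have uscU: "usc ?S U.conv" and uscW: "usc ?S W.conv"
    using usc_subset[OF U.usc_conv Sd] usc_subset[OF W.usc_conv] Sd domW by auto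
  have subU: "K + 1 \<le> Fs sg A"
    if "sg = 1 \<or> sg = - 1" "dist x' xb \<le> rho/2" "0 < sg * x' $ k" "quad_above U.conv x' p A" for sg x' p A
  proof -
    have "quad_above u (U.arg x') p A"
      by (rule quad_above_sup_conv[OF U.sup_convolution_axioms inner(2)[OF that(2)] that(4)])
        (use inner(3)[OF that(2)] in auto)
    then show ?thesis using sub[OF that(1) inner(3)[OF that(2)]] that(3) inner(5)[OF that(2)] by simp
  qed
  have superW: "Fs sg (- A) \<le> K"
    if "sg = 1 \<or> sg = - 1" "dist x' xb \<le> rho/2" "0 < sg * x' $ k" "quad_above W.conv x' p A" for sg x' p A
  proof -
    have "quad_above w (W.arg x') p A"
      by (rule quad_above_sup_conv[OF W.sup_convolution_axioms _ that(4)])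
        (use inner(2,4)[OF that(2)] domW in auto)
    then show ?thesis using super[OF that(1) inner(4)[OF that(2)]] that(3) inner(6)[OF that(2)] by simp
  qed
  have loc: "dist x' xb \<le> rho/2" if "dist x x' \<le> rho/4" for x'
    using dist_triangle[of x' xb x] that xd by (simp add: dist_commute)
  show False
  proof (cases "x $ k = 0")
    case False
    define sg :: real where "sg = (if x $ k > 0 then 1 else - 1)"
    have sg: "sg = 1 \<or> sg = - 1" unfolding sg_def by auto
    have sx: "sg * x $ k = \<bar>x $ k\<bar>" unfolding sg_def by auto
    define r where "r = min (rho/4) (\<bar>x $ k\<bar> / 2)"
    have r: "r > 0" "r \<le> rho/4" "r \<le> \<bar>x $ k\<bar> / 2" unfolding r_def using rho False by auto
    have pt: "dist x' xb \<le> rho/2 \<and> 0 < sg * x' $ k" if "x' \<in> cball x r" for x'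
    proof
      show "dist x' xb \<le> rho/2" using that r by (intro loc) auto
      have "\<bar>(x' - x) $ k\<bar> \<le> \<bar>x $ k\<bar> / 2"
        using component_le_norm_cart[of "x' - x" k] that r(3) by (simp add: dist_norm norm_minus_commute)
      then show "0 < sg * x' $ k" using sx False sg by (auto simp: abs_if split: if_splits)
    qed
    have cS: "cball x r \<subseteq> ?S" using pt inner(1) by blast
    show False
    proof (rule interior_no_max[OF F[OF sg] r(1) usc_subset[OF uscU cS] usc_subset[OF uscW cS]])
      show "\<bar>U.conv y\<bar> \<le> M" "\<bar>W.conv y\<bar> \<le> M" if "y \<in> cball x r" for y using bU bW cS that by auto
      show "K + 1 \<le> Fs sg A" if "y \<in> ball x r" "quad_above U.conv y p A" for y p A
        using subU[OF sg _ _ that(2)] pt[of y] that(1) by auto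
      show "Fs sg (- A) \<le> K" if "y \<in> ball x r" "quad_above W.conv y p A" for y p A
        using superW[OF sg _ _ that(2)] pt[of y] that(1) by auto
      show "U.conv y + W.conv y \<le> U.conv x + W.conv x" if "y \<in> cball x r" for y
        using xmax that cS Sd by blast
    qed simp
  next
    case True
    have xb2: "dist x xb \<le> rho/2" using xd rho by simp
    have r8: "rho/8 > 0" "2 * (rho/8) = rho/4" using rho by auto
    have cS: "cball x (2 * (rho/8)) \<subseteq> ?S" unfolding r8(2) using loc inner(1) by (meson mem_cball subsetI)
    have dl: "dist y xb \<le> rho/2" if "y \<in> cball x (2 * (rho/8))" for y
      using loc that unfolding r8(2) by simp
    have para: "\<exists>q. q $ k = 0 \<and> (\<forall>z. z $ k = 0 \<longrightarrow> U.conv y + q \<bullet> z - 1/(2*e) * (norm z)\<^sup>2 \<le> U.conv (y + z))"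
      "\<exists>q. q $ k = 0 \<and> (\<forall>z. z $ k = 0 \<longrightarrow> W.conv y + q \<bullet> z - 1/(2*e) * (norm z)\<^sup>2 \<le> W.conv (y + z))"
      if "y \<in> cball x (2 * (rho/8))" for y
    proof -
      have d: "y \<in> U.dom" "y \<in> W.dom" using inner(2)[OF dl[OF that]] domW by auto
      show "\<exists>q. q $ k = 0 \<and> (\<forall>z. z $ k = 0 \<longrightarrow> U.conv y + q \<bullet> z - 1/(2*e) * (norm z)\<^sup>2 \<le> U.conv (y + z))"
        using U.lower_paraboloid[OF d(1)] inner(5)[OF dl[OF that]]
        by (intro exI[of _ "(1/e) *\<^sub>R (U.arg y - y)"]) auto
      show "\<exists>q. q $ k = 0 \<and> (\<forall>z. z $ k = 0 \<longrightarrow> W.conv y + q \<bullet> z - 1/(2*e) * (norm z)\<^sup>2 \<le> W.conv (y + z))"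
        using W.lower_paraboloid[OF d(2)] inner(6)[OF dl[OF that]]
        by (intro exI[of _ "(1/e) *\<^sub>R (W.arg y - y)"]) auto
    qed
    have jU: "jump_ge k c1 U.conv x"
      by (rule jump_ge_sup_conv[OF U.sup_convolution_axioms inner(2)[OF xb2] ju])
        (use inner(3,5)[OF xb2] True in auto)
    have jW: "jump_ge k c2 W.conv x"
      by (rule jump_ge_sup_conv[OF W.sup_convolution_axioms _ jw])
        (use inner(2,4,6)[OF xb2] True domW in auto)
    show False
    proof (rule interface_no_max[OF F r8(1) _ _ usc_subset[OF uscU cS] usc_subset[OF uscW cS] _ _ _ _ True para jU jW c12])
      show "0 \<le> K + 1" "0 \<le> 1/(2*e)" using K e(1) by auto
      show "\<bar>U.conv y\<bar> \<le> M" "\<bar>W.conv y\<bar> \<le> M" if "y \<in> cball x (2 * (rho/8))" for y using bU bW cS that by auto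
      show "- (K + 1) \<le> Fs sg A" if "sg = 1 \<or> sg = - 1" "y \<in> cball x (2 * (rho/8))" "0 < sg * y $ k" "quad_above U.conv y p A" for sg y p A
        using subU[OF that(1) dl[OF that(2)] that(3,4)] K by linarith
      show "Fs sg (- A) \<le> K + 1" if "sg = 1 \<or> sg = - 1" "y \<in> cball x (2 * (rho/8))" "0 < sg * y $ k" "quad_above W.conv y p A" for sg y p A
        using superW[OF that(1) dl[OF that(2)] that(3,4)] by linarith
      show "U.conv y + W.conv y \<le> U.conv x + W.conv x" if "y \<in> cball x (2 * (rho/8))" for y
        using xmax that cS Sd by blast
    qed
  qed
qed

lemma comparison_halves:
  fixes u w g :: "real^'n \<Rightarrow> real" and Fs :: "real \<Rightarrow> real^'n^'n \<Rightarrow> real" and fs :: "real \<Rightarrow> real^'n \<Rightarrow> real"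
  assumes F: "\<And>sg. sg = 1 \<or> sg = - 1 \<Longrightarrow> ellip_class lam Lam (Fs sg)"
    and fc: "\<And>sg. sg = 1 \<or> sg = - 1 \<Longrightarrow> continuous_on {x \<in> ball 0 1. 0 < sg * x $ k} (fs sg)"
    and fK: "\<And>sg x. sg = 1 \<or> sg = - 1 \<Longrightarrow> x \<in> ball 0 1 \<Longrightarrow> 0 < sg * x $ k \<Longrightarrow> \<bar>fs sg x\<bar> \<le> K"
    and gc: "continuous_on (Tflat k) g"
    and u: "usc (cball 0 1) u" and w: "usc (cball 0 1) w"
    and Mu: "\<And>y. y \<in> cball 0 1 \<Longrightarrow> \<bar>u y\<bar> \<le> M" and Mw: "\<And>y. y \<in> cball 0 1 \<Longrightarrow> \<bar>w y\<bar> \<le> M"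
    and sub: "\<And>sg x p A. sg = 1 \<or> sg = - 1 \<Longrightarrow> x \<in> ball 0 1 \<Longrightarrow> 0 < sg * x $ k \<Longrightarrow> quad_above u x p A \<Longrightarrow> fs sg x \<le> Fs sg A"
    and super: "\<And>sg x p A. sg = 1 \<or> sg = - 1 \<Longrightarrow> x \<in> ball 0 1 \<Longrightarrow> 0 < sg * x $ k \<Longrightarrow> quad_above w x p A \<Longrightarrow> Fs sg (- A) \<le> fs sg x"
    and ju: "\<And>x. x \<in> Tflat k \<Longrightarrow> jump_ge k (g x) u x" and jw: "\<And>x. x \<in> Tflat k \<Longrightarrow> jump_ge k (- g x) w x"
    and bdry: "\<And>x. x \<in> sphere 0 1 \<Longrightarrow> u x + w x \<le> 0"
    and z: "z \<in> ball 0 1"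
  shows "u z + w z \<le> 0"
proof (rule ccontr)
  assume neg: "\<not> u z + w z \<le> 0"
  have lam: "lam > 0" "Lam \<ge> lam" using F[of 1] unfolding ellip_class_def by auto
  \<comment> \<open>On the unit sphere the two perturbations in \<open>u1\<close> add at most
    \<open>2 * eta\<close>, so a maximum of at least \<open>4 * eta\<close> must be attained
    inside.\<close>
  define eta where "eta = (u z + w z) / 4"
  have eta: "eta > 0" unfolding eta_def using neg by simp
  define u1 where "u1 = perturb k 0 0 (smat (2 * eta)) eta u"
  have u1: "u1 x = u x + eta * (norm x)\<^sup>2 + eta * \<bar>x $ k\<bar>" for x
    unfolding u1_def perturb_def quad_def by (simp add: smat_mult dot_square_norm)
  have usc1: "usc (cball 0 1) u1" unfolding u1_def by (rule usc_perturb[OF u])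
  have "usc (cball 0 1) (\<lambda>x. u1 x + w x)" by (rule usc_add[OF usc1 w])
  then obtain xb where xb: "xb \<in> cball 0 1" "\<And>x. x \<in> cball 0 1 \<Longrightarrow> u1 x + w x \<le> u1 xb + w xb"
    using usc_attains_sup[of "cball 0 1" "\<lambda>x. u1 x + w x"] by auto
  have "u z + w z \<le> u1 z + w z" unfolding u1 using eta by simp
  also have "\<dots> \<le> u1 xb + w xb" using z by (intro xb(2)) auto
  finally have big: "4 * eta \<le> u1 xb + w xb" unfolding eta_def by simp
  have xbB: "xb \<in> ball 0 1"
  proof (rule ccontr)
    assume "xb \<notin> ball 0 1"
    then have n: "norm xb = 1" using xb(1) by simp
    then have "u xb + w xb \<le> 0" using bdry by simp
    moreover have "eta * \<bar>xb $ k\<bar> \<le> eta * 1"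
      using component_le_norm_cart[of xb k] n eta by (intro mult_left_mono) auto
    ultimately show False using big eta unfolding u1 n power_one by linarith
  qed
  have "0 < 1 - norm xb" using xbB by simp
  have ballsub: "cball xb r \<subseteq> ball 0 1" if "r < 1 - norm xb" for r
  proof
    fix y assume "y \<in> cball xb r"
    then show "y \<in> ball 0 1" using norm_triangle_ineq2[of y xb] that by (simp add: dist_norm norm_minus_commute)
  qed
  show False
  proof (cases "xb $ k = 0")
    case False
    define sg :: real where "sg = (if xb $ k > 0 then 1 else - 1)"
    have sg: "sg = 1 \<or> sg = - 1" and sx: "0 < sg * xb $ k" unfolding sg_def using False by auto
    let ?D = "{x \<in> ball 0 1. 0 < sg * x $ k}"
    \<comment> \<open>The Hessian \<open>2 * eta\<close> gains
      \<open>lam * (2 * eta) = 4 * ep\<close>; the oscillation of the right-hand side costs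
      \<open>ep\<close> for each function, which leaves a gap of \<open>2 * ep\<close>.\<close>
    define ep where "ep = lam * eta / 2"
    have ep: "ep > 0" unfolding ep_def using lam eta by simp
    have "xb \<in> ?D" using xbB sx by simp
    then obtain d where d: "d > 0" "\<And>y. y \<in> ?D \<Longrightarrow> dist y xb < d \<Longrightarrow> dist (fs sg y) (fs sg xb) < ep"
      using fc[OF sg] ep unfolding continuous_on_iff by meson
    define rho where "rho = min (min (d/2) ((1 - norm xb)/2)) (\<bar>xb $ k\<bar> / 2)"
    have rho: "rho > 0" "rho < d" "rho < 1 - norm xb" "rho \<le> \<bar>xb $ k\<bar> / 2"
      unfolding rho_def using d(1) \<open>0 < 1 - norm xb\<close> False by (auto simp: min_less_iff_disj)
    have D: "y \<in> ?D" if "y \<in> cball xb rho" for y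
    proof -
      have "\<bar>(y - xb) $ k\<bar> \<le> \<bar>xb $ k\<bar> / 2"
        using component_le_norm_cart[of "y - xb" k] that rho(4) by (simp add: dist_norm norm_minus_commute)
      then have "0 < sg * y $ k" using sx sg by (auto simp: abs_if split: if_splits)
      then show ?thesis using ballsub[OF rho(3)] that by auto
    qed
    have fe: "\<bar>fs sg y - fs sg xb\<bar> < ep" if "y \<in> cball xb rho" for y
      using d(2)[OF D[OF that]] that rho(2) by (simp add: dist_real_def dist_commute)
    have cS: "cball xb rho \<subseteq> cball 0 1" using D by fastforce
    have "\<exists>M1. \<forall>y\<in>cball 0 1. \<bar>u1 y\<bar> \<le> M1"
      unfolding u1_def by (rule perturb_bounded[OF compact_cball Mu])
    then obtain M1 where M1: "\<And>y. y \<in> cball 0 1 \<Longrightarrow> \<bar>u1 y\<bar> \<le> M1" by blast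
    show False
    proof (rule interior_no_max[OF F[OF sg] rho(1) usc_subset[OF usc1 cS] usc_subset[OF w cS]])
      fix y assume "y \<in> cball xb rho"
      then have y: "y \<in> cball 0 1" using cS by auto
      show "\<bar>u1 y\<bar> \<le> max M M1" "\<bar>w y\<bar> \<le> max M M1" using M1[OF y] Mw[OF y] by auto
      show "u1 y + w y \<le> u1 xb + w xb" by (rule xb(2)[OF y])
    next
      fix y p A assume y: "y \<in> ball xb rho" and q: "quad_above u1 y p A"
      have yD: "y \<in> ?D" using D y by auto
      obtain p' where p': "quad_above u y p' (A - smat (2 * eta))"
        using perturb_quad_above[OF q[unfolded u1_def] sym_smat _ sg] yD by auto
      then have s: "sym_mat (A - smat (2 * eta))" unfolding quad_above_def by simp
      have "fs sg y \<le> Fs sg (A - smat (2 * eta))" using sub[OF sg _ _ p'] yD by simp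
      moreover have "Fs sg (A - smat (2 * eta)) + lam * (2 * eta) \<le> Fs sg (A - smat (2 * eta) + smat (2 * eta))"
        by (rule ellip_smat(1)[OF F[OF sg] s]) (use eta in simp)
      moreover have "fs sg xb - ep < fs sg y" using fe[of y] y by (simp add: abs_less_iff)
      moreover have "lam * (2 * eta) = 4 * ep" "A - smat (2 * eta) + smat (2 * eta) = A" unfolding ep_def by simp_all
      ultimately show "fs sg xb + 3 * ep \<le> Fs sg A" by simp
    next
      fix y p A assume y: "y \<in> ball xb rho" and q: "quad_above w y p A"
      have "Fs sg (- A) \<le> fs sg y" using super[OF sg _ _ q] D[of y] y by simp
      moreover have "fs sg y < fs sg xb + ep" using fe[of y] y by (simp add: abs_less_iff)
      ultimately show "Fs sg (- A) \<le> fs sg xb + ep" by simp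
    qed (use ep in simp)
  next
    case True
    have xbT: "xb \<in> Tflat k" unfolding Tflat_def using xbB True by simp
    define K' where "K' = max K 0"
    \<comment> \<open>The normal Hessian gains \<open>2 * lam * B\<close>, which has to lift
      \<open>- K'\<close> to \<open>K' + 1\<close> and to pay \<open>2 * Lam\<close> for the term
      \<open>- (norm (x - xb))\<^sup>2\<close>.\<close>
    define B where "B = (2 * K' + 1 + 2 * Lam) / (2 * lam)"
    have B: "B > 0" "2 * lam * B = 2 * K' + 1 + 2 * Lam" unfolding B_def K'_def using lam by auto
    obtain d where d: "d > 0" "\<And>y. y \<in> Tflat k \<Longrightarrow> dist y xb < d \<Longrightarrow> dist (g y) (g xb) < eta/4"
      using gc xbT eta unfolding continuous_on_iff by (metis zero_less_divide_iff zero_less_numeral)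
    \<comment> \<open>Within distance \<open>eta / (2 * B)\<close> of the interface, half of the
      kink in \<open>u1\<close> dominates \<open>B * (x $ k)\<^sup>2\<close>. The other half is kept
      in \<open>u3\<close> as a strict excess in the jump.\<close>
    define rho where "rho = min (min (d/2) ((1 - norm xb)/2)) (eta / (2 * B))"
    have rho: "rho > 0" "rho < d" "rho < 1 - norm xb" "rho \<le> eta / (2 * B)"
      unfolding rho_def using d(1) \<open>0 < 1 - norm xb\<close> eta B(1) by (auto simp: min_less_iff_disj)
    have Br: "B * rho \<le> eta / 2" using rho(4) B(1) by (simp add: field_simps)
    have bS: "cball xb rho \<subseteq> ball 0 1" by (rule ballsub[OF rho(3)])
    then have cS: "cball xb rho \<subseteq> cball 0 1" by auto
    have bB: "y \<in> ball 0 1" if "y \<in> ball xb rho" for y using bS ball_subset_cball that by blast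
    define P where "P = smat (2 * eta - 2) + (2 * B) *\<^sub>R kk_mat k"
    have sP: "sym_mat P" unfolding P_def by (intro sym_mat_add sym_smat sym_kk_mat)
    \<comment> \<open>The constant and linear coefficients complete the square in
      \<open>- (norm (x - xb))\<^sup>2\<close>, which makes the maximum at \<open>xb\<close>
      strict.\<close>
    define u3 where "u3 = perturb k (- (norm xb)\<^sup>2) (2 *\<^sub>R xb) P (eta/2) u"
    have u3: "u3 x = u x + eta * (norm x)\<^sup>2 - (norm (x - xb))\<^sup>2 + B * (x $ k)\<^sup>2 + eta/2 * \<bar>x $ k\<bar>" for x
    proof -
      have "(norm (x - xb))\<^sup>2 = (norm x)\<^sup>2 - 2 * (xb \<bullet> x) + (norm xb)\<^sup>2"
        unfolding power2_norm_eq_inner by (simp add: algebra_simps inner_commute)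
      moreover have "x \<bullet> (P *v x) = (2 * eta - 2) * (norm x)\<^sup>2 + 2 * B * (x $ k)\<^sup>2"
        unfolding P_def
        by (simp add: matrix_vector_mult_add_rdistrib smat_mult scaleR_kk_mat_mult inner_add_right inner_unit_vec
            dot_square_norm power2_eq_square[of "x $ k"] algebra_simps)
      ultimately show ?thesis unfolding u3_def perturb_def quad_def by (simp add: algebra_simps)
    qed
    have usc3: "usc (cball xb rho) u3" unfolding u3_def by (rule usc_perturb[OF usc_subset[OF u cS]])
    have "\<exists>M3. \<forall>y\<in>cball xb rho. \<bar>u3 y\<bar> \<le> M3"
      unfolding u3_def by (rule perturb_bounded[OF compact_cball Mu]) (rule subsetD[OF cS])
    then obtain M3 where M3: "\<And>y. y \<in> cball xb rho \<Longrightarrow> \<bar>u3 y\<bar> \<le> M3" by blast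
    show False
    proof (rule no_interface_max[OF F rho(1) _ True usc3 usc_subset[OF w cS], where K = K'])
      show "K' \<ge> 0" unfolding K'_def by simp
    next
      fix y assume "y \<in> cball xb rho"
      then show "\<bar>u3 y\<bar> \<le> max M M3" "\<bar>w y\<bar> \<le> max M M3" using M3[of y] Mw[of y] cS by auto
    next
      fix sg y p A assume sg: "sg = 1 \<or> sg = - 1" and y: "y \<in> ball xb rho" "0 < sg * y $ k" and q: "quad_above u3 y p A"
      have yB: "y \<in> ball 0 1" by (rule bB[OF y(1)])
      have A: "sym_mat A" using q unfolding quad_above_def by simp
      obtain p' where p': "quad_above u y p' (A - P)"
        using perturb_quad_above[OF q[unfolded u3_def] sP y(2) sg] by blast
      then have s: "sym_mat (A - P)" unfolding quad_above_def by simp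
      let ?N = "(2 * B) *\<^sub>R kk_mat k :: real^'n^'n" and ?F = "Fs sg"
      have 1: "- K' \<le> ?F (A - P)"
        using sub[OF sg yB y(2) p'] fK[OF sg yB y(2)] unfolding K'_def by (simp add: abs_le_iff max_def)
      have "lam * mat_norm ?N \<le> ?F (A - P + ?N) - ?F (A - P)"
        using F[OF sg] s sym_kk_mat psd_kk_mat[of "2 * B" k] B(1) unfolding ellip_class_def by auto
      moreover have "lam * (2 * B) \<le> lam * mat_norm ?N"
        using mat_norm_kk_mat[of "2 * B" k] B(1) lam(1) by (intro mult_left_mono) auto
      ultimately have 2: "?F (A - P) + 2 * lam * B \<le> ?F (A - P + ?N)" by simp
      have sN: "sym_mat (A - P + ?N)" by (rule sym_mat_add[OF s sym_kk_mat])
      have "?F (A - P + ?N) \<le> ?F (A - P + ?N + smat (2 * eta))"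
        by (rule ellip_mono[OF F[OF sg] sN sym_smat psd_smat]) (use eta in simp)
      also have "A - P + ?N + smat (2 * eta) = A + smat 2"
        unfolding P_def smat_def by (simp add: algebra_simps)
      also have "?F (A + smat 2) \<le> ?F A + Lam * 2" by (rule ellip_smat(2)[OF F[OF sg] A]) simp
      finally show "K' + 1 \<le> ?F A" using 1 2 B(2) by linarith
    next
      fix sg y p A assume sg: "sg = 1 \<or> sg = - 1" and y: "y \<in> ball xb rho" "0 < sg * y $ k" and q: "quad_above w y p A"
      have yB: "y \<in> ball 0 1" by (rule bB[OF y(1)])
      show "Fs sg (- A) \<le> K'"
        using super[OF sg yB y(2) q] fK[OF sg yB y(2)] unfolding K'_def by (simp add: abs_le_iff max_def)
    next
      fix y assume y: "y \<in> ball xb rho" "y $ k = 0"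
      have yT: "y \<in> Tflat k" unfolding Tflat_def using bB[OF y(1)] y(2) by simp
      have ge: "\<bar>g y - g xb\<bar> < eta/4" using d(2)[OF yT] y(1) rho(2) by (simp add: dist_real_def dist_commute)
      have weaken: "jump_ge k c f x" if "jump_ge k c' f x" "c \<le> c'" for c c' f and x :: "real^'n"
        using that unfolding jump_ge_def by (meson order_trans)
      \<comment> \<open>The kink of size \<open>eta/2\<close> raises the jump by \<open>eta\<close>;
        the oscillation of \<open>g\<close> takes \<open>eta/4\<close> from each of the two
        conditions, so the sum remains positive.\<close>
      show "jump_ge k (g xb + 3/4 * eta) u3 y"
      proof (rule weaken)
        show "jump_ge k (g y + 2 * (eta/2)) u3 y" unfolding u3_def by (rule perturb_jump[OF ju[OF yT] sP y(2)])
      qed (use ge in linarith)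
      show "jump_ge k (- g xb - eta/4) w y"
        by (rule weaken[OF jw[OF yT]]) (use ge in linarith)
    next
      show "g xb + 3/4 * eta + (- g xb - eta/4) > 0" using eta by simp
    next
      fix y assume y: "y \<in> cball xb rho" "y \<noteq> xb"
      have "\<bar>y $ k\<bar> \<le> rho"
        using component_le_norm_cart[of "y - xb" k] y(1) True by (simp add: dist_norm norm_minus_commute)
      then have "B * (\<bar>y $ k\<bar> * \<bar>y $ k\<bar>) \<le> B * (rho * \<bar>y $ k\<bar>)"
        using B(1) by (intro mult_left_mono mult_right_mono) auto
      also have "\<dots> = B * rho * \<bar>y $ k\<bar>" by simp
      also have "\<dots> \<le> eta/2 * \<bar>y $ k\<bar>" using Br by (rule mult_right_mono) simp
      finally have "B * (y $ k)\<^sup>2 \<le> eta/2 * \<bar>y $ k\<bar>" by (simp add: power2_eq_square)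
      moreover have "eta * \<bar>y $ k\<bar> = eta/2 * \<bar>y $ k\<bar> + eta/2 * \<bar>y $ k\<bar>" by simp
      moreover have "(norm (y - xb))\<^sup>2 > 0" using y(2) by simp
      ultimately have "u3 y < u1 y" unfolding u3 u1 by linarith
      moreover have "u1 y + w y \<le> u1 xb + w xb" using y(1) cS by (intro xb(2)) auto
      moreover have "u1 xb = u3 xb" unfolding u1 u3 True by simp
      ultimately show "u3 y + w y < u3 xb + w xb" by linarith
    qed
  qed
qed

theorem mainTheorem13:
  fixes k :: "'n::finite" and lam Lam :: real
    and Fp Fm :: "real^'n^'n \<Rightarrow> real"
    and fp fm g u v :: "real^'n \<Rightarrow> real"
  assumes "ellip_class lam Lam Fp" and "ellip_class lam Lam Fm"
    and "continuous_on (Bplus k) fp" and "bounded (fp ` Bplus k)"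
    and "continuous_on (Bminus k) fm" and "bounded (fm ` Bminus k)"
    and "continuous_on (Tflat k) g"
    and "bounded (u ` cball 0 1)" and "usc_on (cball 0 1) u"
    and "bounded (v ` cball 0 1)" and "lsc_on (cball 0 1) v"
    and "visc_sub k Fp Fm fp fm g u"
    and "visc_super k Fp Fm fp fm g v"
    and "\<forall>x\<in>sphere 0 1. u x \<le> v x"
  shows "\<forall>x\<in>ball 0 1. u x \<le> v x"
proof
  fix z :: "real^'n" assume z: "z \<in> ball 0 1"
  define Fs where "Fs sg = (if sg = (1::real) then Fp else Fm)" for sg
  define fs where "fs sg = (if sg = (1::real) then fp else fm)" for sg
  define D where "D sg = {x :: real^'n \<in> ball 0 1. 0 < sg * x $ k}" for sg :: real
  have D: "D 1 = Bplus k" "D (- 1) = Bminus k" unfolding D_def Bplus_def Bminus_def by auto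
  obtain K1 K2 where K: "\<And>x. x \<in> Bplus k \<Longrightarrow> \<bar>fp x\<bar> \<le> K1" "\<And>x. x \<in> Bminus k \<Longrightarrow> \<bar>fm x\<bar> \<le> K2"
    using assms(4,6) unfolding bounded_iff by auto
  obtain M1 where M1: "\<forall>x\<in>u ` cball 0 1. norm x \<le> M1" using assms(8) unfolding bounded_iff by blast
  obtain M2 where M2: "\<forall>x\<in>v ` cball 0 1. norm x \<le> M2" using assms(10) unfolding bounded_iff by blast
  have M: "\<bar>u x\<bar> \<le> M1" "\<bar>v x\<bar> \<le> M2" if "x \<in> cball 0 1" for x using M1 M2 that by simp_all
  have "u z + - v z \<le> 0"
  proof (rule comparison_halves[where Fs = Fs and fs = fs and k = k and K = "max K1 K2" and M = "max M1 M2" and lam = lam and Lam = Lam and g = g])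
    show "ellip_class lam Lam (Fs sg)" if "sg = 1 \<or> sg = - 1" for sg using assms(1,2) unfolding Fs_def by auto
    show "continuous_on {x \<in> ball 0 1. 0 < sg * x $ k} (fs sg)" if "sg = 1 \<or> sg = - 1" for sg
      unfolding D_def[symmetric] using that assms(3,5) D unfolding fs_def by auto
    show "\<bar>fs sg x\<bar> \<le> max K1 K2" if "sg = 1 \<or> sg = - 1" "x \<in> ball 0 1" "0 < sg * x $ k" for sg x
    proof -
      have "x \<in> D sg" unfolding D_def using that by simp
      then show ?thesis using that(1) K D unfolding fs_def by (auto simp: le_max_iff_disj)
    qed
    show "fs sg x \<le> Fs sg A" if "sg = 1 \<or> sg = - 1" "x \<in> ball 0 1" "0 < sg * x $ k" "quad_above u x p A" for sg x p A
    proof -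
      have "x \<in> D sg" unfolding D_def using that by simp
      then show ?thesis using that(1) D visc_sub_quad_above[OF assms(12) that(4)] unfolding fs_def Fs_def by auto
    qed
    show "Fs sg (- A) \<le> fs sg x" if "sg = 1 \<or> sg = - 1" "x \<in> ball 0 1" "0 < sg * x $ k" "quad_above (\<lambda>x. - v x) x p A" for sg x p A
    proof -
      have "x \<in> D sg" unfolding D_def using that by simp
      then show ?thesis using that(1) D visc_super_quad_above[OF assms(13) that(4)] unfolding fs_def Fs_def by auto
    qed
    show "usc (cball 0 1) u" using assms(9) unfolding usc_on_def usc_def .
    show "usc (cball 0 1) (\<lambda>x. - v x)"
      using assms(11) unfolding lsc_on_def usc_def by (fastforce simp: algebra_simps)
    show "\<bar>u y\<bar> \<le> max M1 M2" "\<bar>- v y\<bar> \<le> max M1 M2" if "y \<in> cball 0 1" for y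
      using M[OF that] by (auto simp: le_max_iff_disj)
    show "u x + - v x \<le> 0" if "x \<in> sphere 0 1" for x using assms(14) that by simp
  qed (use assms(7) visc_sub_jump[OF assms(12)] visc_super_jump[OF assms(13)] z in auto)
  then show "u z \<le> v z" by simp
qed

end
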